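(* Let $d\ge 1$ and let $c_d$ be the entire function such that $X\mapsto c_d(|X|^2)$, $X=(x,\xi)\in\mathbf R^{2d}$, is the Weyl symbol of the inverse of the harmonic oscillator $H=-\Delta+|x|^2$ on $\mathbf R^d$. Then $$c_d(t)=\frac{d!!}{d}\left(\alpha\sum_{p=0}^\infty\frac{t^{2p}}{(2p)!!\,(2p+d-1)!!}-\sum_{p=0}^\infty\frac{t^{2p+1}}{(2p+1)!!\,(2p+d)!!}\right),$$ where $\alpha=1$ when $d$ is even, and $\alpha=\pi/2$ when $d$ is odd.
   Context: Semifactorials: $0!!=1$, $1!!=1$, $k!!=k\cdot(k-2)!!$ for $k\ge2$. The harmonic oscillator $H=-\Delta+|x|^2$ on $\mathbf R^d$ is strictly positive on $L^2(\mathbf R^d)$ and invertible. The Weyl symbol of $H^{-1}$ is the (unique, smooth) function $b_d$ on $\mathbf R^{2d}$ such that, in the sense of Weyl quantization (oscillatory integrals), $$H^{-1}f(x)=(2\pi)^{-d}\iint e^{i\langle x-y,\xi\rangle}\,b_d\big((x+y)/2,\xi\big)f(y)\,dy\,d\xi,\qquad f\in\mathscr S(\mathbf R^d).$$ This symbol is of the form $b_d(X)=c_d(|X|^2)$ for a unique entire function $c_d$ on $\mathbf C$. *)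

theory Defs
  imports "HOL-Analysis.Analysis"
begin

fun semifactorial :: "nat \<Rightarrow> nat" where
  "semifactorial 0 = 1"
| "semifactorial (Suc 0) = 1"
| "semifactorial (Suc (Suc k)) = Suc (Suc k) * semifactorial k"

(* The list [v1, ..., vk] of directions plays the role of a multi-index; the result is the
   iterated directional derivative of f along v1, ..., vk. *)
fun iter_deriv :: "'a::euclidean_space list \<Rightarrow> ('a \<Rightarrow> complex) \<Rightarrow> 'a \<Rightarrow> complex" where
  "iter_deriv [] f = f"
| "iter_deriv (v # vs) f = (\<lambda>x. frechet_derivative (iter_deriv vs f) (at x) v)"

(* Differentiability of every iterated partial derivative makes all of them continuous, so this
   is the class of C^infinity functions. *)
definition smooth :: "('a::euclidean_space \<Rightarrow> complex) \<Rightarrow> bool" where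
  "smooth f \<longleftrightarrow> (\<forall>vs. set vs \<subseteq> Basis \<longrightarrow> (\<forall>x. iter_deriv vs f differentiable (at x)))"

definition schwartz :: "('a::euclidean_space \<Rightarrow> complex) set" where
  "schwartz = {f. smooth f \<and>
     (\<forall>vs. set vs \<subseteq> Basis \<longrightarrow>
        (\<forall>n::nat. \<exists>C. \<forall>x. (1 + norm x) ^ n * cmod (iter_deriv vs f x) \<le> C))}"

(* Smooth functions all of whose derivatives are bounded by one fixed power of 1 + |X|, the
   exponent not depending on the order of the derivative. This is the standard class of
   amplitudes for which the oscillatory integral defining the Weyl quantization converges. *)
definition symbol_class :: "('a::euclidean_space \<Rightarrow> complex) set" where
  "symbol_class = {b. smooth b \<and>
     (\<exists>m::nat. \<forall>vs. set vs \<subseteq> Basis \<longrightarrow>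
        (\<exists>C. \<forall>X. cmod (iter_deriv vs b X) \<le> C * (1 + norm X) ^ m))}"

(* v is the oscillatory integral of a: the integrals regularized by a cut-off h (eps z), with
   h a Schwartz function and h 0 = 1, tend to v as eps tends to 0 from the right, whatever
   the cut-off. *)
definition has_oscillatory_integral ::
    "('a::euclidean_space \<Rightarrow> complex) \<Rightarrow> complex \<Rightarrow> bool" where
  "has_oscillatory_integral a v \<longleftrightarrow>
     (\<forall>h\<in>schwartz. h 0 = 1 \<longrightarrow>
        (\<forall>\<epsilon>>0. integrable lborel (\<lambda>z. h (\<epsilon> *\<^sub>R z) * a z)) \<and>
        ((\<lambda>\<epsilon>. LINT z|lborel. h (\<epsilon> *\<^sub>R z) * a z) \<longlongrightarrow> v) (at_right 0))"

(* The integration variable is the pair (y, xi). *)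
definition weyl_integrand ::
    "('a::euclidean_space \<times> 'a \<Rightarrow> complex) \<Rightarrow> ('a \<Rightarrow> complex) \<Rightarrow> 'a \<Rightarrow> 'a \<times> 'a \<Rightarrow> complex" where
  "weyl_integrand b f x = (\<lambda>(y, \<xi>).
     exp (\<i> * of_real ((x - y) \<bullet> \<xi>)) * b ((1 / 2) *\<^sub>R (x + y), \<xi>) * f y)"

definition has_weyl_quantization ::
    "('a::euclidean_space \<times> 'a \<Rightarrow> complex) \<Rightarrow> ('a \<Rightarrow> complex) \<Rightarrow> ('a \<Rightarrow> complex) \<Rightarrow> bool" where
  "has_weyl_quantization b f u \<longleftrightarrow>
     (\<forall>x. \<exists>v. has_oscillatory_integral (weyl_integrand b f x) v \<and>
          u x = of_real (1 / (2 * pi) ^ DIM('a)) * v)"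

definition square_integrable :: "('a::euclidean_space \<Rightarrow> complex) set" where
  "square_integrable = {u. u \<in> borel_measurable lborel \<and> integrable lborel (\<lambda>x. (cmod (u x))\<^sup>2)}"

definition laplacian :: "('a::euclidean_space \<Rightarrow> complex) \<Rightarrow> 'a \<Rightarrow> complex" where
  "laplacian f x = (\<Sum>i\<in>Basis. iter_deriv [i, i] f x)"

definition oscillator_expr :: "('a::euclidean_space \<Rightarrow> complex) \<Rightarrow> 'a \<Rightarrow> complex" where
  "oscillator_expr f x = - laplacian f x + of_real ((norm x)\<^sup>2) * f x"

(* Graph of the harmonic oscillator H as an unbounded operator on L^2: u lies in the domain and
   H u = g iff u and g are square integrable and - Laplacian u + |x|^2 u = g in the sense of
   tempered distributions. (The expression is essentially self-adjoint on Schwartz functions, so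
   this maximal realization is the self-adjoint one.) Elements of L^2 are given by
   representatives, hence a relation and not a function. *)
definition harmonic_oscillator ::
    "('a::euclidean_space \<Rightarrow> complex) \<Rightarrow> ('a \<Rightarrow> complex) \<Rightarrow> bool" where
  "harmonic_oscillator u g \<longleftrightarrow>
     u \<in> square_integrable \<and> g \<in> square_integrable \<and>
     (\<forall>\<phi>\<in>schwartz. (LINT x|lborel. u x * oscillator_expr \<phi> x) = (LINT x|lborel. g x * \<phi> x))"

(* T f u says that u represents the image of f under an operator on L^2. *)
definition is_weyl_symbol ::
    "('a::euclidean_space \<times> 'a \<Rightarrow> complex) \<Rightarrow> (('a \<Rightarrow> complex) \<Rightarrow> ('a \<Rightarrow> complex) \<Rightarrow> bool) \<Rightarrow> bool" where
  "is_weyl_symbol b T \<longleftrightarrow>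
     b \<in> symbol_class \<and> (\<forall>f\<in>schwartz. \<exists>u. T f u \<and> has_weyl_quantization b f u)"

(* Inverse of the relation above: u represents the L^2 class of the preimage of f under H. *)
definition harmonic_oscillator_inverse ::
    "('a::euclidean_space \<Rightarrow> complex) \<Rightarrow> ('a \<Rightarrow> complex) \<Rightarrow> bool" where
  "harmonic_oscillator_inverse f u \<longleftrightarrow> harmonic_oscillator u f"

end

theory Submission
  imports Defs "HOL-Probability.Probability" "HOL-Complex_Analysis.Complex_Analysis"
begin

text \<open>Write \<open>b X = c (|X|\<^sup>2)\<close> and \<open>f\<^sub>w x = e\<^bsup>-|x|\<^sup>2/2 + iw\<bullet>x\<^esup>\<close>. Testing \<open>H (b\<^sup>w f\<^sub>w) = f\<^sub>w\<close> against \<open>f\<^sub>w\<close>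
  and computing the Wigner function of \<open>H f\<^sub>w\<close> and \<open>f\<^sub>w\<close> gives, for every \<open>w\<close>,
  \<open>\<integral> b (x, \<xi>) (d + |w|\<^sup>2 + 2i w\<bullet>x) e\<^bsup>-|x|\<^sup>2 - |\<xi>|\<^sup>2 + 2i w\<bullet>x\<^esup> dx d\<xi> = \<pi>\<^sup>d e\<^bsup>-|w|\<^sup>2\<^esup>\<close>.
  The oscillatory integral is handled by integrating by parts in \<open>y\<close>, which gives decay in \<open>\<xi>\<close>.
  The function \<open>b X = \<integral> (cos \<theta>)\<^bsup>d-1\<^esup> e\<^bsup>-|X|\<^sup>2 sin \<theta>\<^esup> d\<theta>\<close> over \<open>0 \<le> \<theta> \<le> \<pi>/2\<close> satisfies the same identity.
  For the difference of two radial solutions, integrating the identity for \<open>t w\<close> over \<open>0 \<le> t \<le> 1\<close> with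
  weight \<open>t\<^bsup>d-1\<^esup> e\<^bsup>t\<^sup>2|w|\<^sup>2/2\<^esup>\<close> shows that the Fourier transform of \<open>b X e\<^bsup>-|X|\<^sup>2\<^esup>\<close> vanishes at \<open>(2w, 0)\<close>, hence
  everywhere by rotation invariance. So \<open>c\<close> agrees with the \<open>\<theta>\<close>-integral on the half line and, both
  being entire, everywhere; its Taylor coefficients are Wallis integrals.\<close>

section \<open>Gaussian integrals and invariance of Lebesgue measure\<close>

text \<open>Along a ray the identity is a first order ODE. Put g(w) = integral of b e^(-|X|^2 + 2i
  w.x). The factor 2i w.x acts on it as w.grad, so g(t w) satisfies t g' + (d + t^2 |w|^2) g = right
  side, with integrating factor t^(d-1) e^(t^2 |w|^2 / 2). The homogeneous solutions t^(-d) e^(-t^2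
  |w|^2 / 2) are singular at t = 0, where g is bounded: hence uniqueness. The pairing is bilinear,
  without conjugation, so only the frequencies (2w, 0) are reached; radiality of b supplies the
  others. The candidate comes from H^(-1) = integral of e^(-tH) over t >= 0 and Mehler's formula.
  Since c is assumed to give the symbol, it suffices that the candidate obeys the same scalar
  identity. The analytic obstacle is that b may grow polynomially in xi, so the Weyl integral need
  not converge absolutely. That \<open>symbol_class\<close> has one growth exponent for all
  derivatives lets arbitrarily many y-derivatives fall on the amplitude without losing powers of
  xi.\<close>

lemma
  fixes f :: "'a::euclidean_space \<Rightarrow> real \<Rightarrow> 'b::{real_normed_field, banach, second_countable_topology}"
  assumes f: "\<And>b. b \<in> Basis \<Longrightarrow> integrable lborel (f b)"
  shows integrable_lborel_prod: "integrable lborel (\<lambda>x::'a. \<Prod>b\<in>Basis. f b (x \<bullet> b))"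
    and integral_lborel_prod:
      "(LINT x|lborel. (\<Prod>b\<in>Basis. f b (x \<bullet> b))) = (\<Prod>b\<in>Basis. integral\<^sup>L lborel (f b))"
proof -
  interpret product_sigma_finite "\<lambda>_::'a. lborel :: real measure" ..
  have m[measurable]: "\<And>b. b \<in> Basis \<Longrightarrow> f b \<in> borel_measurable borel"
    using borel_measurable_integrable[OF f] by simp
  have m2: "(\<lambda>x::'a. \<Prod>b\<in>Basis. f b (x \<bullet> b)) \<in> borel_measurable borel"
    by measurable
  have T: "(\<lambda>f. \<Sum>b\<in>Basis. f b *\<^sub>R b) \<in> (\<Pi>\<^sub>M b\<in>Basis. lborel) \<rightarrow>\<^sub>M (borel :: 'a measure)"
    by measurable
  have eq: "(\<Prod>b\<in>Basis. f b ((\<Sum>c\<in>Basis. x c *\<^sub>R c) \<bullet> b)) = (\<Prod>b\<in>Basis. f b (x b))" for x :: "'a \<Rightarrow> real"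
    by (intro prod.cong refl) simp
  show "integrable lborel (\<lambda>x::'a. \<Prod>b\<in>Basis. f b (x \<bullet> b))"
    apply (subst lborel_eq)
    unfolding integrable_distr_eq[OF T m2] eq
    by (rule product_integrable_prod) (auto intro: f)
  show "(LINT x|lborel. (\<Prod>b\<in>Basis. f b (x \<bullet> b))) = (\<Prod>b\<in>Basis. integral\<^sup>L lborel (f b))"
    apply (subst lborel_eq)
    unfolding integral_distr[OF T m2] eq
    by (rule product_integral_prod) (auto intro: f)
qed

lemma
  fixes f :: "'a::euclidean_space \<Rightarrow> 'b::{banach, second_countable_topology}"
  assumes m[measurable]: "f \<in> borel_measurable borel" and c: "c \<noteq> 0"
  shows integrable_lborel_affine: "integrable lborel (\<lambda>x. f (t + c *\<^sub>R x)) \<longleftrightarrow> integrable lborel f"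
    and integral_lborel_affine:
      "(LINT x|lborel. f x) = \<bar>c\<bar> ^ DIM('a) *\<^sub>R (LINT x|lborel. f (t + c *\<^sub>R x))"
proof -
  have eq: "integral\<^sup>L lborel f = integral\<^sup>L (density (distr lborel borel (\<lambda>x. t + c *\<^sub>R x)) (\<lambda>x. ennreal (\<bar>c\<bar> ^ DIM('a)))) f"
    "integrable lborel f = integrable (density (distr lborel borel (\<lambda>x. t + c *\<^sub>R x)) (\<lambda>x. ennreal (\<bar>c\<bar> ^ DIM('a)))) f"
    using lborel_affine[OF c, of t] by simp_all
  show "integrable lborel (\<lambda>x. f (t + c *\<^sub>R x)) \<longleftrightarrow> integrable lborel f"
  proof -
    have "integrable lborel (\<lambda>x. \<bar>c\<bar> ^ DIM('a) *\<^sub>R f (t + c *\<^sub>R x)) \<longleftrightarrow> integrable lborel (\<lambda>x. f (t + c *\<^sub>R x))"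
      using integrable_scaleR_right[of "inverse (\<bar>c\<bar> ^ DIM('a))" lborel "\<lambda>x. \<bar>c\<bar> ^ DIM('a) *\<^sub>R f (t + c *\<^sub>R x)"] c
      by auto
    then show ?thesis unfolding eq by (subst integrable_density) (auto simp: integrable_distr_eq)
  qed
  show "(LINT x|lborel. f x) = \<bar>c\<bar> ^ DIM('a) *\<^sub>R (LINT x|lborel. f (t + c *\<^sub>R x))"
    unfolding eq by (subst integral_density) (auto simp: integral_distr)
qed

lemma
  fixes f :: "'a::euclidean_space \<Rightarrow> 'b::{banach, second_countable_topology}"
  assumes m[measurable]: "f \<in> borel_measurable borel"
  shows integrable_lborel_translate: "integrable lborel (\<lambda>x. f (t + x)) \<longleftrightarrow> integrable lborel f"
    and integral_lborel_translate: "(LINT x|lborel. f (t + x)) = (LINT x|lborel. f x)"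
  using integrable_lborel_affine[OF m, of 1 t] integral_lborel_affine[OF m, of 1 t] by simp_all

section \<open>Gaussians with a linear phase\<close>

lemma
  fixes k v :: real
  assumes k: "k > 0"
  shows integrable_gaussian_real: "integrable lborel (\<lambda>x::real. exp (of_real (- k * x\<^sup>2) + \<i> * of_real (v * x)))"
    and integral_gaussian_real:
      "(LINT x|lborel. exp (of_real (- k * x\<^sup>2) + \<i> * of_real (v * x))) = complex_of_real (sqrt (pi / k) * exp (- v\<^sup>2 / (4 * k)))"
proof -
  \<comment> \<open>The dilation by \<open>s\<close> carries exp (-k x^2) to the standard normal
    density, so the integral is the characteristic function of the latter at
    \<open>v / s\<close>.\<close>
  define s where "s = sqrt (2 * k)"
  have s: "s > 0" "s\<^sup>2 = 2 * k" using k by (auto simp: s_def)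
  define g where "g = (\<lambda>x::real. exp (\<i> * of_real (v / s * x)) * complex_of_real (std_normal_density x))"
  have gm: "g \<in> borel_measurable borel" unfolding g_def by measurable
  have gi: "integrable lborel g"
  proof (rule Bochner_Integration.integrable_bound[OF integrable_normal_density[of 1 0]])
    show "AE x in lborel. norm (g x) \<le> norm (std_normal_density x)"
      by (simp add: g_def norm_mult)
  qed (use gm in auto)
  have "integral\<^sup>L lborel g = char std_normal_distribution (v / s)"
    unfolding char_def g_def
    by (subst integral_density) (auto simp: scaleR_conv_of_real mult_ac)
  also have "\<dots> = complex_of_real (exp (- ((v / s)\<^sup>2) / 2))"
    by (simp add: char_std_normal_distribution)
  also have "- ((v/s)\<^sup>2) / 2 = - v\<^sup>2 / (4 * k)" using s by (simp add: power_divide)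
  finally have gI: "integral\<^sup>L lborel g = complex_of_real (exp (- v\<^sup>2 / (4 * k)))" by simp
  have eq: "exp (of_real (- k * x\<^sup>2) + \<i> * of_real (v * x)) = of_real (sqrt (2 * pi)) * g (0 + s *\<^sub>R x)" for x
  proof -
    have "(s * x)\<^sup>2 / 2 = k * x\<^sup>2" by (simp add: power_mult_distrib s)
    then have "complex_of_real (std_normal_density (s * x)) = exp (of_real (- k * x\<^sup>2)) / of_real (sqrt (2 * pi))"
      by (simp add: std_normal_density_def flip: exp_of_real)
    then show ?thesis using s by (simp add: g_def exp_diff exp_minus field_simps)
  qed
  show "integrable lborel (\<lambda>x::real. exp (of_real (- k * x\<^sup>2) + \<i> * of_real (v * x)))"
    unfolding eq using integrable_lborel_affine[OF gm, of s 0] s gi by simp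
  have "(LINT x|lborel. g (0 + s *\<^sub>R x)) = of_real (exp (- v\<^sup>2 / (4 * k))) / of_real s"
    using integral_lborel_affine[OF gm, of s 0] s gI by (simp add: scaleR_conv_of_real field_simps)
  moreover have "sqrt (2 * pi) / s = sqrt (pi / k)"
    using k by (simp add: s_def real_sqrt_divide real_sqrt_mult)
  ultimately show "(LINT x|lborel. exp (of_real (- k * x\<^sup>2) + \<i> * of_real (v * x))) = complex_of_real (sqrt (pi / k) * exp (- v\<^sup>2 / (4 * k)))"
    unfolding eq by (simp only: integral_mult_right_zero flip: of_real_mult of_real_divide)
      (metis times_divide_eq_left times_divide_eq_right)
qed

lemma norm_sq_eq_sum_inner: "(norm (x::'a::euclidean_space))\<^sup>2 = (\<Sum>b\<in>Basis. (x \<bullet> b)\<^sup>2)"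
  unfolding power2_norm_eq_inner by (subst euclidean_inner) (simp add: power2_eq_square)

text \<open>Damping \<open>k\<close> and frequency \<open>v\<close> share one function, so that the
  plane wave of a Fourier integral (\<open>k = 0\<close>), the Gaussian cut-off
  (\<open>v = 0\<close>) and the test functions (\<open>k = 1 / 2\<close>) are instances of it, and
  products merely add the two parameters.\<close>

definition gauss :: "real \<Rightarrow> 'a::euclidean_space \<Rightarrow> 'a \<Rightarrow> complex" where
  "gauss k v x = exp (of_real (- k * (norm x)\<^sup>2) + \<i> * of_real (v \<bullet> x))"

lemma continuous_gauss [continuous_intros]:
  assumes "continuous_on S k" "continuous_on S v" "continuous_on S x"
  shows "continuous_on S (\<lambda>z. gauss (k z) (v z) (x z))"
  unfolding gauss_def using assms by (intro continuous_intros)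

lemma borel_measurable_gauss [measurable]:
  "gauss k v \<in> borel_measurable borel"
  by (intro borel_measurable_continuous_onI continuous_intros)

lemma gauss_at_0 [simp]: "gauss k v 0 = 1"
  by (simp add: gauss_def)

lemma norm_gauss: "norm (gauss k v x) = exp (- k * (norm x)\<^sup>2)"
  by (simp add: gauss_def)

lemma
  fixes v :: "'a::euclidean_space"
  assumes k: "k > 0"
  shows integrable_gauss: "integrable lborel (gauss k v)"
    and integral_gauss:
      "(LINT x|lborel. gauss k v x) = of_real (sqrt (pi / k) ^ DIM('a) * exp (- (norm v)\<^sup>2 / (4 * k)))"
proof -
  have eq: "gauss k v x = (\<Prod>b\<in>Basis. exp (of_real (- k * (x \<bullet> b)\<^sup>2) + \<i> * of_real ((v \<bullet> b) * (x \<bullet> b))))" for x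
  proof -
    have "of_real (- k * (norm x)\<^sup>2) + \<i> * of_real (v \<bullet> x) =
        (\<Sum>b\<in>Basis. complex_of_real (- k * (x \<bullet> b)\<^sup>2) + \<i> * of_real ((v \<bullet> b) * (x \<bullet> b)))"
      unfolding norm_sq_eq_sum_inner euclidean_inner[of v x]
      by (simp add: sum_subtractf sum_distrib_left sum_negf)
    then show ?thesis unfolding gauss_def by (simp only: exp_sum finite_Basis)
  qed
  show "integrable lborel (gauss k v)"
    unfolding eq[abs_def] by (rule integrable_lborel_prod) (rule integrable_gaussian_real[OF k])
  have "(LINT x|lborel. gauss k v x) =
      (\<Prod>b\<in>Basis. complex_of_real (sqrt (pi / k) * exp (- (v \<bullet> b)\<^sup>2 / (4 * k))))"
    unfolding eq using integral_gaussian_real[OF k]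
    by (subst integral_lborel_prod) (use integrable_gaussian_real[OF k] in auto)
  also have "\<dots> = of_real (sqrt (pi / k) ^ DIM('a) * exp (- (norm v)\<^sup>2 / (4 * k)))"
  proof -
    have "exp (- (norm v)\<^sup>2 / (4 * k)) = (\<Prod>b\<in>Basis. exp (- (v \<bullet> b)\<^sup>2 / (4 * k)))"
      unfolding norm_sq_eq_sum_inner by (simp add: sum_divide_distrib sum_negf flip: exp_sum)
    then show ?thesis by (simp add: prod.distrib)
  qed
  finally show "(LINT x|lborel. gauss k v x) = of_real (sqrt (pi / k) ^ DIM('a) * exp (- (norm v)\<^sup>2 / (4 * k)))" .
qed

section \<open>Integrable weights\<close>

lemma power_le_gaussian:
  fixes r k :: real
  assumes "k > 0" "r \<ge> 0"
  shows "(1 + r) ^ n \<le> exp (real n ^ 2 / (4 * k)) * exp (k * r\<^sup>2)"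
proof -
  have "(1 + r) ^ n \<le> exp r ^ n" using assms by (intro power_mono exp_ge_add_one_self) auto
  also have "\<dots> = exp (n * r)" by (simp add: exp_of_nat_mult)
  also have "\<dots> \<le> exp (real n ^ 2 / (4 * k) + k * r\<^sup>2)"
  proof -
    \<comment> \<open>Completing the square splits n r into n^2 / (4 k) and k r^2; the first term is
      the constant of the bound.\<close>
    have "0 \<le> (real n - 2 * k * r)\<^sup>2" by simp
    then have "4 * k * (n * r) \<le> real n ^ 2 + 4 * k * (k * r\<^sup>2)"
      by (simp add: power2_eq_square algebra_simps)
    then show ?thesis using assms by (simp add: field_simps)
  qed
  finally show ?thesis by (simp add: exp_add)
qed

lemma integrable_norm_gaussian:
  assumes k: "k > 0"
  shows "integrable lborel (\<lambda>x::'a::euclidean_space. exp (- k * (norm x)\<^sup>2))"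
  using integrable_norm[OF integrable_gauss[OF k, of "0::'a"]] by (simp add: norm_gauss)

lemma integrable_power_gaussian:
  assumes k: "k > 0"
  shows "integrable lborel (\<lambda>x::'a::euclidean_space. (1 + norm x) ^ n * exp (- k * (norm x)\<^sup>2))"
proof (rule Bochner_Integration.integrable_bound)
  \<comment> \<open>Half of the Gaussian absorbs the polynomial, the other half remains as an
    integrable majorant.\<close>
  show "integrable lborel (\<lambda>x::'a. exp (real n ^ 2 / (4 * (k/2))) * exp (- (k/2) * (norm x)\<^sup>2))"
    using integrable_norm_gaussian[of "k/2"] k by auto
  show "AE x in lborel. norm ((1 + norm (x::'a)) ^ n * exp (- k * (norm x)\<^sup>2))
      \<le> norm (exp (real n ^ 2 / (4 * (k/2))) * exp (- (k/2) * (norm x)\<^sup>2))"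
  proof (rule AE_I2)
    fix x :: 'a
    have "(1 + norm x) ^ n * exp (- k * (norm x)\<^sup>2) \<le>
       (exp (real n ^ 2 / (4 * (k/2))) * exp ((k/2) * (norm x)\<^sup>2)) * exp (- k * (norm x)\<^sup>2)"
      by (intro mult_right_mono power_le_gaussian) (use k in auto)
    also have "\<dots> = exp (real n ^ 2 / (4 * (k/2))) * exp (- (k/2) * (norm x)\<^sup>2)"
      by (simp add: mult.assoc flip: exp_add)
    finally show "norm ((1 + norm x) ^ n * exp (- k * (norm x)\<^sup>2))
      \<le> norm (exp (real n ^ 2 / (4 * (k/2))) * exp (- (k/2) * (norm x)\<^sup>2))"
      by (simp add: abs_mult)
  qed
qed measurable

text \<open>Of the N powers, m pay for the numerator through 1 + r <= 2 (1 + r^2), and DIM powers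
  dominate the product of 1 + (x.b)^2 over the coordinates, because |x.b| <= |x|. What is left is a
  product of one-dimensional integrals of 1 / (1 + x^2).\<close>

lemma integrable_inverse_one_plus_norm_sq:
  assumes N: "N \<ge> m + DIM('a)"
  shows "integrable lborel (\<lambda>x::'a::euclidean_space. (1 + norm x) ^ m / (1 + (norm x)\<^sup>2) ^ N)"
proof (rule Bochner_Integration.integrable_bound)
  have "integrable lborel (\<lambda>x::real. inverse (1 + x\<^sup>2))"
    using integrable_inverse_1_plus_square by (simp add: set_integrable_def)
  from integrable_lborel_prod[of "\<lambda>_. \<lambda>x. inverse (1 + x\<^sup>2)", OF this]
  show "integrable lborel (\<lambda>x::'a. 2 ^ m * (\<Prod>b\<in>Basis. inverse (1 + (x \<bullet> b)\<^sup>2)))" by simp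
  show "AE x::'a in lborel. norm ((1 + norm x) ^ m / (1 + (norm x)\<^sup>2) ^ N) \<le> norm (2 ^ m * (\<Prod>b\<in>Basis. inverse (1 + (x \<bullet> b)\<^sup>2)))"
  proof (rule AE_I2)
    fix x :: 'a
    have 1: "(1 + norm x) \<le> 2 * (1 + (norm x)\<^sup>2)"
    proof -
      have "norm x \<le> (norm x)\<^sup>2 + 1 / 4"
        using zero_le_power2[of "norm x - 1/2"] by (simp add: power2_eq_square algebra_simps)
      then show ?thesis using zero_le_power2[of "norm x"] by (simp only: distrib_left)
    qed
    have "(1 + norm x) ^ m \<le> (2 * (1 + (norm x)\<^sup>2)) ^ m" by (intro power_mono 1) auto
    then have "(1 + norm x) ^ m \<le> 2 ^ m * (1 + (norm x)\<^sup>2) ^ m" by (simp only: power_mult_distrib)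
    then have 2: "(1 + norm x) ^ m / (1 + (norm x)\<^sup>2) ^ N \<le> 2 ^ m * (1 + (norm x)\<^sup>2) ^ m / (1 + (norm x)\<^sup>2) ^ N"
      by (rule divide_right_mono) simp
    have "(1 + (norm x)\<^sup>2) ^ m * (1 + (norm x)\<^sup>2) ^ DIM('a) \<le> (1 + (norm x)\<^sup>2) ^ N"
      unfolding power_add[symmetric] by (rule power_increasing) (use N in auto)
    then have "(1 + (norm x)\<^sup>2) ^ m / (1 + (norm x)\<^sup>2) ^ N \<le> 1 / (1 + (norm x)\<^sup>2) ^ DIM('a)"
      by (simp add: field_simps add_pos_nonneg)
    then have 3: "2 ^ m * (1 + (norm x)\<^sup>2) ^ m / (1 + (norm x)\<^sup>2) ^ N \<le> 2 ^ m * (1 / (1 + (norm x)\<^sup>2) ^ DIM('a))"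
      by (metis mult_left_mono times_divide_eq_right zero_le_numeral zero_le_power)
    have "(\<Prod>b\<in>(Basis::'a set). (1 + (x \<bullet> b)\<^sup>2)) \<le> (\<Prod>b\<in>(Basis::'a set). (1 + (norm x)\<^sup>2))"
      by (intro prod_mono) (auto intro!: Basis_le_norm simp flip: abs_le_square_iff)
    then have "(\<Prod>b\<in>(Basis::'a set). (1 + (x \<bullet> b)\<^sup>2)) \<le> (1 + (norm x)\<^sup>2) ^ DIM('a)" by simp
    moreover have "(\<Prod>b\<in>(Basis::'a set). (1 + (x \<bullet> b)\<^sup>2)) > 0"
      by (intro prod_pos) (auto simp: add_pos_nonneg)
    ultimately have "1 / (1 + (norm x)\<^sup>2) ^ DIM('a) \<le> (\<Prod>b\<in>(Basis::'a set). inverse (1 + (x \<bullet> b)\<^sup>2))"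
      using prod_inversef[of "\<lambda>b. 1 + (x \<bullet> b)\<^sup>2" "Basis :: 'a set"]
      by (simp add: o_def inverse_eq_divide frac_le)
    then have "2 ^ m * (1 / (1 + (norm x)\<^sup>2) ^ DIM('a)) \<le> 2 ^ m * (\<Prod>b\<in>(Basis::'a set). inverse (1 + (x \<bullet> b)\<^sup>2))"
      by (rule mult_left_mono) simp
    with 2 3 have "(1 + norm x) ^ m / (1 + (norm x)\<^sup>2) ^ N \<le> 2 ^ m * (\<Prod>b\<in>(Basis::'a set). inverse (1 + (x \<bullet> b)\<^sup>2))"
      by linarith
    then show "norm ((1 + norm x) ^ m / (1 + (norm x)\<^sup>2) ^ N) \<le> norm (2 ^ m * (\<Prod>b\<in>Basis. inverse (1 + (x \<bullet> b)\<^sup>2)))"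
      by (simp add: abs_mult abs_prod)
  qed
qed measurable

text \<open>Averaging over the translates by s i with 0 <= s <= 1 leaves the integral of
  \<open>G'\<close> unchanged. By Fubini and the fundamental theorem it becomes the integral of G (y
  + i) - G y, which is 0 by translation invariance. Integrability thus replaces any discussion of
  boundary terms at infinity.\<close>

lemma integral_directional_derivative_eq_0:
  fixes G G' :: "'a::euclidean_space \<Rightarrow> complex"
  assumes G: "integrable lborel G" and G': "integrable lborel G'" and cont: "continuous_on UNIV G'"
    and der: "\<And>y. ((\<lambda>s. G (y + s *\<^sub>R i)) has_vector_derivative G' y) (at 0)"
  shows "(LINT y|lborel. G' y) = 0"
proof -
  have [measurable]: "G \<in> borel_measurable borel" "G' \<in> borel_measurable borel"
    using G G' borel_measurable_integrable by auto
  have der': "((\<lambda>s. G (y + s *\<^sub>R i)) has_vector_derivative G' (y + s *\<^sub>R i)) (at s within A)" for y s A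
  proof -
    have "((\<lambda>h. G ((y + s *\<^sub>R i) + h *\<^sub>R i)) has_vector_derivative G' (y + s *\<^sub>R i)) (at (s - s))"
      using der[of "y + s *\<^sub>R i"] by simp
    moreover have "((\<lambda>r. r - s) has_vector_derivative 1) (at s)"
      by (auto intro!: derivative_eq_intros)
    ultimately have "((\<lambda>h. G ((y + s *\<^sub>R i) + h *\<^sub>R i)) \<circ> (\<lambda>r. r - s) has_vector_derivative (1 *\<^sub>R G' (y + s *\<^sub>R i))) (at s)"
      by (intro vector_diff_chain_at)
    then have "((\<lambda>s. G (y + s *\<^sub>R i)) has_vector_derivative G' (y + s *\<^sub>R i)) (at s)"
      by (simp add: o_def algebra_simps)
    then show ?thesis by (rule has_vector_derivative_at_within)
  qed
  have ftc: "(LINT s|lborel. indicator {0..1} s *\<^sub>R G' (y + s *\<^sub>R i)) = G (y + i) - G y" for y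
  proof -
    have "continuous_on {0..1} (\<lambda>s. G' (y + s *\<^sub>R i))"
      by (rule continuous_on_compose2[OF cont]) (intro continuous_intros, simp)
    then show ?thesis
      using integral_FTC_atLeastAtMost[of 0 1 "\<lambda>s. G (y + s *\<^sub>R i)" "\<lambda>s. G' (y + s *\<^sub>R i)"] der' by simp
  qed
  have int: "integrable (lborel \<Otimes>\<^sub>M lborel) (\<lambda>(s::real, y). indicator {0..1} s *\<^sub>R G' (y + s *\<^sub>R i))"
  proof (rule lborel_pair.Fubini_integrable)
    show "integrable lborel (\<lambda>x::real. LBINT y. norm (case (x, y) of (s, y) \<Rightarrow> indicat_real {0..1} s *\<^sub>R G' (y + s *\<^sub>R i)))"
    proof -
      have "(LBINT y. norm (indicat_real {0..1} s *\<^sub>R G' (y + s *\<^sub>R i))) = indicator {0..1} s *\<^sub>R (LBINT y. norm (G' y))" for s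
        using integral_lborel_translate[of "\<lambda>y. norm (G' y)" "s *\<^sub>R i"]
        by (simp add: add.commute)
      moreover have "integrable lborel (\<lambda>s::real. indicator {0..1} s *\<^sub>R c)" for c :: real
        by simp
      ultimately show ?thesis by (simp only: prod.case)
    qed
    show "AE x::real in lborel. integrable lborel (\<lambda>y. case (x, y) of (s, y) \<Rightarrow> indicat_real {0..1} s *\<^sub>R G' (y + s *\<^sub>R i))"
    proof (intro AE_I2, unfold prod.case)
      fix s
      have "integrable lborel (\<lambda>y. G' (y + s *\<^sub>R i))"
        using G' integrable_lborel_translate[of G' "s *\<^sub>R i"] by (simp add: add.commute)
      then show "integrable lborel (\<lambda>y. indicat_real {0..1} s *\<^sub>R G' (y + s *\<^sub>R i))"
        by (rule integrable_scaleR_right)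
    qed
  qed measurable
  have "(LINT y|lborel. G' y) = (LINT s|lborel. indicator {0..1::real} s *\<^sub>R (LINT y|lborel. G' y))"
    by simp
  also have "\<dots> = (LINT s|lborel. LINT y|lborel. indicator {0..1::real} s *\<^sub>R G' (y + s *\<^sub>R i))"
  proof (intro Bochner_Integration.integral_cong refl)
    fix s :: real
    show "indicator {0..1} s *\<^sub>R (LINT y|lborel. G' y) = (LINT y|lborel. indicator {0..1::real} s *\<^sub>R G' (y + s *\<^sub>R i))"
      using integral_lborel_translate[of G' "s *\<^sub>R i"] by (simp add: add.commute)
  qed
  also have "\<dots> = (LINT y|lborel. LINT s|lborel. indicator {0..1::real} s *\<^sub>R G' (y + s *\<^sub>R i))"
    by (rule lborel_pair.Fubini_integral[symmetric]) (rule int)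
  also have "\<dots> = (LINT y|lborel. G (y + i) - G y)"
    by (simp only: ftc)
  also have "\<dots> = (LINT y|lborel. G (y + i)) - (LINT y|lborel. G y)"
    using G integrable_lborel_translate[of G i] by (intro Bochner_Integration.integral_diff) (simp_all add: add.commute)
  also have "\<dots> = 0"
    using integral_lborel_translate[of G i] by (simp add: add.commute)
  finally show ?thesis .
qed

text \<open>Uniqueness of Haar measure: a translation invariant measure that gives the Gaussian the same
  integral as Lebesgue measure coincides with it, by evaluating
  \<open>\<integral>\<integral> e\<^bsup>-|x|\<^sup>2\<^esup> h (x + y) d\<mu>(x) dy\<close> in both orders.\<close>

lemma distr_lborel_isometry:
  fixes T :: "'a::euclidean_space \<Rightarrow> 'a"
  assumes T: "orthogonal_transformation T"
  shows "distr lborel borel T = lborel"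
proof -
  have lin: "linear T" and nrm: "norm (T x) = norm x" for x
    using T by (auto simp: orthogonal_transformation)
  have surj: "surj T" using T by (simp add: orthogonal_transformation_surj)
  have [measurable]: "T \<in> borel_measurable borel"
    by (intro borel_measurable_continuous_onI linear_continuous_on linear_conv_bounded_linear[THEN iffD1] lin)
  define \<mu> where "\<mu> = distr lborel borel T"
  have sets[measurable_cong]: "sets \<mu> = sets borel" by (simp add: \<mu>_def)
  define g where "g = (\<lambda>x::'a. ennreal (exp (- (norm x)\<^sup>2)))"
  have [measurable]: "g \<in> borel_measurable borel" unfolding g_def by measurable
  have gT: "(\<integral>\<^sup>+x. g x \<partial>\<mu>) = (\<integral>\<^sup>+x. g x \<partial>lborel)"
    unfolding \<mu>_def by (subst nn_integral_distr) (auto simp: g_def nrm)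
  have "(\<integral>\<^sup>+x. g x \<partial>lborel) = ennreal (LINT x::'a|lborel. exp (- 1 * (norm x)\<^sup>2))"
    using integrable_norm_gaussian[of 1, where 'a='a]
    by (subst nn_integral_eq_integral[symmetric]) (auto simp: g_def)
  moreover have "(LINT x::'a|lborel. exp (- 1 * (norm x)\<^sup>2)) = sqrt pi ^ DIM('a)"
  proof -
    have "complex_of_real (LINT x::'a|lborel. exp (- 1 * (norm x)\<^sup>2)) = (LINT x|lborel. gauss 1 (0::'a) x)"
      unfolding integral_complex_of_real[symmetric]
      by (intro Bochner_Integration.integral_cong refl) (simp add: gauss_def flip: exp_of_real)
    also have "\<dots> = complex_of_real (sqrt pi ^ DIM('a))" by (simp add: integral_gauss)
    finally show ?thesis using of_real_eq_iff by blast
  qed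
  ultimately have g0: "(\<integral>\<^sup>+x. g x \<partial>lborel) = ennreal (sqrt pi ^ DIM('a))" by simp
  have trans_lborel: "(\<integral>\<^sup>+x. f (t + x) \<partial>lborel) = (\<integral>\<^sup>+x. f x \<partial>lborel)"
    if [measurable]: "f \<in> borel_measurable borel" for f :: "'a \<Rightarrow> ennreal" and t
    by (subst (2) lborel_distr_plus[of t, symmetric], subst nn_integral_distr) auto
  have neg_lborel: "(\<integral>\<^sup>+x. f (- x) \<partial>lborel) = (\<integral>\<^sup>+x. f x \<partial>lborel)"
    if [measurable]: "f \<in> borel_measurable borel" for f :: "'a \<Rightarrow> ennreal"
    by (subst (2) lborel_affine[of "-1" 0], simp) (auto simp: nn_integral_density nn_integral_distr)
  \<comment> \<open>T is linear and onto, so translating by t in the image amounts to translating by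
    a preimage of t before T is applied.\<close>
  have trans_\<mu>: "(\<integral>\<^sup>+x. f (t + x) \<partial>\<mu>) = (\<integral>\<^sup>+x. f x \<partial>\<mu>)"
    if [measurable]: "f \<in> borel_measurable borel" for f :: "'a \<Rightarrow> ennreal" and t
  proof -
    obtain t' where t': "t = T t'" using surj by (metis surjD)
    have "(\<integral>\<^sup>+x. f (t + x) \<partial>\<mu>) = (\<integral>\<^sup>+x. f (T (t' + x)) \<partial>lborel)"
      unfolding \<mu>_def by (subst nn_integral_distr) (auto simp: t' linear_add[OF lin])
    also have "\<dots> = (\<integral>\<^sup>+x. f (T x) \<partial>lborel)" by (rule trans_lborel[of "\<lambda>x. f (T x)"]) measurable
    also have "\<dots> = (\<integral>\<^sup>+x. f x \<partial>\<mu>)" unfolding \<mu>_def by (subst nn_integral_distr) auto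
    finally show ?thesis .
  qed
  have sf: "sigma_finite_measure \<mu>"
  proof (rule sigma_finite_measure.intro, intro exI[of _ "range (\<lambda>n::nat. cball 0 (real n))"] conjI)
    show "countable (range (\<lambda>n::nat. cball (0::'a) (real n)))" by simp
    show "range (\<lambda>n::nat. cball (0::'a) (real n)) \<subseteq> sets \<mu>" by (auto simp: sets)
    show "\<Union> (range (\<lambda>n::nat. cball (0::'a) (real n))) = space \<mu>"
      by (auto simp: \<mu>_def real_arch_simple)
    show "\<forall>a\<in>range (\<lambda>n::nat. cball (0::'a) (real n)). emeasure \<mu> a \<noteq> \<infinity>"
    proof clarsimp
      fix n :: nat assume "emeasure \<mu> (cball 0 (real n)) = top"
      moreover have "emeasure \<mu> (cball 0 (real n)) = emeasure lborel (T -` cball 0 (real n))"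
        unfolding \<mu>_def by (subst emeasure_distr) auto
      moreover have "T -` cball 0 (real n) = cball 0 (real n)" by (auto simp: nrm)
      ultimately show False using emeasure_bounded_finite[of "cball (0::'a) (real n)"] by simp
    qed
  qed
  interpret \<mu>: sigma_finite_measure \<mu> by fact
  interpret pair_sigma_finite lborel \<mu> ..
  have *: "(\<integral>\<^sup>+x. h x \<partial>lborel) = (\<integral>\<^sup>+x. h x \<partial>\<mu>)"
    if hm[measurable]: "h \<in> borel_measurable borel" for h :: "'a \<Rightarrow> ennreal"
  proof -
    have m1: "(\<lambda>(y, x). g x * h (y + x)) \<in> borel_measurable (lborel \<Otimes>\<^sub>M \<mu>)"
      and m2: "(\<lambda>(y, x). g (x - y) * h x) \<in> borel_measurable (lborel \<Otimes>\<^sub>M \<mu>)"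
      by measurable
    have "(\<integral>\<^sup>+x. g x \<partial>\<mu>) * (\<integral>\<^sup>+x. h x \<partial>lborel) = (\<integral>\<^sup>+x. g x * (\<integral>\<^sup>+y. h y \<partial>lborel) \<partial>\<mu>)"
      by (subst nn_integral_multc) auto
    also have "\<dots> = (\<integral>\<^sup>+x. \<integral>\<^sup>+y. g x * h (y + x) \<partial>lborel \<partial>\<mu>)"
      by (subst nn_integral_cmult) (auto simp: trans_lborel add.commute)
    also have "\<dots> = (\<integral>\<^sup>+y. \<integral>\<^sup>+x. g x * h (y + x) \<partial>\<mu> \<partial>lborel)"
      using Fubini[OF m1] by simp
    also have "\<dots> = (\<integral>\<^sup>+y. \<integral>\<^sup>+x. g (x - y) * h x \<partial>\<mu> \<partial>lborel)"
    proof (rule nn_integral_cong)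
      fix y
      show "(\<integral>\<^sup>+x. g x * h (y + x) \<partial>\<mu>) = (\<integral>\<^sup>+x. g (x - y) * h x \<partial>\<mu>)"
        using trans_\<mu>[of "\<lambda>x. g (x - y) * h x" y] by simp
    qed
    also have "\<dots> = (\<integral>\<^sup>+x. \<integral>\<^sup>+y. g (x - y) * h x \<partial>lborel \<partial>\<mu>)"
      using Fubini[OF m2] by simp
    also have "\<dots> = (\<integral>\<^sup>+x. (\<integral>\<^sup>+y. g y \<partial>lborel) * h x \<partial>\<mu>)"
    proof (rule nn_integral_cong)
      fix x
      have "(\<integral>\<^sup>+y. g (x - y) \<partial>lborel) = (\<integral>\<^sup>+y. g (x + y) \<partial>lborel)"
        using neg_lborel[of "\<lambda>y. g (x + y)"] by simp
      then have "(\<integral>\<^sup>+y. g (x - y) \<partial>lborel) = (\<integral>\<^sup>+y. g y \<partial>lborel)"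
        by (simp add: trans_lborel)
      moreover have "(\<integral>\<^sup>+y. g (x - y) * h x \<partial>lborel) = (\<integral>\<^sup>+y. g (x - y) \<partial>lborel) * h x"
        by (rule nn_integral_multc) measurable
      ultimately show "(\<integral>\<^sup>+y. g (x - y) * h x \<partial>lborel) = (\<integral>\<^sup>+y. g y \<partial>lborel) * h x"
        by simp
    qed
    also have "\<dots> = (\<integral>\<^sup>+x. g x \<partial>lborel) * (\<integral>\<^sup>+x. h x \<partial>\<mu>)"
      by (rule nn_integral_cmult) auto
    \<comment> \<open>Both sides carry the Gaussian mass as a factor; it cancels because
      \<open>g0\<close> shows it to be finite and positive.\<close>
    finally show ?thesis
      unfolding gT g0 by (simp add: ennreal_mult_cancel_left)
  qed
  show ?thesis
  proof (rule measure_eqI)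
    fix A :: "'a set" assume "A \<in> sets (distr lborel borel T)"
    then have A: "A \<in> sets borel" by simp
    then show "emeasure (distr lborel borel T) A = emeasure lborel A"
      using *[of "indicator A"] by (simp add: \<mu>_def)
  qed simp
qed

section \<open>Gaussians as Schwartz functions\<close>

text \<open>Contains the affine factors that differentiating a Gaussian brings down, and is closed
  under the product rule. Derivatives and growth bounds follow by rule induction, without a normal
  form for polynomials in several variables.\<close>

inductive_set polyfun :: "('a::euclidean_space \<Rightarrow> complex) set" where
  const: "(\<lambda>x. c) \<in> polyfun"
| inner: "(\<lambda>x. of_real (v \<bullet> x)) \<in> polyfun"
| add: "p \<in> polyfun \<Longrightarrow> q \<in> polyfun \<Longrightarrow> (\<lambda>x. p x + q x) \<in> polyfun"
| mult: "p \<in> polyfun \<Longrightarrow> q \<in> polyfun \<Longrightarrow> (\<lambda>x. p x * q x) \<in> polyfun"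

lemma polyfun_has_derivative:
  assumes "p \<in> polyfun"
  obtains D where "\<And>x. (p has_derivative (\<lambda>h. D h x)) (at x)" "\<And>h. D h \<in> polyfun"
proof -
  from assms have "\<exists>D. (\<forall>x. (p has_derivative (\<lambda>h. D h x)) (at x)) \<and> (\<forall>h. D h \<in> polyfun)"
  proof induction
    case (const c)
    show ?case by (intro exI[of _ "\<lambda>h x. 0"]) (auto intro: polyfun.const)
  next
    case (inner v)
    show ?case
      by (intro exI[of _ "\<lambda>h x. of_real (v \<bullet> h)"])
        (auto intro!: polyfun.const derivative_eq_intros)
  next
    case (add p q)
    then obtain D E where D: "\<And>x. (p has_derivative (\<lambda>h. D h x)) (at x)" "\<And>h. D h \<in> polyfun"
      and E: "\<And>x. (q has_derivative (\<lambda>h. E h x)) (at x)" "\<And>h. E h \<in> polyfun" by blast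
    show ?case
      by (intro exI[of _ "\<lambda>h x. D h x + E h x"] conjI allI polyfun.add has_derivative_add D E)
  next
    case (mult p q)
    then obtain D E where D: "\<And>x. (p has_derivative (\<lambda>h. D h x)) (at x)" "\<And>h. D h \<in> polyfun"
      and E: "\<And>x. (q has_derivative (\<lambda>h. E h x)) (at x)" "\<And>h. E h \<in> polyfun" by blast
    show ?case
      by (intro exI[of _ "\<lambda>h x. p x * E h x + D h x * q x"] conjI allI polyfun.add polyfun.mult
          has_derivative_mult D E mult.hyps)
  qed
  then show ?thesis using that by blast
qed

lemma polyfun_bound:
  assumes "p \<in> polyfun"
  obtains C n where "C \<ge> 0" "\<And>x. norm (p x) \<le> C * (1 + norm x) ^ n"
proof -
  from assms have "\<exists>C n. C \<ge> 0 \<and> (\<forall>x. norm (p x) \<le> C * (1 + norm x) ^ n)"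
  proof induction
    case (const c)
    show ?case by (intro exI[of _ "norm c"] exI[of _ 0]) auto
  next
    case (inner v)
    have "\<bar>v \<bullet> x\<bar> \<le> norm v * (1 + norm x)" for x
      using Cauchy_Schwarz_ineq2[of v x] mult_left_mono[of "norm x" "1 + norm x" "norm v"] by simp
    then show ?case by (intro exI[of _ "norm v"] exI[of _ 1]) auto
  next
    case (add p q)
    then obtain C n C' n' where C: "C \<ge> 0" "\<And>x. norm (p x) \<le> C * (1 + norm x) ^ n"
      and C': "C' \<ge> 0" "\<And>x. norm (q x) \<le> C' * (1 + norm x) ^ n'" by blast
    have "norm (p x + q x) \<le> (C + C') * (1 + norm x) ^ (n + n')" for x
    proof -
      have "C * (1 + norm x) ^ n \<le> C * (1 + norm x) ^ (n + n')"
        "C' * (1 + norm x) ^ n' \<le> C' * (1 + norm x) ^ (n + n')"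
        using C C' by (auto intro!: mult_left_mono power_increasing)
      then show ?thesis
        using norm_triangle_ineq[of "p x" "q x"] C(2)[of x] C'(2)[of x] by (simp add: distrib_right)
    qed
    then show ?case using C(1) C'(1) by (meson add_nonneg_nonneg)
  next
    case (mult p q)
    then obtain C n C' n' where C: "C \<ge> 0" "\<And>x. norm (p x) \<le> C * (1 + norm x) ^ n"
      and C': "C' \<ge> 0" "\<And>x. norm (q x) \<le> C' * (1 + norm x) ^ n'" by blast
    have "norm (p x * q x) \<le> (C * C') * (1 + norm x) ^ (n + n')" for x
    proof -
      have "norm (p x * q x) \<le> (C * (1 + norm x) ^ n) * (C' * (1 + norm x) ^ n')"
        unfolding norm_mult by (intro mult_mono C C') (use C in auto)
      then show ?thesis by (simp add: power_add mult_ac)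
    qed
    then show ?case using C(1) C'(1) by (meson mult_nonneg_nonneg)
  qed
  then show ?thesis using that by blast
qed

section \<open>Derivatives of Gaussians times polynomials\<close>

lemma gauss_has_derivative:
  "(gauss k v has_derivative (\<lambda>h. (of_real (- (2 * k) * (x \<bullet> h)) + \<i> * of_real (v \<bullet> h)) * gauss k v x)) (at x)"
proof -
  define g where "g = (\<lambda>x. complex_of_real (- k * (x \<bullet> x)) + \<i> * of_real (v \<bullet> x))"
  have "(g has_derivative (\<lambda>h. complex_of_real (- k * (x \<bullet> h + h \<bullet> x)) + \<i> * of_real (v \<bullet> h))) (at x)"
    unfolding g_def by (intro derivative_intros)
  moreover have "(exp has_derivative (\<lambda>h. exp (g x) * h)) (at (g x))"
    using DERIV_exp[of "g x"] by (simp add: has_field_derivative_def)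
  ultimately have "((\<lambda>x. exp (g x)) has_derivative
      (\<lambda>h. exp (g x) * (complex_of_real (- k * (x \<bullet> h + h \<bullet> x)) + \<i> * of_real (v \<bullet> h)))) (at x)"
    by (rule has_derivative_compose)
  moreover have "gauss k v = (\<lambda>x. exp (g x))"
    by (simp add: fun_eq_iff gauss_def g_def power2_norm_eq_inner)
  ultimately show ?thesis by (simp add: inner_commute algebra_simps)
qed

lemma has_vector_derivative_along_line:
  assumes f: "(f has_derivative f') (at y)"
  shows "((\<lambda>s. f (y + s *\<^sub>R i)) has_vector_derivative f' i) (at 0)"
proof -
  have "((\<lambda>s. y + s *\<^sub>R i) has_derivative (\<lambda>s. s *\<^sub>R i)) (at 0)"
    by (auto intro!: derivative_eq_intros)
  moreover have "(f has_derivative f') (at (y + 0 *\<^sub>R i))" using f by simp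
  ultimately have "((\<lambda>s. f (y + s *\<^sub>R i)) has_derivative (\<lambda>s. f' (s *\<^sub>R i))) (at 0)"
    by (rule has_derivative_compose)
  then show ?thesis
    by (simp add: has_vector_derivative_def linear_scale[OF has_derivative_linear[OF f]])
qed

text \<open>The Gaussian is carried along and only the polynomial changes: a derivative in direction
  h replaces q by its own derivative plus q times the affine factor from the exponent.\<close>

lemma iter_deriv_polyfun_gauss:
  assumes "p \<in> polyfun"
  shows "\<exists>q\<in>polyfun. iter_deriv vs (\<lambda>x. p x * gauss k v x) = (\<lambda>x. q x * gauss k v x)"
proof (induction vs)
  case Nil
  then show ?case using assms by auto
next
  case (Cons h vs)
  then obtain q where q: "q \<in> polyfun"
    and eq: "iter_deriv vs (\<lambda>x. p x * gauss k v x) = (\<lambda>x. q x * gauss k v x)" by blast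
  obtain D where D: "\<And>x. (q has_derivative (\<lambda>h. D h x)) (at x)" "\<And>h. D h \<in> polyfun"
    using polyfun_has_derivative[OF q] by blast
  define r where "r = (\<lambda>x. q x * (of_real (((- (2 * k)) *\<^sub>R h) \<bullet> x) + \<i> * of_real (v \<bullet> h)) + D h x)"
  have "r \<in> polyfun"
    unfolding r_def by (intro polyfun.intros q D)
  moreover have "frechet_derivative (\<lambda>x. q x * gauss k v x) (at x) h = r x * gauss k v x" for x
  proof -
    have "((\<lambda>x. q x * gauss k v x) has_derivative
       (\<lambda>h. q x * ((of_real (- (2 * k) * (x \<bullet> h)) + \<i> * of_real (v \<bullet> h)) * gauss k v x) + D h x * gauss k v x)) (at x)"
      by (intro has_derivative_mult D gauss_has_derivative)
    from fun_cong[OF frechet_derivative_at[OF this], of h, symmetric] show ?thesis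
      unfolding r_def by (simp add: inner_commute algebra_simps)
  qed
  ultimately show ?case unfolding iter_deriv.simps eq by auto
qed

lemma schwartz_polyfun_gauss:
  fixes p :: "'a::euclidean_space \<Rightarrow> complex"
  assumes p: "p \<in> polyfun" and k: "k > 0"
  shows "(\<lambda>x. p x * gauss k v x) \<in> schwartz"
proof -
  have "iter_deriv vs (\<lambda>x. p x * gauss k v x) differentiable (at x)" for vs x
  proof -
    obtain q where q: "q \<in> polyfun"
      and eq: "iter_deriv vs (\<lambda>x. p x * gauss k v x) = (\<lambda>x. q x * gauss k v x)"
      using iter_deriv_polyfun_gauss[OF p] by blast
    obtain D where D: "\<And>x. (q has_derivative (\<lambda>h. D h x)) (at x)"
      using polyfun_has_derivative[OF q] by blast
    show ?thesis unfolding eq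
      by (rule differentiableI[OF has_derivative_mult[OF D gauss_has_derivative]])
  qed
  moreover have "\<exists>C. \<forall>x. (1 + norm x) ^ n * cmod (iter_deriv vs (\<lambda>x. p x * gauss k v x) x) \<le> C" for n vs
  proof -
    obtain q where q: "q \<in> polyfun"
      and eq: "iter_deriv vs (\<lambda>x. p x * gauss k v x) = (\<lambda>x. q x * gauss k v x)"
      using iter_deriv_polyfun_gauss[OF p] by blast
    obtain C m where C: "C \<ge> 0" "\<And>x. norm (q x) \<le> C * (1 + norm x) ^ m"
      using polyfun_bound[OF q] by blast
    have "(1 + norm x) ^ n * cmod (q x * gauss k v x) \<le> C * exp (real (n + m) ^ 2 / (4 * k))" for x
    proof -
      have "(1 + norm x) ^ n * cmod (q x * gauss k v x) \<le>
          (1 + norm x) ^ n * ((C * (1 + norm x) ^ m) * exp (- k * (norm x)\<^sup>2))"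
        unfolding norm_mult norm_gauss by (intro mult_left_mono mult_right_mono C) auto
      also have "\<dots> = C * ((1 + norm x) ^ (n + m) * exp (- k * (norm x)\<^sup>2))"
        by (simp add: power_add)
      also have "\<dots> \<le> C * ((exp (real (n + m) ^ 2 / (4 * k)) * exp (k * (norm x)\<^sup>2)) * exp (- k * (norm x)\<^sup>2))"
        by (intro mult_left_mono mult_right_mono power_le_gaussian C) (use k in auto)
      also have "\<dots> = C * exp (real (n + m) ^ 2 / (4 * k))"
        by (simp add: mult.assoc flip: exp_add)
      finally show ?thesis .
    qed
    then show ?thesis unfolding eq by blast
  qed
  ultimately show ?thesis unfolding schwartz_def smooth_def by blast
qed

lemma schwartz_gauss: "k > 0 \<Longrightarrow> gauss k v \<in> schwartz"
  using schwartz_polyfun_gauss[OF polyfun.const[of 1], of k v] by simp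

text \<open>For \<open>k = 1 / 2\<close>, the ground state of H, the |x|^2 produced by the Laplacian
  is exactly the potential, so only an affine factor survives. The phase shifts the ground state
  energy d by |w|^2 + 2i w.x.\<close>

lemma oscillator_expr_gauss:
  fixes w :: "'a::euclidean_space"
  shows "oscillator_expr (gauss (1/2) w) x =
    (of_nat DIM('a) + of_real ((norm w)\<^sup>2) + 2 * \<i> * of_real (w \<bullet> x)) * gauss (1/2) w x"
proof -
  have 1: "frechet_derivative (gauss (1/2) w) (at x) h = (of_real (- (x \<bullet> h)) + \<i> * of_real (w \<bullet> h)) * gauss (1/2) w x" for x h
    using fun_cong[OF frechet_derivative_at[OF gauss_has_derivative[of "1/2" w x]], of h] by simp
  have 2: "frechet_derivative (\<lambda>x. (of_real (- (x \<bullet> i)) + \<i> * of_real (w \<bullet> i)) * gauss (1/2) w x) (at x) i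
      = (- 1 + (of_real (- (x \<bullet> i)) + \<i> * of_real (w \<bullet> i))\<^sup>2) * gauss (1/2) w x" if i: "i \<in> Basis" for x i
  proof -
    have "((\<lambda>x. (of_real (- (x \<bullet> i)) + \<i> * of_real (w \<bullet> i)) * gauss (1/2) w x) has_derivative
      (\<lambda>h. (of_real (- (x \<bullet> i)) + \<i> * of_real (w \<bullet> i)) * ((of_real (- (2 * (1/2)) * (x \<bullet> h)) + \<i> * of_real (w \<bullet> h)) * gauss (1/2) w x)
         + (of_real (- (h \<bullet> i)) * gauss (1/2) w x))) (at x)"
      by (intro has_derivative_mult gauss_has_derivative) (auto intro!: derivative_eq_intros)
    from fun_cong[OF frechet_derivative_at[OF this], of i, symmetric] have
      "frechet_derivative (\<lambda>x. (of_real (- (x \<bullet> i)) + \<i> * of_real (w \<bullet> i)) * gauss (1/2) w x) (at x) i =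
       (of_real (- (x \<bullet> i)) + \<i> * of_real (w \<bullet> i)) * ((of_real (- (2 * (1/2)) * (x \<bullet> i)) + \<i> * of_real (w \<bullet> i)) * gauss (1/2) w x)
         + (of_real (- (i \<bullet> i)) * gauss (1/2) w x)"
      .
    then show ?thesis using i by (simp add: power2_eq_square algebra_simps)
  qed
  have "laplacian (gauss (1/2) w) x =
      (\<Sum>i\<in>Basis. (- 1 + (of_real (- (x \<bullet> i)) + \<i> * of_real (w \<bullet> i))\<^sup>2) * gauss (1/2) w x)"
    unfolding laplacian_def by (intro sum.cong refl) (simp only: iter_deriv.simps 1 2)
  also have "\<dots> = (\<Sum>i\<in>Basis. - 1 + of_real ((x \<bullet> i)\<^sup>2) - of_real ((w \<bullet> i)\<^sup>2) - 2 * \<i> * of_real ((w \<bullet> i) * (x \<bullet> i))) * gauss (1/2) w x"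
    unfolding sum_distrib_right by (intro sum.cong refl) (simp add: power2_eq_square algebra_simps)
  also have "(\<Sum>i\<in>Basis. - 1 + of_real ((x \<bullet> i)\<^sup>2) - of_real ((w \<bullet> i)\<^sup>2) - 2 * \<i> * of_real ((w \<bullet> i) * (x \<bullet> i)))
     = - of_nat DIM('a) + complex_of_real ((norm x)\<^sup>2) - of_real ((norm w)\<^sup>2) - 2 * \<i> * of_real (w \<bullet> x)"
    unfolding norm_sq_eq_sum_inner euclidean_inner[of w x]
    by (simp add: sum.distrib sum_subtractf sum_distrib_left sum_negf)
  finally show ?thesis
    unfolding oscillator_expr_def by (simp add: algebra_simps)
qed

section \<open>Decay of Fourier integrals\<close>

text \<open>The bounds are uniform in the parameter \<open>\<theta>\<close>. Recursion over single directional derivatives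
  avoids multi-indices and makes Leibniz' rule a plain induction.\<close>

primrec deriv_bounded ::
    "nat \<Rightarrow> ('p \<Rightarrow> 'a::euclidean_space \<Rightarrow> real) \<Rightarrow> ('p \<Rightarrow> 'a \<Rightarrow> complex) \<Rightarrow> bool" where
  "deriv_bounded 0 w A \<longleftrightarrow>
     (\<forall>\<theta>. continuous_on UNIV (A \<theta>)) \<and> (\<exists>C\<ge>0. \<forall>\<theta> y. norm (A \<theta> y) \<le> C * w \<theta> y)"
| "deriv_bounded (Suc n) w A \<longleftrightarrow>
     (\<forall>\<theta>. continuous_on UNIV (A \<theta>)) \<and> (\<exists>C\<ge>0. \<forall>\<theta> y. norm (A \<theta> y) \<le> C * w \<theta> y) \<and>
     (\<forall>i\<in>Basis. \<exists>A'. deriv_bounded n w A' \<and>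
        (\<forall>\<theta> y. ((\<lambda>s. A \<theta> (y + s *\<^sub>R i)) has_vector_derivative A' \<theta> y) (at 0)))"

section \<open>Calculus of families with bounded derivatives\<close>

lemma deriv_bounded_bound:
  "deriv_bounded n w A \<Longrightarrow> \<exists>C\<ge>0. \<forall>\<theta> y. norm (A \<theta> y) \<le> C * w \<theta> y"
  by (cases n) auto

lemma deriv_bounded_continuous: "deriv_bounded n w A \<Longrightarrow> continuous_on UNIV (A \<theta>)"
  by (cases n) auto

lemma deriv_bounded_SucI:
  assumes "deriv_bounded 0 w A"
    and "\<And>i. i \<in> Basis \<Longrightarrow> \<exists>A'. deriv_bounded n w A' \<and>
        (\<forall>\<theta> y. ((\<lambda>s. A \<theta> (y + s *\<^sub>R i)) has_vector_derivative A' \<theta> y) (at 0))"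
  shows "deriv_bounded (Suc n) w A"
  using assms by simp

lemma deriv_bounded_0I: "deriv_bounded n w A \<Longrightarrow> deriv_bounded 0 w A"
  by (cases n) auto

lemma deriv_bounded_Suc_derivative:
  assumes "deriv_bounded (Suc n) w A" "i \<in> Basis"
  shows "\<exists>A'. deriv_bounded n w A' \<and>
    (\<forall>\<theta> y. ((\<lambda>s. A \<theta> (y + s *\<^sub>R i)) has_vector_derivative A' \<theta> y) (at 0))"
  using assms by (simp only: deriv_bounded.simps(2))

lemma deriv_bounded_SucE:
  assumes "deriv_bounded (Suc n) w A" "i \<in> Basis"
  obtains A' where "deriv_bounded n w A'"
    "\<And>\<theta> y. ((\<lambda>s. A \<theta> (y + s *\<^sub>R i)) has_vector_derivative A' \<theta> y) (at 0)"
  using deriv_bounded_Suc_derivative[OF assms] by blast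

lemma deriv_bounded_SucD: "deriv_bounded (Suc n) w A \<Longrightarrow> deriv_bounded n w A"
proof (induction n arbitrary: A)
  case (Suc n)
  show ?case
  proof (rule deriv_bounded_SucI)
    show "deriv_bounded 0 w A" by (rule deriv_bounded_0I) fact
  next
    fix i :: 'b assume "i \<in> Basis"
    from deriv_bounded_SucE[OF Suc.prems this] obtain A' where "deriv_bounded (Suc n) w A'"
      "\<And>\<theta> y. ((\<lambda>s. A \<theta> (y + s *\<^sub>R i)) has_vector_derivative A' \<theta> y) (at 0)" by blast
    with Suc.IH show "\<exists>A'. deriv_bounded n w A' \<and>
        (\<forall>\<theta> y. ((\<lambda>s. A \<theta> (y + s *\<^sub>R i)) has_vector_derivative A' \<theta> y) (at 0))" by blast
  qed
qed simp

lemma deriv_bounded_weight: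
  assumes "deriv_bounded n w A" and w: "\<And>\<theta> y. w \<theta> y \<le> w' \<theta> y"
  shows "deriv_bounded n w' A"
  using assms(1)
proof (induction n arbitrary: A)
  case 0
  then obtain C where C: "C \<ge> 0" "\<And>\<theta> y. norm (A \<theta> y) \<le> C * w \<theta> y" by auto
  have "norm (A \<theta> y) \<le> C * w' \<theta> y" for \<theta> y
    using C(2)[of \<theta> y] mult_left_mono[OF w[of \<theta> y] C(1)] by linarith
  with 0 C(1) show ?case by auto
next
  case (Suc n)
  then obtain C where C: "C \<ge> 0" "\<And>\<theta> y. norm (A \<theta> y) \<le> C * w \<theta> y" by auto
  have "norm (A \<theta> y) \<le> C * w' \<theta> y" for \<theta> y
    using C(2)[of \<theta> y] mult_left_mono[OF w[of \<theta> y] C(1)] by linarith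
  with Suc.prems C(1) have "deriv_bounded 0 w' A" by auto
  then show ?case
  proof (rule deriv_bounded_SucI)
    fix i :: 'b assume "i \<in> Basis"
    from deriv_bounded_SucE[OF Suc.prems this] obtain A' where "deriv_bounded n w A'"
      "\<And>\<theta> y. ((\<lambda>s. A \<theta> (y + s *\<^sub>R i)) has_vector_derivative A' \<theta> y) (at 0)" by blast
    with Suc.IH show "\<exists>A'. deriv_bounded n w' A' \<and>
        (\<forall>\<theta> y. ((\<lambda>s. A \<theta> (y + s *\<^sub>R i)) has_vector_derivative A' \<theta> y) (at 0))" by blast
  qed
qed

lemma deriv_bounded_add:
  assumes "deriv_bounded n w A" "deriv_bounded n w B"
  shows "deriv_bounded n w (\<lambda>\<theta> y. A \<theta> y + B \<theta> y)"
proof -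
  have base: "deriv_bounded 0 w (\<lambda>\<theta> y. A \<theta> y + B \<theta> y)"
    if A: "deriv_bounded 0 w A" and B: "deriv_bounded 0 w B" for A B
  proof -
    from A B obtain C D where C: "C \<ge> 0" "\<And>\<theta> y. norm (A \<theta> y) \<le> C * w \<theta> y"
      and D: "D \<ge> 0" "\<And>\<theta> y. norm (B \<theta> y) \<le> D * w \<theta> y" by auto
    have "norm (A \<theta> y + B \<theta> y) \<le> (C + D) * w \<theta> y" for \<theta> y
      using C(2)[of \<theta> y] D(2)[of \<theta> y] norm_triangle_ineq[of "A \<theta> y" "B \<theta> y"] by (simp add: distrib_right)
    moreover have "C + D \<ge> 0" using C(1) D(1) by simp
    ultimately show ?thesis using A B by (auto intro: continuous_on_add)
  qed
  show ?thesis using assms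
  proof (induction n arbitrary: A B)
    case 0
    then show ?case by (rule base)
  next
    case (Suc n)
    show ?case
    proof (rule deriv_bounded_SucI)
      show "deriv_bounded 0 w (\<lambda>\<theta> y. A \<theta> y + B \<theta> y)"
        by (intro base deriv_bounded_0I[OF Suc.prems(1)] deriv_bounded_0I[OF Suc.prems(2)])
    next
      fix i :: 'b assume i: "i \<in> Basis"
      from deriv_bounded_SucE[OF Suc.prems(1) i] obtain A' where "deriv_bounded n w A'"
        and "\<And>\<theta> y. ((\<lambda>s. A \<theta> (y + s *\<^sub>R i)) has_vector_derivative A' \<theta> y) (at 0)" by blast
      moreover from deriv_bounded_SucE[OF Suc.prems(2) i] obtain B' where "deriv_bounded n w B'"
        and "\<And>\<theta> y. ((\<lambda>s. B \<theta> (y + s *\<^sub>R i)) has_vector_derivative B' \<theta> y) (at 0)" by blast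
      ultimately show "\<exists>A'. deriv_bounded n w A' \<and>
        (\<forall>\<theta> y. ((\<lambda>s. A \<theta> (y + s *\<^sub>R i) + B \<theta> (y + s *\<^sub>R i)) has_vector_derivative A' \<theta> y) (at 0))"
        by (intro exI[of _ "\<lambda>\<theta> y. A' \<theta> y + B' \<theta> y"] conjI allI has_vector_derivative_add Suc.IH)
    qed
  qed
qed

lemma deriv_bounded_mult:
  assumes "deriv_bounded n w A" "deriv_bounded n w' B" and nn: "\<And>\<theta> y. w \<theta> y \<ge> 0" "\<And>\<theta> y. w' \<theta> y \<ge> 0"
  shows "deriv_bounded n (\<lambda>\<theta> y. w \<theta> y * w' \<theta> y) (\<lambda>\<theta> y. A \<theta> y * B \<theta> y)"
proof -
  have base: "deriv_bounded 0 (\<lambda>\<theta> y. w \<theta> y * w' \<theta> y) (\<lambda>\<theta> y. A \<theta> y * B \<theta> y)"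
    if A: "deriv_bounded 0 w A" and B: "deriv_bounded 0 w' B" for A B
  proof -
    from A B obtain C D where C: "C \<ge> 0" "\<And>\<theta> y. norm (A \<theta> y) \<le> C * w \<theta> y"
      and D: "D \<ge> 0" "\<And>\<theta> y. norm (B \<theta> y) \<le> D * w' \<theta> y" by auto
    have "norm (A \<theta> y * B \<theta> y) \<le> (C * D) * (w \<theta> y * w' \<theta> y)" for \<theta> y
    proof -
      have "norm (A \<theta> y * B \<theta> y) \<le> (C * w \<theta> y) * (D * w' \<theta> y)"
        unfolding norm_mult by (intro mult_mono C D mult_nonneg_nonneg nn norm_ge_zero)
      then show ?thesis by (simp add: mult_ac)
    qed
    moreover have "C * D \<ge> 0" using C(1) D(1) by simp
    moreover have "continuous_on UNIV (\<lambda>y. A \<theta> y * B \<theta> y)" for \<theta>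
      using A B by (auto intro: continuous_on_mult)
    ultimately show ?thesis by (simp only: deriv_bounded.simps) blast
  qed
  show ?thesis using assms(1,2)
  proof (induction n arbitrary: A B)
    case 0
    then show ?case by (rule base)
  next
    case (Suc n)
    show ?case
    proof (rule deriv_bounded_SucI)
      show "deriv_bounded 0 (\<lambda>\<theta> y. w \<theta> y * w' \<theta> y) (\<lambda>\<theta> y. A \<theta> y * B \<theta> y)"
        by (intro base deriv_bounded_0I[OF Suc.prems(1)] deriv_bounded_0I[OF Suc.prems(2)])
    next
      fix i :: 'b assume i: "i \<in> Basis"
      from deriv_bounded_SucE[OF Suc.prems(1) i] obtain A' where A': "deriv_bounded n w A'"
        and dA: "\<And>\<theta> y. ((\<lambda>s. A \<theta> (y + s *\<^sub>R i)) has_vector_derivative A' \<theta> y) (at 0)" by blast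
      from deriv_bounded_SucE[OF Suc.prems(2) i] obtain B' where B': "deriv_bounded n w' B'"
        and dB: "\<And>\<theta> y. ((\<lambda>s. B \<theta> (y + s *\<^sub>R i)) has_vector_derivative B' \<theta> y) (at 0)" by blast
      have "((\<lambda>s. A \<theta> (y + s *\<^sub>R i) * B \<theta> (y + s *\<^sub>R i)) has_vector_derivative A \<theta> y * B' \<theta> y + A' \<theta> y * B \<theta> y) (at 0)" for \<theta> y
        using has_vector_derivative_mult[OF dA[of \<theta> y] dB[of \<theta> y]] by simp
      \<comment> \<open>In each Leibniz term one factor has lost an order, so the other one is
        weakened to order n too before the induction hypothesis applies.\<close>
      moreover have "deriv_bounded n (\<lambda>\<theta> y. w \<theta> y * w' \<theta> y) (\<lambda>\<theta> y. A \<theta> y * B' \<theta> y + A' \<theta> y * B \<theta> y)"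
        by (intro deriv_bounded_add Suc.IH A' B' deriv_bounded_SucD[OF Suc.prems(1)] deriv_bounded_SucD[OF Suc.prems(2)])
      ultimately show "\<exists>A'. deriv_bounded n (\<lambda>\<theta> y. w \<theta> y * w' \<theta> y) A' \<and>
        (\<forall>\<theta> y. ((\<lambda>s. A \<theta> (y + s *\<^sub>R i) * B \<theta> (y + s *\<^sub>R i)) has_vector_derivative A' \<theta> y) (at 0))"
        by (intro exI[of _ "\<lambda>\<theta> y. A \<theta> y * B' \<theta> y + A' \<theta> y * B \<theta> y"]) auto
    qed
  qed
qed

lemma deriv_bounded_zero:
  assumes "\<And>\<theta> y. w \<theta> y \<ge> 0"
  shows "deriv_bounded n w (\<lambda>\<theta> y. 0)"
proof (induction n)
  case (Suc n)
  then show ?case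
    by (intro deriv_bounded_SucI exI[of _ "\<lambda>\<theta> y. 0"]) (auto intro!: exI[of _ 0] assms)
qed (auto intro!: exI[of _ 0] assms)

lemma deriv_bounded_const:
  assumes c: "\<And>\<theta>. norm (c \<theta>) \<le> K"
  shows "deriv_bounded n (\<lambda>\<theta> y. 1) (\<lambda>\<theta> y. c \<theta>)"
proof -
  \<comment> \<open>Types are inhabited, so the bound at an arbitrary parameter gives the sign of
    \<open>K\<close>.\<close>
  have K: "K \<ge> 0" using c[of undefined] norm_ge_zero[of "c undefined"] by linarith
  show ?thesis
  proof (cases n)
    case (Suc n)
    have "deriv_bounded n (\<lambda>\<theta> y. 1) (\<lambda>\<theta> y. 0)" by (rule deriv_bounded_zero) simp
    then show ?thesis unfolding Suc using K
      by (intro deriv_bounded_SucI exI[of _ "\<lambda>\<theta> y. 0"]) (auto intro!: exI[of _ K] c)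
  qed (use K in \<open>auto intro!: exI[of _ K] c\<close>)
qed

lemma deriv_bounded_cmult:
  assumes "deriv_bounded n w A" "\<And>\<theta> y. w \<theta> y \<ge> 0"
  shows "deriv_bounded n w (\<lambda>\<theta> y. c * A \<theta> y)"
  using deriv_bounded_mult[OF deriv_bounded_const[of "\<lambda>_. c" "norm c" n] assms(1)] assms(2) by simp

lemma deriv_bounded_sum:
  assumes "\<And>i. i \<in> I \<Longrightarrow> deriv_bounded n w (A i)" "\<And>\<theta> y. w \<theta> y \<ge> 0"
  shows "deriv_bounded n w (\<lambda>\<theta> y. \<Sum>i\<in>I. A i \<theta> y)"
  using assms
proof (induction I rule: infinite_finite_induct)
  case (insert i I)
  then show ?case by (simp add: deriv_bounded_add)
qed (auto intro: deriv_bounded_zero)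

lemma deriv_bounded_integrable:
  assumes A: "deriv_bounded n w A" and w: "integrable lborel (w \<theta>)"
  shows "integrable lborel (\<lambda>y. gauss 0 v y * A \<theta> y)"
proof -
  obtain C where C: "C \<ge> 0" "\<And>\<theta> y. norm (A \<theta> y) \<le> C * w \<theta> y"
    using deriv_bounded_bound[OF A] by blast
  show ?thesis
  proof (rule Bochner_Integration.integrable_bound)
    show "integrable lborel (\<lambda>y. C * w \<theta> y)" using w by simp
    show "(\<lambda>y. gauss 0 v y * A \<theta> y) \<in> borel_measurable lborel"
      using deriv_bounded_continuous[OF A]
      by (auto intro!: borel_measurable_continuous_onI continuous_intros)
    show "AE y in lborel. norm (gauss 0 v y * A \<theta> y) \<le> norm (C * w \<theta> y)"
    proof (rule AE_I2)
      fix y show "norm (gauss 0 v y * A \<theta> y) \<le> norm (C * w \<theta> y)"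
        using C(2)[of \<theta> y] by (simp add: norm_mult norm_gauss)
    qed
  qed
qed

lemma deriv_bounded_integral_by_parts:
  assumes A: "deriv_bounded n w A" and A': "deriv_bounded m w A'"
    and d: "\<And>y. ((\<lambda>s. A \<theta> (y + s *\<^sub>R i)) has_vector_derivative A' \<theta> y) (at 0)"
    and w: "integrable lborel (w \<theta>)"
  shows "(LINT y|lborel. gauss 0 v y * A' \<theta> y) = - \<i> * of_real (v \<bullet> i) * (LINT y|lborel. gauss 0 v y * A \<theta> y)"
proof -
  note int = deriv_bounded_integrable[of _ w _ \<theta> v, OF _ w]
  have der: "((\<lambda>s. gauss 0 v (y + s *\<^sub>R i) * A \<theta> (y + s *\<^sub>R i)) has_vector_derivative
      gauss 0 v y * A' \<theta> y + \<i> * of_real (v \<bullet> i) * (gauss 0 v y * A \<theta> y)) (at 0)" for y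
  proof -
    have "((\<lambda>s. gauss 0 v (y + s *\<^sub>R i)) has_vector_derivative (\<i> * of_real (v \<bullet> i)) * gauss 0 v y) (at 0)"
      using has_vector_derivative_along_line[OF gauss_has_derivative[of 0 v y], of i] by simp
    from has_vector_derivative_mult[OF this d[of y]] show ?thesis by (simp add: algebra_simps)
  qed
  have "(LINT y|lborel. gauss 0 v y * A' \<theta> y + \<i> * of_real (v \<bullet> i) * (gauss 0 v y * A \<theta> y)) = 0"
  proof (rule integral_directional_derivative_eq_0[OF _ _ _ der])
    show "integrable lborel (\<lambda>y. gauss 0 v y * A \<theta> y)" by (rule int[OF A])
    show "integrable lborel (\<lambda>y. gauss 0 v y * A' \<theta> y + \<i> * of_real (v \<bullet> i) * (gauss 0 v y * A \<theta> y))"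
      using int[OF A] int[OF A'] by auto
    show "continuous_on UNIV (\<lambda>y. gauss 0 v y * A' \<theta> y + \<i> * of_real (v \<bullet> i) * (gauss 0 v y * A \<theta> y))"
      using deriv_bounded_continuous[OF A] deriv_bounded_continuous[OF A'] by (intro continuous_intros)
  qed
  then show ?thesis
    using int[OF A] int[OF A'] by (simp add: add_eq_0_iff)
qed

text \<open>Each factor \<open>1 + |\<xi>|\<^sup>2\<close> is traded for the operator \<open>1 - \<Delta>\<^sub>y\<close> by two integrations by parts.\<close>

lemma deriv_bounded_fourier_decay:
  fixes \<xi> :: "'p \<Rightarrow> 'a::euclidean_space"
  assumes "deriv_bounded (2 * N) w A" and w: "\<And>\<theta>. integrable lborel (w \<theta>)" and nn: "\<And>\<theta> y. w \<theta> y \<ge> 0"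
  shows "\<exists>C\<ge>0. \<forall>\<theta>. (1 + (norm (\<xi> \<theta>))\<^sup>2) ^ N * norm (LINT y|lborel. gauss 0 (\<xi> \<theta>) y * A \<theta> y)
    \<le> C * (LINT y|lborel. w \<theta> y)"
  using assms(1)
proof (induction N arbitrary: A)
  case 0
  then have A: "deriv_bounded 0 w A" by simp
  obtain C where C: "C \<ge> 0" "\<And>\<theta> y. norm (A \<theta> y) \<le> C * w \<theta> y"
    using deriv_bounded_bound[OF A] by blast
  have "norm (LINT y|lborel. gauss 0 (\<xi> \<theta>) y * A \<theta> y) \<le> C * (LINT y|lborel. w \<theta> y)" for \<theta>
  proof -
    have "norm (LINT y|lborel. gauss 0 (\<xi> \<theta>) y * A \<theta> y) \<le> (LINT y|lborel. C * w \<theta> y)"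
    proof (rule Bochner_Integration.integral_norm_bound_integral)
      show "integrable lborel (\<lambda>y. gauss 0 (\<xi> \<theta>) y * A \<theta> y)" by (rule deriv_bounded_integrable[OF A w])
      show "integrable lborel (\<lambda>y. C * w \<theta> y)" using w by simp
      show "norm (gauss 0 (\<xi> \<theta>) y * A \<theta> y) \<le> C * w \<theta> y" for y
        using C(2) by (simp add: norm_mult norm_gauss)
    qed
    then show ?thesis by simp
  qed
  with C(1) show ?case by auto
next
  case (Suc N)
  then have A: "deriv_bounded (Suc (Suc (2 * N))) w A" by simp
  have "\<forall>i\<in>Basis. \<exists>A1. deriv_bounded (Suc (2 * N)) w A1 \<and>
        (\<forall>\<theta> y. ((\<lambda>s. A \<theta> (y + s *\<^sub>R i)) has_vector_derivative A1 \<theta> y) (at 0))"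
  proof
    fix i :: 'a assume i: "i \<in> Basis"
    show "\<exists>A1. deriv_bounded (Suc (2 * N)) w A1 \<and>
        (\<forall>\<theta> y. ((\<lambda>s. A \<theta> (y + s *\<^sub>R i)) has_vector_derivative A1 \<theta> y) (at 0))"
      by (rule deriv_bounded_Suc_derivative[OF A i])
  qed
  from bchoice[OF this] obtain A1 where *: "\<forall>i\<in>Basis. deriv_bounded (Suc (2 * N)) w (A1 i) \<and>
        (\<forall>\<theta> y. ((\<lambda>s. A \<theta> (y + s *\<^sub>R i)) has_vector_derivative A1 i \<theta> y) (at 0))" ..
  have A1: "deriv_bounded (Suc (2 * N)) w (A1 i)" if "i \<in> Basis" for i
    by (rule conjunct1[OF bspec[OF * that]])
  have d1: "((\<lambda>s. A \<theta> (y + s *\<^sub>R i)) has_vector_derivative A1 i \<theta> y) (at 0)" if "i \<in> Basis" for i \<theta> y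
    by (rule spec[OF spec[OF conjunct2[OF bspec[OF * that]]]])
  have "\<forall>i\<in>Basis. \<exists>A2. deriv_bounded (2 * N) w A2 \<and>
        (\<forall>\<theta> y. ((\<lambda>s. A1 i \<theta> (y + s *\<^sub>R i)) has_vector_derivative A2 \<theta> y) (at 0))"
  proof
    fix i :: 'a assume i: "i \<in> Basis"
    show "\<exists>A2. deriv_bounded (2 * N) w A2 \<and>
        (\<forall>\<theta> y. ((\<lambda>s. A1 i \<theta> (y + s *\<^sub>R i)) has_vector_derivative A2 \<theta> y) (at 0))"
      by (rule deriv_bounded_Suc_derivative[OF A1[OF i] i])
  qed
  from bchoice[OF this] obtain A2 where *: "\<forall>i\<in>Basis. deriv_bounded (2 * N) w (A2 i) \<and>
        (\<forall>\<theta> y. ((\<lambda>s. A1 i \<theta> (y + s *\<^sub>R i)) has_vector_derivative A2 i \<theta> y) (at 0))" ..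
  have A2: "deriv_bounded (2 * N) w (A2 i)" if "i \<in> Basis" for i
    by (rule conjunct1[OF bspec[OF * that]])
  have d2: "((\<lambda>s. A1 i \<theta> (y + s *\<^sub>R i)) has_vector_derivative A2 i \<theta> y) (at 0)" if "i \<in> Basis" for i \<theta> y
    by (rule spec[OF spec[OF conjunct2[OF bspec[OF * that]]]])
  \<comment> \<open>\<open>B\<close> is A minus its Laplacian in y. It keeps 2 N of the 2 N + 2
    orders, and its Fourier integral is that of A times 1 + |xi|^2.\<close>
  define B where "B = (\<lambda>\<theta> y. A \<theta> y + (- 1) * (\<Sum>i\<in>Basis. A2 i \<theta> y))"
  have "deriv_bounded (2 * N) w B"
    unfolding B_def
    by (intro deriv_bounded_add deriv_bounded_cmult deriv_bounded_sum A2 nn deriv_bounded_SucD[OF deriv_bounded_SucD[OF A]])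
  from Suc.IH[OF this] obtain C where C: "C \<ge> 0"
    "\<And>\<theta>. (1 + (norm (\<xi> \<theta>))\<^sup>2) ^ N * norm (LINT y|lborel. gauss 0 (\<xi> \<theta>) y * B \<theta> y) \<le> C * (LINT y|lborel. w \<theta> y)"
    by blast
  have eq: "(LINT y|lborel. gauss 0 (\<xi> \<theta>) y * B \<theta> y) =
      of_real (1 + (norm (\<xi> \<theta>))\<^sup>2) * (LINT y|lborel. gauss 0 (\<xi> \<theta>) y * A \<theta> y)" for \<theta>
  proof -
    let ?I = "LINT y|lborel. gauss 0 (\<xi> \<theta>) y * A \<theta> y"
    have alg: "\<i> * r * (\<i> * r * I) = - (r * r * I)" for r I :: complex
    proof -
      have "\<i> * r * (\<i> * r * I) = (\<i> * \<i>) * (r * r * I)" by (simp only: mult_ac)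
      then show ?thesis by simp
    qed
    have 2: "(LINT y|lborel. gauss 0 (\<xi> \<theta>) y * A2 i \<theta> y) = - of_real ((\<xi> \<theta> \<bullet> i)\<^sup>2) * ?I" if i: "i \<in> Basis" for i
      using deriv_bounded_integral_by_parts[OF A A1[OF i] d1[OF i, where \<theta> = \<theta>] w, where v = "\<xi> \<theta>"]
        deriv_bounded_integral_by_parts[OF A1[OF i] A2[OF i] d2[OF i, where \<theta> = \<theta>] w, where v = "\<xi> \<theta>"]
      by (simp add: power2_eq_square alg)
    have iA: "integrable lborel (\<lambda>y. gauss 0 (\<xi> \<theta>) y * A \<theta> y)"
      by (rule deriv_bounded_integrable[OF A w])
    have iA2: "integrable lborel (\<lambda>y. gauss 0 (\<xi> \<theta>) y * A2 i \<theta> y)" if "i \<in> Basis" for i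
      by (rule deriv_bounded_integrable[OF A2[OF that] w])
    have "(LINT y|lborel. gauss 0 (\<xi> \<theta>) y * B \<theta> y) =
        (LINT y|lborel. gauss 0 (\<xi> \<theta>) y * A \<theta> y - (\<Sum>i\<in>Basis. gauss 0 (\<xi> \<theta>) y * A2 i \<theta> y))"
      unfolding B_def by (simp add: algebra_simps sum_distrib_left sum_negf)
    also have "\<dots> = ?I - (\<Sum>i\<in>Basis. LINT y|lborel. gauss 0 (\<xi> \<theta>) y * A2 i \<theta> y)"
      using iA iA2 by (subst Bochner_Integration.integral_diff) auto
    also have "\<dots> = ?I - (\<Sum>i\<in>Basis. - of_real ((\<xi> \<theta> \<bullet> i)\<^sup>2) * ?I)"
      using 2 by simp
    also have "\<dots> = of_real (1 + (norm (\<xi> \<theta>))\<^sup>2) * ?I"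
      unfolding norm_sq_eq_sum_inner by (simp add: sum_negf algebra_simps sum_distrib_left)
    finally show ?thesis .
  qed
  have "(1 + (norm (\<xi> \<theta>))\<^sup>2) ^ Suc N * norm (LINT y|lborel. gauss 0 (\<xi> \<theta>) y * A \<theta> y) \<le> C * (LINT y|lborel. w \<theta> y)" for \<theta>
  proof -
    have "norm (complex_of_real (1 + (norm (\<xi> \<theta>))\<^sup>2)) = 1 + (norm (\<xi> \<theta>))\<^sup>2"
      unfolding norm_of_real by simp
    then show ?thesis using C(2)[of \<theta>] unfolding eq norm_mult by (simp only: power_Suc2 mult.assoc)
  qed
  with C(1) show ?case by blast
qed

section \<open>Weyl quantization of Gaussians\<close>

text \<open>The product form separates the variables, so that powers of it can be integrated against
  weights in x, xi and y independently.\<close>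

lemma one_plus_norm_midpoint_le:
  fixes x y \<xi> :: "'a::euclidean_space"
  shows "1 + norm ((1 / 2) *\<^sub>R (x + y), \<xi>) \<le> (1 + norm x) * (1 + norm \<xi>) * (1 + norm y)"
proof -
  have "norm ((1 / 2) *\<^sub>R (x + y), \<xi>) \<le> norm ((1 / 2) *\<^sub>R (x + y)) + norm \<xi>"
    by (rule norm_Pair_le)
  also have "norm ((1 / 2) *\<^sub>R (x + y)) \<le> norm x + norm y"
    using norm_triangle_ineq[of x y] norm_ge_zero[of x] norm_ge_zero[of y] by (simp only: norm_scaleR)
  finally have "1 + norm ((1 / 2) *\<^sub>R (x + y), \<xi>) \<le> 1 + norm x + norm y + norm \<xi>" by simp
  also have "\<dots> \<le> (1 + norm x) * (1 + norm \<xi>) * (1 + norm y)"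
    by (simp add: algebra_simps)
  finally show ?thesis .
qed

text \<open>The parameter is (x, xi, k). The index k of the cut-off is carried along so that symbol
  and Gaussian can be multiplied as families over the same parameters. The exponent m is the same
  for every order n: differentiating in y more often does not worsen the growth in xi.\<close>

lemma symbol_deriv_bounded:
  fixes b :: "'a::euclidean_space \<times> 'a \<Rightarrow> complex"
  assumes smooth: "smooth b"
    and bound: "\<And>vs. set vs \<subseteq> Basis \<Longrightarrow> \<exists>C. \<forall>X. cmod (iter_deriv vs b X) \<le> C * (1 + norm X) ^ m"
  shows "deriv_bounded n (\<lambda>\<theta> y. ((1 + norm (fst \<theta>)) * (1 + norm (fst (snd \<theta>))) * (1 + norm y)) ^ m)
     (\<lambda>(\<theta> :: 'a \<times> 'a \<times> nat) y. b ((1 / 2) *\<^sub>R (fst \<theta> + y), fst (snd \<theta>)))"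
    (is "deriv_bounded n ?w _")
proof -
  \<comment> \<open>Generalised to all iterated derivatives of b: a derivative in y along i prepends
    (i, 0) to \<open>vs\<close> and contributes the factor 1/2 of the midpoint.\<close>
  have "deriv_bounded n ?w (\<lambda>\<theta> y. iter_deriv vs b ((1 / 2) *\<^sub>R (fst \<theta> + y), fst (snd \<theta>)))"
    if "set vs \<subseteq> Basis" for vs
    using that
  proof (induction n arbitrary: vs)
    case base: 0
    obtain C where C: "\<And>X. cmod (iter_deriv vs b X) \<le> C * (1 + norm X) ^ m"
      using bound[OF base] by blast
    have "0 \<le> C" using order_trans[OF norm_ge_zero C[of 0]] by simp
    moreover have "cmod (iter_deriv vs b ((1 / 2) *\<^sub>R (fst \<theta> + y), fst (snd \<theta>))) \<le> C * ?w \<theta> y" for \<theta> y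
      by (rule order_trans[OF C]) (intro mult_left_mono power_mono one_plus_norm_midpoint_le, use \<open>0 \<le> C\<close> in auto)
    moreover have "continuous_on UNIV (iter_deriv vs b)"
      using smooth base unfolding smooth_def
      by (metis differentiable_imp_continuous_within continuous_at_imp_continuous_on)
    then have "continuous_on UNIV (\<lambda>y. iter_deriv vs b ((1 / 2) *\<^sub>R (fst \<theta> + y), fst (snd \<theta>)))" for \<theta> :: "'a \<times> 'a \<times> nat"
      by (rule continuous_on_compose2) (auto intro!: continuous_intros)
    ultimately show ?case by (simp only: deriv_bounded.simps) blast
  next
    case (Suc n)
    show ?case
    proof (rule deriv_bounded_SucI)
      show "deriv_bounded 0 ?w (\<lambda>(\<theta> :: 'a \<times> 'a \<times> nat) y. iter_deriv vs b ((1 / 2) *\<^sub>R (fst \<theta> + y), fst (snd \<theta>)))"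
        by (rule deriv_bounded_0I[OF Suc.IH[OF Suc.prems]])
    next
      fix i :: 'a assume i: "i \<in> Basis"
      have "deriv_bounded n ?w (\<lambda>(\<theta> :: 'a \<times> 'a \<times> nat) y. (1 / 2) * iter_deriv ((i, 0) # vs) b ((1 / 2) *\<^sub>R (fst \<theta> + y), fst (snd \<theta>)))"
        using Suc.IH[of "(i, 0) # vs"] Suc.prems i
        by (intro deriv_bounded_cmult) (auto simp: Basis_prod_def)
      moreover have "((\<lambda>s. iter_deriv vs b ((1 / 2) *\<^sub>R (fst \<theta> + (y + s *\<^sub>R i)), fst (snd \<theta>))) has_vector_derivative
          (1 / 2) * iter_deriv ((i, 0) # vs) b ((1 / 2) *\<^sub>R (fst \<theta> + y), fst (snd \<theta>))) (at 0)"
        for \<theta> :: "'a \<times> 'a \<times> nat" and y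
      proof -
        let ?X = "((1 / 2) *\<^sub>R (fst \<theta> + y), fst (snd \<theta>))"
        have d: "(iter_deriv vs b has_derivative frechet_derivative (iter_deriv vs b) (at ?X)) (at ?X)"
          using smooth Suc.prems unfolding smooth_def frechet_derivative_works[symmetric] by blast
        have "((\<lambda>s. iter_deriv vs b (?X + s *\<^sub>R ((1 / 2) *\<^sub>R (i, 0)))) has_vector_derivative
            frechet_derivative (iter_deriv vs b) (at ?X) ((1 / 2) *\<^sub>R (i, 0))) (at 0)"
          by (rule has_vector_derivative_along_line[OF d])
        moreover have "?X + s *\<^sub>R ((1 / 2) *\<^sub>R (i, 0)) = ((1 / 2) *\<^sub>R (fst \<theta> + (y + s *\<^sub>R i)), fst (snd \<theta>))" for s
          by (simp add: algebra_simps)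
        moreover have "frechet_derivative (iter_deriv vs b) (at ?X) ((1 / 2) *\<^sub>R (i, 0)) = (1 / 2) * iter_deriv ((i, 0) # vs) b ?X"
          by (simp only: linear_scale[OF has_derivative_linear[OF d]] iter_deriv.simps) (simp add: scaleR_conv_of_real)
        ultimately show ?thesis by (simp only:)
      qed
      ultimately show "\<exists>A'. deriv_bounded n ?w A' \<and>
          (\<forall>\<theta> y. ((\<lambda>s. iter_deriv vs b ((1 / 2) *\<^sub>R (fst \<theta> + (y + s *\<^sub>R i)), fst (snd \<theta>)))
             has_vector_derivative A' \<theta> y) (at 0))"
        by blast
    qed
  qed
  from this[of "[]"] show ?thesis by simp
qed

text \<open>The factor that a derivative of \<open>gauss (k \<theta>) w\<close> brings down has this
  form, the parameter entering only through a bounded coefficient.\<close>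

lemma affine_deriv_bounded:
  assumes c: "\<And>\<theta>. \<bar>c \<theta>\<bar> \<le> K"
  shows "deriv_bounded n (\<lambda>\<theta> y. 1 + norm y) (\<lambda>\<theta> y. of_real (c \<theta> * (y \<bullet> v)) + a)"
proof -
  have K: "K \<ge> 0" using c[of undefined] abs_ge_zero[of "c undefined"] by linarith
  have bound: "norm (of_real (c \<theta> * (y \<bullet> v)) + a) \<le> (K * norm v + norm a) * (1 + norm y)" for \<theta> y
  proof -
    have "norm (complex_of_real (c \<theta> * (y \<bullet> v))) \<le> K * (norm y * norm v)"
      unfolding norm_of_real abs_mult by (intro mult_mono c Cauchy_Schwarz_ineq2 K) auto
    also have "\<dots> \<le> K * norm v * (1 + norm y)" using K by (simp add: algebra_simps)
    finally have "norm (complex_of_real (c \<theta> * (y \<bullet> v))) \<le> K * norm v * (1 + norm y)" .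
    moreover have "norm a \<le> norm a * (1 + norm y)" by (simp add: distrib_left)
    ultimately show ?thesis
      using norm_triangle_ineq[of "of_real (c \<theta> * (y \<bullet> v))" a] unfolding distrib_right by linarith
  qed
  have "(K * norm v + norm a) \<ge> 0" using K by simp
  with bound have base: "deriv_bounded 0 (\<lambda>\<theta> y. 1 + norm y) (\<lambda>\<theta> y. of_real (c \<theta> * (y \<bullet> v)) + a)"
    unfolding deriv_bounded.simps by (intro conjI allI continuous_intros) blast
  show ?thesis
  proof (cases n)
    case (Suc n)
    show ?thesis unfolding Suc
    proof (rule deriv_bounded_SucI[OF base])
      fix i
      have "deriv_bounded n (\<lambda>\<theta> y. 1) (\<lambda>\<theta> y. complex_of_real (c \<theta> * (i \<bullet> v)))"
        by (rule deriv_bounded_const[where K = "K * \<bar>i \<bullet> v\<bar>"]) (auto simp: abs_mult norm_mult intro!: mult_right_mono c)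
      then have "deriv_bounded n (\<lambda>\<theta> y. 1 + norm y) (\<lambda>\<theta> y. complex_of_real (c \<theta> * (i \<bullet> v)))"
        by (rule deriv_bounded_weight) simp
      moreover have "((\<lambda>s. of_real (c \<theta> * ((y + s *\<^sub>R i) \<bullet> v)) + a) has_vector_derivative complex_of_real (c \<theta> * (i \<bullet> v))) (at 0)" for \<theta> y
        unfolding has_vector_derivative_def
        by (auto intro!: derivative_eq_intros simp: inner_add_left scaleR_conv_of_real)
      ultimately show "\<exists>A'. deriv_bounded n (\<lambda>\<theta> y. 1 + norm y) A' \<and>
          (\<forall>\<theta> y. ((\<lambda>s. of_real (c \<theta> * ((y + s *\<^sub>R i) \<bullet> v)) + a) has_vector_derivative A' \<theta> y) (at 0))"
        by blast
    qed
  qed (use base in simp)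
qed

text \<open>Each derivative costs one power of 1 + |y|. Uniformity in the parameter comes from the
  lower bound 1/2 on the damping for the size of the Gaussian, and from the upper bound K for the
  affine factors.\<close>

lemma gauss_deriv_bounded:
  assumes k: "\<And>\<theta>. 1 / 2 \<le> k \<theta>" "\<And>\<theta>. k \<theta> \<le> K"
  shows "deriv_bounded n (\<lambda>\<theta> y. (1 + norm y) ^ n * exp (- (1 / 2) * (norm y)\<^sup>2)) (\<lambda>\<theta> y. gauss (k \<theta>) w y)"
proof (induction n)
  case 0
  have "norm (gauss (k \<theta>) w y) \<le> exp (- (1 / 2) * (norm y)\<^sup>2)" for \<theta> y
    unfolding norm_gauss using mult_right_mono[OF k(1)[of \<theta>], of "(norm y)\<^sup>2"] by simp
  then show ?case
    by (auto intro!: exI[of _ 1] continuous_intros)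
next
  case (Suc n)
  show ?case
  proof (rule deriv_bounded_SucI)
    have "(1 + norm y) ^ n \<le> (1 + norm y) ^ Suc n" for y :: 'b
      by (rule power_increasing) auto
    then show "deriv_bounded 0 (\<lambda>\<theta> y. (1 + norm y) ^ Suc n * exp (- (1 / 2) * (norm y)\<^sup>2)) (\<lambda>\<theta> y. gauss (k \<theta>) w y)"
      by (intro deriv_bounded_weight[OF deriv_bounded_0I[OF Suc]] mult_right_mono) auto
  next
    fix i :: 'b
    have "deriv_bounded n (\<lambda>\<theta> y. (1 + norm y) * ((1 + norm y) ^ n * exp (- (1 / 2) * (norm y)\<^sup>2)))
      (\<lambda>\<theta> y. (of_real (- (2 * k \<theta>) * (y \<bullet> i)) + \<i> * of_real (w \<bullet> i)) * gauss (k \<theta>) w y)"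
    proof (intro deriv_bounded_mult affine_deriv_bounded[where K = "2 * K"] Suc)
      show "\<bar>- (2 * k \<theta>)\<bar> \<le> 2 * K" for \<theta> using k[of \<theta>] by simp
    qed auto
    then show "\<exists>A'. deriv_bounded n (\<lambda>\<theta> y. (1 + norm y) ^ Suc n * exp (- (1 / 2) * (norm y)\<^sup>2)) A' \<and>
        (\<forall>\<theta> y. ((\<lambda>s. gauss (k \<theta>) w (y + s *\<^sub>R i)) has_vector_derivative A' \<theta> y) (at 0))"
      using has_vector_derivative_along_line[OF gauss_has_derivative]
      by (intro exI conjI allI) (auto simp: mult.assoc)
  qed
qed

text \<open>The \<open>y\<close>-integral in the Weyl quantization of \<open>gauss (1 / 2) w\<close>, without the factor \<open>e\<^bsup>i x\<bullet>\<xi>\<^esup>\<close>;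
  \<open>e\<close> is the contribution of a Gaussian cut-off.\<close>

definition weyl_inner ::
    "('a::euclidean_space \<times> 'a \<Rightarrow> complex) \<Rightarrow> 'a \<Rightarrow> real \<Rightarrow> 'a \<Rightarrow> 'a \<Rightarrow> complex" where
  "weyl_inner b w e x \<xi> =
     (LINT y|lborel. gauss 0 (- \<xi>) y * (b ((1 / 2) *\<^sub>R (x + y), \<xi>) * gauss (1 / 2 + e) w y))"

lemma symbol_class_bound:
  fixes b :: "'a::euclidean_space \<times> 'a \<Rightarrow> complex"
  assumes b: "b \<in> symbol_class"
  obtains C m where "C \<ge> 0" "\<And>x y \<xi>. norm (b ((1 / 2) *\<^sub>R (x + y), \<xi>)) \<le> C * ((1 + norm x) * (1 + norm \<xi>) * (1 + norm y)) ^ m"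
    "\<And>X. norm (b X) \<le> C * (1 + norm X) ^ m"
proof -
  from b obtain m where "\<And>vs. set vs \<subseteq> Basis \<Longrightarrow> \<exists>C. \<forall>X. cmod (iter_deriv vs b X) \<le> C * (1 + norm X) ^ m"
    unfolding symbol_class_def by blast
  from this[of "[]"] obtain C where C: "\<And>X. cmod (b X) \<le> C * (1 + norm X) ^ m" by auto
  have C0: "0 \<le> C" using order_trans[OF norm_ge_zero C[of 0]] by simp
  have "norm (b ((1 / 2) *\<^sub>R (x + y), \<xi>)) \<le> C * ((1 + norm x) * (1 + norm \<xi>) * (1 + norm y)) ^ m" for x y \<xi>
    by (rule order_trans[OF C]) (intro mult_left_mono power_mono one_plus_norm_midpoint_le, use C0 in auto)
  with C C0 show ?thesis using that by blast
qed

lemma symbol_class_continuous: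
  assumes "b \<in> symbol_class"
  shows "continuous_on UNIV b"
proof -
  have "b differentiable (at x)" for x
    using assms unfolding symbol_class_def smooth_def
    by (metis (mono_tags, lifting) empty_subsetI iter_deriv.simps(1) list.set(1) mem_Collect_eq)
  then show ?thesis
    by (metis differentiable_imp_continuous_within continuous_at_imp_continuous_on)
qed

text \<open>The bound is uniform in k and integrable over xi, hence a dominating function for the
  removal of the cut-off.\<close>

lemma weyl_inner_decay:
  fixes b :: "'a::euclidean_space \<times> 'a \<Rightarrow> complex"
  assumes b: "b \<in> symbol_class"
  obtains C m where "C \<ge> 0" "\<And>k x \<xi>. norm (weyl_inner b w ((1 / (real k + 1))\<^sup>2) x \<xi>)
     \<le> C * (1 + norm x) ^ m * ((1 + norm \<xi>) ^ m / (1 + (norm \<xi>)\<^sup>2) ^ (m + DIM('a)))"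
proof -
  from b obtain m where smooth: "smooth b"
    and bound: "\<And>vs. set vs \<subseteq> Basis \<Longrightarrow> \<exists>C. \<forall>X. cmod (iter_deriv vs b X) \<le> C * (1 + norm X) ^ m"
    unfolding symbol_class_def by blast
  \<comment> \<open>m powers of 1 + |xi|^2 compensate the growth of the symbol in xi, and DIM more
    make the quotient integrable. Each power costs two derivatives, hence the order
    \<open>2 * N\<close> below.\<close>
  define N where "N = m + DIM('a)"
  \<comment> \<open>The cut-off exp (-|eps z|^2) with eps = 1 / (k + 1) adds eps^2 to the damping
    1/2 in y; eps <= 1 keeps the sum between 1/2 and 3/2.\<close>
  define e where "e = (\<lambda>\<theta> :: 'a \<times> 'a \<times> nat. (1 / (real (snd (snd \<theta>)) + 1))\<^sup>2)"
  define W where "W = (\<lambda>(\<theta> :: 'a \<times> 'a \<times> nat) (y::'a). ((1 + norm (fst \<theta>)) * (1 + norm (fst (snd \<theta>))) * (1 + norm y)) ^ m *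
      ((1 + norm y) ^ (2 * N) * exp (- (1 / 2) * (norm y)\<^sup>2)))"
  have e: "0 \<le> e \<theta>" "e \<theta> \<le> 1" for \<theta>
    by (auto simp: e_def power_le_one)
  have A: "deriv_bounded (2 * N) W
     (\<lambda>(\<theta> :: 'a \<times> 'a \<times> nat) y. b ((1 / 2) *\<^sub>R (fst \<theta> + y), fst (snd \<theta>)) * gauss (1 / 2 + e \<theta>) w y)"
    unfolding W_def
    by (intro deriv_bounded_mult symbol_deriv_bounded smooth bound gauss_deriv_bounded[where K = "3 / 2"])
      (use e in \<open>auto\<close>)
  define c where "c = (LINT y::'a|lborel. (1 + norm y) ^ (m + 2 * N) * exp (- (1 / 2) * (norm y)\<^sup>2))"
  have W_eq: "W \<theta> y = ((1 + norm (fst \<theta>)) * (1 + norm (fst (snd \<theta>)))) ^ m *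
     ((1 + norm y) ^ (m + 2 * N) * exp (- (1 / 2) * (norm y)\<^sup>2))" for \<theta> y
    by (simp add: W_def power_mult_distrib power_add)
  have intW: "integrable lborel (W \<theta>)" for \<theta>
    unfolding W_eq[abs_def] using integrable_power_gaussian[of "1/2", where 'a='a] by simp
  have IW: "(LINT y|lborel. W \<theta> y) = ((1 + norm (fst \<theta>)) * (1 + norm (fst (snd \<theta>)))) ^ m * c" for \<theta>
    unfolding W_eq c_def by simp
  have c0: "c \<ge> 0" unfolding c_def by (rule Bochner_Integration.integral_nonneg) simp
  have nn: "W \<theta> y \<ge> 0" for \<theta> y by (simp add: W_def)
  obtain C where C: "C \<ge> 0" "\<And>\<theta>. (1 + (norm (- fst (snd \<theta>)))\<^sup>2) ^ N *
     norm (LINT y|lborel. gauss 0 (- fst (snd \<theta>)) y * (b ((1 / 2) *\<^sub>R (fst \<theta> + y), fst (snd \<theta>)) * gauss (1 / 2 + e \<theta>) w y))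
       \<le> C * (LINT y|lborel. W \<theta> y)"
    using deriv_bounded_fourier_decay[OF A intW nn, of "\<lambda>\<theta>. - fst (snd \<theta>)"] by blast
  have "norm (weyl_inner b w ((1 / (real k + 1))\<^sup>2) x \<xi>)
     \<le> (C * c) * (1 + norm x) ^ m * ((1 + norm \<xi>) ^ m / (1 + (norm \<xi>)\<^sup>2) ^ N)" for k x \<xi>
  proof -
    have "(1 + (norm \<xi>)\<^sup>2) ^ N * norm (weyl_inner b w ((1 / (real k + 1))\<^sup>2) x \<xi>) \<le> C * (((1 + norm x) * (1 + norm \<xi>)) ^ m * c)"
      using C(2)[of "(x, \<xi>, k)"] unfolding IW by (simp add: weyl_inner_def e_def)
    moreover have "(1 + (norm \<xi>)\<^sup>2) ^ N > 0" by (simp add: add_pos_nonneg)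
    ultimately have "norm (weyl_inner b w ((1 / (real k + 1))\<^sup>2) x \<xi>) \<le> C * (((1 + norm x) * (1 + norm \<xi>)) ^ m * c) / (1 + (norm \<xi>)\<^sup>2) ^ N"
      by (simp add: pos_le_divide_eq mult.commute)
    then show ?thesis by (simp add: power_mult_distrib mult_ac)
  qed
  then show ?thesis using that[of "C * c" m] C(1) c0 unfolding N_def by simp
qed

lemma borel_measurable_pair_continuous:
  fixes f :: "'a::euclidean_space \<times> 'b::euclidean_space \<Rightarrow> 'c::topological_space"
  assumes "continuous_on UNIV f"
  shows "f \<in> borel_measurable (lborel \<Otimes>\<^sub>M lborel)"
  unfolding lborel_prod using borel_measurable_continuous_onI[OF assms] by simp

lemma continuous_symbol_comp:
  assumes "b \<in> symbol_class" "continuous_on UNIV f"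
  shows "continuous_on UNIV (\<lambda>x. b (f x))"
  by (rule continuous_on_compose2[OF symbol_class_continuous[OF assms(1)] assms(2)]) simp

lemma weyl_inner_borel_measurable:
  assumes b: "b \<in> symbol_class"
  shows "(\<lambda>z. weyl_inner b w e (fst z) (snd z)) \<in> borel_measurable borel"
proof -
  have "(\<lambda>z. weyl_inner b w e (fst z) (snd z)) \<in> borel_measurable lborel"
    unfolding weyl_inner_def
    by (rule lborel.borel_measurable_lebesgue_integral)
      (auto simp: split_beta intro!: borel_measurable_pair_continuous continuous_intros continuous_symbol_comp[OF b])
  then show ?thesis by simp
qed

lemma weyl_inner_borel_measurable_snd:
  assumes b: "b \<in> symbol_class"
  shows "weyl_inner b w e x \<in> borel_measurable borel"
proof -
  have "(\<lambda>\<xi>. (x, \<xi>)) \<in> borel_measurable borel"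
    by (intro borel_measurable_continuous_onI continuous_intros)
  from measurable_compose[OF this weyl_inner_borel_measurable[OF b]] show ?thesis by simp
qed

lemma cutoff_tendsto: "(\<lambda>k. (1 / (real k + 1))\<^sup>2) \<longlonglongrightarrow> 0"
proof -
  have "(\<lambda>k. inverse (real (Suc k))) \<longlonglongrightarrow> 0" by (rule LIMSEQ_inverse_real_of_nat)
  from tendsto_power[OF this, of 2] show ?thesis by (simp add: inverse_eq_divide add.commute)
qed

lemma weyl_inner_tendsto:
  fixes b :: "'a::euclidean_space \<times> 'a \<Rightarrow> complex"
  assumes b: "b \<in> symbol_class"
  shows "(\<lambda>k. weyl_inner b w ((1 / (real k + 1))\<^sup>2) x \<xi>) \<longlonglongrightarrow> weyl_inner b w 0 x \<xi>"
proof -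
  obtain C m where C: "C \<ge> 0"
    "\<And>y. norm (b ((1 / 2) *\<^sub>R (x + y), \<xi>)) \<le> C * ((1 + norm x) * (1 + norm \<xi>) * (1 + norm y)) ^ m"
    using symbol_class_bound[OF b] by metis
  have meas: "(\<lambda>y. gauss 0 (- \<xi>) y * (b ((1 / 2) *\<^sub>R (x + y), \<xi>) * gauss (1 / 2 + e) w y)) \<in> borel_measurable lborel" for e
    using borel_measurable_continuous_onI
    by (auto intro!: borel_measurable_continuous_onI continuous_intros continuous_symbol_comp[OF b])
  show ?thesis
    unfolding weyl_inner_def
  proof (rule integral_dominated_convergence[where w =
        "\<lambda>y. C * ((1 + norm x) * (1 + norm \<xi>)) ^ m * ((1 + norm y) ^ m * exp (- (1 / 2) * (norm y)\<^sup>2))"])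
    show "integrable lborel (\<lambda>y. C * ((1 + norm x) * (1 + norm \<xi>)) ^ m * ((1 + norm y) ^ m * exp (- (1 / 2) * (norm (y::'a))\<^sup>2)))"
      by (intro integrable_mult_right impI integrable_power_gaussian) simp
    show "AE y in lborel. (\<lambda>k. gauss 0 (- \<xi>) y * (b ((1 / 2) *\<^sub>R (x + y), \<xi>) * gauss (1 / 2 + (1 / (real k + 1))\<^sup>2) w y))
        \<longlonglongrightarrow> gauss 0 (- \<xi>) y * (b ((1 / 2) *\<^sub>R (x + y), \<xi>) * gauss (1 / 2 + 0) w y)"
    proof (rule AE_I2)
      fix y
      show "(\<lambda>k. gauss 0 (- \<xi>) y * (b ((1 / 2) *\<^sub>R (x + y), \<xi>) * gauss (1 / 2 + (1 / (real k + 1))\<^sup>2) w y))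
        \<longlonglongrightarrow> gauss 0 (- \<xi>) y * (b ((1 / 2) *\<^sub>R (x + y), \<xi>) * gauss (1 / 2 + 0) w y)"
        unfolding gauss_def by (intro tendsto_intros cutoff_tendsto)
    qed
    show "AE y in lborel. norm (gauss 0 (- \<xi>) y * (b ((1 / 2) *\<^sub>R (x + y), \<xi>) * gauss (1 / 2 + (1 / (real k + 1))\<^sup>2) w y))
       \<le> C * ((1 + norm x) * (1 + norm \<xi>)) ^ m * ((1 + norm y) ^ m * exp (- (1 / 2) * (norm y)\<^sup>2))" for k
    proof (rule AE_I2)
      fix y :: 'a
      have "norm (gauss 0 (- \<xi>) y * (b ((1 / 2) *\<^sub>R (x + y), \<xi>) * gauss (1 / 2 + (1 / (real k + 1))\<^sup>2) w y))
        = norm (b ((1 / 2) *\<^sub>R (x + y), \<xi>)) * exp (- (1 / 2 + (1 / (real k + 1))\<^sup>2) * (norm y)\<^sup>2)"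
        by (simp add: norm_mult norm_gauss)
      also have "\<dots> \<le> C * ((1 + norm x) * (1 + norm \<xi>) * (1 + norm y)) ^ m * exp (- (1 / 2) * (norm y)\<^sup>2)"
        by (intro mult_mono C(2)) (use C(1) in \<open>auto simp: left_diff_distrib\<close>)
      finally show "norm (gauss 0 (- \<xi>) y * (b ((1 / 2) *\<^sub>R (x + y), \<xi>) * gauss (1 / 2 + (1 / (real k + 1))\<^sup>2) w y))
       \<le> C * ((1 + norm x) * (1 + norm \<xi>)) ^ m * ((1 + norm y) ^ m * exp (- (1 / 2) * (norm y)\<^sup>2))"
        by (simp add: power_mult_distrib mult_ac)
    qed
  qed (rule meas)+
qed

text \<open>The value e = 0 is no member of the sequence in \<open>weyl_inner_decay\<close>, but the
  bound there is uniform in k and survives the limit.\<close>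

lemma weyl_inner_0_decay:
  fixes b :: "'a::euclidean_space \<times> 'a \<Rightarrow> complex"
  assumes b: "b \<in> symbol_class"
  obtains C m where "C \<ge> 0" "\<And>x \<xi>. norm (weyl_inner b w 0 x \<xi>)
     \<le> C * (1 + norm x) ^ m * ((1 + norm \<xi>) ^ m / (1 + (norm \<xi>)\<^sup>2) ^ (m + DIM('a)))"
proof -
  obtain C m where C: "C \<ge> 0" "\<And>k x \<xi>. norm (weyl_inner b w ((1 / (real k + 1))\<^sup>2) x \<xi>)
     \<le> C * (1 + norm x) ^ m * ((1 + norm \<xi>) ^ m / (1 + (norm \<xi>)\<^sup>2) ^ (m + DIM('a)))"
    using weyl_inner_decay[OF b] by blast
  have "norm (weyl_inner b w 0 x \<xi>)
     \<le> C * (1 + norm x) ^ m * ((1 + norm \<xi>) ^ m / (1 + (norm \<xi>)\<^sup>2) ^ (m + DIM('a)))" for x \<xi>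
    by (rule LIMSEQ_le_const2[OF tendsto_norm[OF weyl_inner_tendsto[OF b]]]) (use C(2) in blast)
  with C(1) show ?thesis using that by blast
qed

lemma norm_Pair_sq: "(norm (x, y))\<^sup>2 = (norm x)\<^sup>2 + (norm y)\<^sup>2"
  by (simp add: norm_Pair)

text \<open>The oscillatory integral has the same value for every cut-off, so a Gaussian one may be
  chosen, which merges with the other exponentials. With y integrated first, the decay in xi leaves
  an absolutely convergent integral over xi.\<close>

lemma weyl_quantization_gauss:
  fixes b :: "'a::euclidean_space \<times> 'a \<Rightarrow> complex"
  assumes b: "b \<in> symbol_class" and u: "has_weyl_quantization b (gauss (1 / 2) w) u"
  shows "u x = of_real (1 / (2 * pi) ^ DIM('a)) * (LINT \<xi>|lborel. gauss 0 x \<xi> * weyl_inner b w 0 x \<xi>)"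
proof -
  obtain v where osc: "has_oscillatory_integral (weyl_integrand b (gauss (1 / 2) w) x) v"
    and ux: "u x = of_real (1 / (2 * pi) ^ DIM('a)) * v"
    using u unfolding has_weyl_quantization_def by blast
  let ?h = "gauss 1 0 :: 'a \<times> 'a \<Rightarrow> complex"
  let ?a = "weyl_integrand b (gauss (1 / 2) w) x"
  have "?h \<in> schwartz" by (rule schwartz_gauss) simp
  moreover have "?h 0 = 1" by simp
  ultimately have int: "\<And>\<epsilon>. \<epsilon> > 0 \<Longrightarrow> integrable lborel (\<lambda>z. ?h (\<epsilon> *\<^sub>R z) * ?a z)"
    and lim: "((\<lambda>\<epsilon>. LINT z|lborel. ?h (\<epsilon> *\<^sub>R z) * ?a z) \<longlongrightarrow> v) (at_right 0)"
    using osc unfolding has_oscillatory_integral_def by blast+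
  \<comment> \<open>Dominated convergence is about sequences, so the limit at 0 from the right is
    taken along 1 / (k + 1).\<close>
  define \<epsilon> where "\<epsilon> = (\<lambda>k. 1 / (real k + 1))"
  have \<epsilon>: "\<epsilon> k > 0" for k by (simp add: \<epsilon>_def)
  have "filterlim \<epsilon> (at_right 0) sequentially"
  proof (rule tendsto_imp_filterlim_at_right)
    show "\<epsilon> \<longlonglongrightarrow> 0"
      using LIMSEQ_inverse_real_of_nat by (simp add: \<epsilon>_def inverse_eq_divide add.commute)
  qed (simp add: \<epsilon>)
  from filterlim_compose[OF lim this]
  have lim_v: "(\<lambda>k. LINT z|lborel. ?h (\<epsilon> k *\<^sub>R z) * ?a z) \<longlonglongrightarrow> v" .
  \<comment> \<open>The cut-off separates: its xi-part damps the plane wave in x.xi, its y-part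
    raises the damping of the test function from 1/2 to 1/2 + e^2.\<close>
  have eq: "?h (e *\<^sub>R (y, \<xi>)) * ?a (y, \<xi>) =
      gauss (e\<^sup>2) x \<xi> * (gauss 0 (- \<xi>) y * (b ((1 / 2) *\<^sub>R (x + y), \<xi>) * gauss (1 / 2 + e\<^sup>2) w y))" for e y \<xi>
  proof -
    have "?h (e *\<^sub>R (y, \<xi>)) * exp (\<i> * of_real ((x - y) \<bullet> \<xi>)) * gauss (1/2) w y =
       gauss (e\<^sup>2) x \<xi> * gauss 0 (- \<xi>) y * gauss (1 / 2 + e\<^sup>2) w y"
      unfolding gauss_def exp_add[symmetric]
      by (rule arg_cong[where f = exp])
        (simp add: norm_Pair_sq power_mult_distrib inner_diff_left inner_commute algebra_simps)
    then show ?thesis by (simp add: weyl_integrand_def mult_ac)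
  qed
  have I: "(LINT z|lborel. ?h (e *\<^sub>R z) * ?a z) = (LINT \<xi>|lborel. gauss (e\<^sup>2) x \<xi> * weyl_inner b w (e\<^sup>2) x \<xi>)"
    if e: "e > 0" for e
  proof -
    define g where "g = (\<lambda>z. ?h (e *\<^sub>R z) * ?a z)"
    have "integrable (lborel \<Otimes>\<^sub>M lborel) (\<lambda>(y, \<xi>). g (y, \<xi>))"
      using int[OF e] unfolding g_def[symmetric] case_prod_eta lborel_prod .
    from lborel_pair.integral_snd[OF this]
    have "(LINT z|lborel. g z) = (LINT \<xi>|lborel. LINT y|lborel. g (y, \<xi>))"
      unfolding case_prod_eta lborel_prod by simp
    then show ?thesis unfolding g_def eq weyl_inner_def by simp
  qed
  obtain C m where C: "C \<ge> 0" "\<And>k x \<xi>. norm (weyl_inner b w ((1 / (real k + 1))\<^sup>2) x \<xi>)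
     \<le> C * (1 + norm x) ^ m * ((1 + norm \<xi>) ^ m / (1 + (norm \<xi>)\<^sup>2) ^ (m + DIM('a)))"
    using weyl_inner_decay[OF b] by blast
  have "(\<lambda>k. LINT \<xi>|lborel. gauss ((\<epsilon> k)\<^sup>2) x \<xi> * weyl_inner b w ((\<epsilon> k)\<^sup>2) x \<xi>) \<longlonglongrightarrow> (LINT \<xi>|lborel. gauss 0 x \<xi> * weyl_inner b w 0 x \<xi>)"
  proof (rule integral_dominated_convergence[where w =
        "\<lambda>\<xi>. C * (1 + norm x) ^ m * ((1 + norm \<xi>) ^ m / (1 + (norm \<xi>)\<^sup>2) ^ (m + DIM('a)))"])
    note [measurable] = weyl_inner_borel_measurable_snd[OF b]
    show "(\<lambda>\<xi>. gauss 0 x \<xi> * weyl_inner b w 0 x \<xi>) \<in> borel_measurable lborel" by measurable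
    show "(\<lambda>\<xi>. gauss ((\<epsilon> k)\<^sup>2) x \<xi> * weyl_inner b w ((\<epsilon> k)\<^sup>2) x \<xi>) \<in> borel_measurable lborel" for k by measurable
    show "integrable lborel (\<lambda>\<xi>::'a. C * (1 + norm x) ^ m * ((1 + norm \<xi>) ^ m / (1 + (norm \<xi>)\<^sup>2) ^ (m + DIM('a))))"
      by (intro integrable_mult_right impI integrable_inverse_one_plus_norm_sq) simp
    show "AE \<xi> in lborel. (\<lambda>k. gauss ((\<epsilon> k)\<^sup>2) x \<xi> * weyl_inner b w ((\<epsilon> k)\<^sup>2) x \<xi>) \<longlonglongrightarrow> gauss 0 x \<xi> * weyl_inner b w 0 x \<xi>"
    proof (rule AE_I2)
      fix \<xi> :: 'a
      have "(\<lambda>k. gauss ((\<epsilon> k)\<^sup>2) x \<xi>) \<longlonglongrightarrow> gauss 0 x \<xi>"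
        unfolding gauss_def \<epsilon>_def by (intro tendsto_intros cutoff_tendsto)
      then show "(\<lambda>k. gauss ((\<epsilon> k)\<^sup>2) x \<xi> * weyl_inner b w ((\<epsilon> k)\<^sup>2) x \<xi>) \<longlonglongrightarrow> gauss 0 x \<xi> * weyl_inner b w 0 x \<xi>"
        using weyl_inner_tendsto[OF b] unfolding \<epsilon>_def by (rule tendsto_mult)
    qed
    show "AE \<xi> in lborel. norm (gauss ((\<epsilon> k)\<^sup>2) x \<xi> * weyl_inner b w ((\<epsilon> k)\<^sup>2) x \<xi>)
        \<le> C * (1 + norm x) ^ m * ((1 + norm \<xi>) ^ m / (1 + (norm \<xi>)\<^sup>2) ^ (m + DIM('a)))" for k
    proof (rule AE_I2)
      fix \<xi> :: 'a
      have "norm (gauss ((\<epsilon> k)\<^sup>2) x \<xi>) \<le> 1" by (simp add: norm_gauss)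
      then have "norm (gauss ((\<epsilon> k)\<^sup>2) x \<xi> * weyl_inner b w ((\<epsilon> k)\<^sup>2) x \<xi>) \<le> norm (weyl_inner b w ((\<epsilon> k)\<^sup>2) x \<xi>)"
        unfolding norm_mult by (simp add: mult_left_le_one_le)
      also have "\<dots> \<le> C * (1 + norm x) ^ m * ((1 + norm \<xi>) ^ m / (1 + (norm \<xi>)\<^sup>2) ^ (m + DIM('a)))"
        unfolding \<epsilon>_def by (rule C)
      finally show "norm (gauss ((\<epsilon> k)\<^sup>2) x \<xi> * weyl_inner b w ((\<epsilon> k)\<^sup>2) x \<xi>)
        \<le> C * (1 + norm x) ^ m * ((1 + norm \<xi>) ^ m / (1 + (norm \<xi>)\<^sup>2) ^ (m + DIM('a)))" .
    qed
  qed
  then have "v = (LINT \<xi>|lborel. gauss 0 x \<xi> * weyl_inner b w 0 x \<xi>)"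
    using lim_v LIMSEQ_unique unfolding I[OF \<epsilon>] by blast
  then show ?thesis using ux by simp
qed

section \<open>Isometries and the midpoint substitution\<close>

lemma
  fixes T :: "'a::euclidean_space \<Rightarrow> 'a" and F :: "'a \<Rightarrow> 'b::{banach, second_countable_topology}"
  assumes T: "orthogonal_transformation T" and F: "F \<in> borel_measurable borel"
  shows integrable_lborel_isometry: "integrable lborel (\<lambda>x. F (T x)) \<longleftrightarrow> integrable lborel F"
    and integral_lborel_isometry: "(LINT x|lborel. F (T x)) = (LINT x|lborel. F x)"
proof -
  have lin: "linear T" using T by (simp add: orthogonal_transformation)
  have m: "T \<in> lborel \<rightarrow>\<^sub>M borel"
    by (simp, intro borel_measurable_continuous_onI linear_continuous_on linear_conv_bounded_linear[THEN iffD1] lin)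
  show "integrable lborel (\<lambda>x. F (T x)) \<longleftrightarrow> integrable lborel F"
    using integrable_distr_eq[OF m F] distr_lborel_isometry[OF T] by simp
  show "(LINT x|lborel. F (T x)) = (LINT x|lborel. F x)"
    using integral_distr[OF m F] distr_lborel_isometry[OF T] by simp
qed

text \<open>The substitution x = z + v / 2, y = z - v / 2 has Jacobian 1 in absolute value. It is
  the isometry \<open>S\<close>, sum and difference over sqrt 2, after the dilations by sqrt 2 in z
  and by 1 / sqrt 2 in v, whose Jacobians cancel.\<close>

lemma integral_midpoint_difference:
  fixes F :: "'a::euclidean_space \<times> 'a \<Rightarrow> complex"
  assumes F: "integrable lborel F"
  shows "(LINT x|lborel. LINT y|lborel. F (x, y)) =
    (LINT z|lborel. LINT v|lborel. F (z + (1 / 2) *\<^sub>R v, z - (1 / 2) *\<^sub>R v))"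
proof -
  define r where "r = sqrt (2::real)"
  have r: "r > 0" "r * r = 2" by (auto simp: r_def)
  define S :: "'a \<times> 'a \<Rightarrow> 'a \<times> 'a" where
    "S = (\<lambda>X. ((1 / r) *\<^sub>R (fst X + snd X), (1 / r) *\<^sub>R (fst X - snd X)))"
  have "linear S"
    unfolding S_def by (intro linearI) (auto simp: algebra_simps)
  moreover have "norm (S X) = norm X" for X
  proof -
    have "(norm (S X))\<^sup>2 = (norm X)\<^sup>2"
    proof -
      have h: "(1 / r)\<^sup>2 = 1 / 2" using r by (simp add: power_divide power2_eq_square)
      have "(norm (S X))\<^sup>2 = 1 / 2 * (norm (fst X + snd X))\<^sup>2 + 1 / 2 * (norm (fst X - snd X))\<^sup>2"
        unfolding S_def norm_Pair_sq norm_scaleR power_mult_distrib power2_abs h by simp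
      also have "\<dots> = (norm (fst X))\<^sup>2 + (norm (snd X))\<^sup>2"
        by (simp add: power2_norm_eq_inner inner_simps inner_commute field_simps)
      also have "\<dots> = (norm X)\<^sup>2" by (metis norm_Pair_sq prod.collapse)
      finally show ?thesis .
    qed
    then show ?thesis by simp
  qed
  ultimately have S: "orthogonal_transformation S" by (simp add: orthogonal_transformation)
  have Fm[measurable]: "F \<in> borel_measurable borel" using borel_measurable_integrable[OF F] by simp
  define G where "G = (\<lambda>X. F (S X))"
  have G: "integrable lborel G"
    unfolding G_def by (simp add: integrable_lborel_isometry[OF S Fm] F)
  have Gm: "G \<in> borel_measurable (lborel \<Otimes>\<^sub>M lborel)"
    unfolding lborel_prod by (rule borel_measurable_integrable[OF G])
  have Gp: "(\<lambda>q. G (p, q)) \<in> borel_measurable borel" for p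
    using measurable_Pair2[OF Gm, of p] by simp
  have g: "(\<lambda>p. LINT q|lborel. G (p, q)) \<in> borel_measurable borel"
    using lborel.borel_measurable_lebesgue_integral[of "\<lambda>p q. G (p, q)" lborel] Gm by (simp add: case_prod_eta)
  have "(LINT x|lborel. LINT y|lborel. F (x, y)) = integral\<^sup>L lborel F"
    using lborel_pair.integral_fst'[of F] F by (simp add: lborel_prod)
  also have "\<dots> = integral\<^sup>L lborel G"
    unfolding G_def by (rule integral_lborel_isometry[OF S Fm, symmetric])
  also have "\<dots> = (LINT p|lborel. LINT q|lborel. G (p, q))"
    using lborel_pair.integral_fst'[of G] G by (simp add: lborel_prod)
  also have "\<dots> = r ^ DIM('a) *\<^sub>R (LINT z|lborel. LINT q|lborel. G (r *\<^sub>R z, q))"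
    using integral_lborel_affine[OF g, of r 0] r by simp
  also have "(\<lambda>z. LINT q|lborel. G (r *\<^sub>R z, q)) = (\<lambda>z. (1 / r) ^ DIM('a) *\<^sub>R (LINT v|lborel. G (r *\<^sub>R z, (1 / r) *\<^sub>R v)))"
    using integral_lborel_affine[OF Gp, of "1 / r" _ 0] r by simp
  also have "r ^ DIM('a) *\<^sub>R (LINT z|lborel. (1 / r) ^ DIM('a) *\<^sub>R (LINT v|lborel. G (r *\<^sub>R z, (1 / r) *\<^sub>R v)))
      = (LINT z|lborel. LINT v|lborel. G (r *\<^sub>R z, (1 / r) *\<^sub>R v))"
    using r by (simp flip: power_mult_distrib)
  also have "(\<lambda>z v. G (r *\<^sub>R z, (1 / r) *\<^sub>R v)) = (\<lambda>z v. F (z + (1 / 2) *\<^sub>R v, z - (1 / 2) *\<^sub>R v))"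
    using r by (simp add: G_def S_def scaleR_add_right scaleR_diff_right)
  finally show ?thesis .
qed

lemma integrable_poly_growth_gauss:
  fixes f :: "'a::euclidean_space \<Rightarrow> complex"
  assumes k: "k > 0" and f: "f \<in> borel_measurable borel" and bound: "\<And>x. norm (f x) \<le> C * (1 + norm x) ^ n"
  shows "integrable lborel (\<lambda>x. f x * gauss k v x)"
proof (rule Bochner_Integration.integrable_bound)
  show "integrable lborel (\<lambda>x::'a. C * ((1 + norm x) ^ n * exp (- k * (norm x)\<^sup>2)))"
    by (intro integrable_mult_right impI integrable_power_gaussian k)
  show "(\<lambda>x. f x * gauss k v x) \<in> borel_measurable lborel" using f by simp
  show "AE x in lborel. norm (f x * gauss k v x) \<le> norm (C * ((1 + norm x) ^ n * exp (- k * (norm x)\<^sup>2)))"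
  proof (rule AE_I2)
    fix x
    have "norm (f x * gauss k v x) \<le> C * ((1 + norm x) ^ n * exp (- k * (norm x)\<^sup>2))"
      unfolding norm_mult norm_gauss using mult_right_mono[OF bound[of x], of "exp (- k * (norm x)\<^sup>2)"]
      by (simp add: mult.assoc)
    also have "\<dots> \<le> norm (C * ((1 + norm x) ^ n * exp (- k * (norm x)\<^sup>2)))" by simp
    finally show "norm (f x * gauss k v x) \<le> norm (C * ((1 + norm x) ^ n * exp (- k * (norm x)\<^sup>2)))" .
  qed
qed

lemma norm_inner_le_one_plus: "norm (complex_of_real (w \<bullet> x)) \<le> norm w * (1 + norm x) ^ 1"
proof -
  have "norm w * norm x \<le> norm w * (1 + norm x)" by (rule mult_left_mono) auto
  then show ?thesis using Cauchy_Schwarz_ineq2[of w x] by simp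
qed

lemma norm_affine_le:
  fixes D :: complex
  shows "norm (D + 2 * \<i> * of_real (w \<bullet> x)) \<le> (norm D + 2 * norm w) * (1 + norm x)"
proof -
  have "norm (D + 2 * \<i> * of_real (w \<bullet> x)) \<le> norm D + 2 * \<bar>w \<bullet> x\<bar>"
    by (rule order_trans[OF norm_triangle_ineq]) (simp add: norm_mult)
  also have "\<dots> \<le> norm D * (1 + norm x) + 2 * (norm w * (1 + norm x))"
    using norm_inner_le_one_plus[of w x] by (intro add_mono) (simp_all add: distrib_left)
  finally show ?thesis by (simp add: algebra_simps)
qed

text \<open>The first moment is read off from the vanishing integral of the derivative of
  \<open>gauss k v\<close> in direction w.\<close>

lemma
  fixes w v :: "'a::euclidean_space"
  assumes k: "k > 0"
  shows integrable_inner_gauss: "integrable lborel (\<lambda>x. of_real (w \<bullet> x) * gauss k v x)"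
    and integral_inner_gauss: "(LINT x|lborel. of_real (w \<bullet> x) * gauss k v x) =
      \<i> * of_real ((w \<bullet> v) / (2 * k)) * (LINT x|lborel. gauss k v x)"
proof -
  show int: "integrable lborel (\<lambda>x. of_real (w \<bullet> x) * gauss k v x)"
    by (rule integrable_poly_growth_gauss[OF k _ norm_inner_le_one_plus]) measurable
  have eq: "(of_real (- (2 * k) * (x \<bullet> w)) + \<i> * of_real (v \<bullet> w)) * gauss k v x =
     - of_real (2 * k) * (of_real (w \<bullet> x) * gauss k v x) + \<i> * of_real (v \<bullet> w) * gauss k v x" for x
    by (simp add: inner_commute algebra_simps)
  have "(LINT x|lborel. (of_real (- (2 * k) * (x \<bullet> w)) + \<i> * of_real (v \<bullet> w)) * gauss k v x) = 0"
  proof (rule integral_directional_derivative_eq_0)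
    show "integrable lborel (gauss k v)" by (rule integrable_gauss[OF k])
    show "integrable lborel (\<lambda>x. (of_real (- (2 * k) * (x \<bullet> w)) + \<i> * of_real (v \<bullet> w)) * gauss k v x)"
      unfolding eq using int integrable_gauss[OF k] by (intro Bochner_Integration.integrable_add integrable_mult_right) auto
    show "continuous_on UNIV (\<lambda>x. (of_real (- (2 * k) * (x \<bullet> w)) + \<i> * of_real (v \<bullet> w)) * gauss k v x)"
      by (intro continuous_intros)
    show "((\<lambda>s. gauss k v (y + s *\<^sub>R w)) has_vector_derivative
        (of_real (- (2 * k) * (y \<bullet> w)) + \<i> * of_real (v \<bullet> w)) * gauss k v y) (at 0)" for y
      by (rule has_vector_derivative_along_line[OF gauss_has_derivative])
  qed
  then have "- of_real (2 * k) * (LINT x|lborel. of_real (w \<bullet> x) * gauss k v x) + \<i> * of_real (v \<bullet> w) * (LINT x|lborel. gauss k v x) = 0"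
    unfolding eq using int integrable_gauss[OF k] by (subst (asm) Bochner_Integration.integral_add) auto
  then show "(LINT x|lborel. of_real (w \<bullet> x) * gauss k v x) =
      \<i> * of_real ((w \<bullet> v) / (2 * k)) * (LINT x|lborel. gauss k v x)"
    using k by (simp add: field_simps inner_commute)
qed

lemma integrable_pair_mult:
  fixes f :: "'a::euclidean_space \<Rightarrow> real" and g :: "'b::euclidean_space \<Rightarrow> real"
  assumes f: "integrable lborel f" and g: "integrable lborel g"
  shows "integrable lborel (\<lambda>z. f (fst z) * g (snd z))"
proof -
  have [measurable]: "f \<in> borel_measurable borel" "g \<in> borel_measurable borel"
    using borel_measurable_integrable[OF f] borel_measurable_integrable[OF g] by simp_all
  have "integrable (lborel \<Otimes>\<^sub>M lborel) (\<lambda>z. f (fst z) * g (snd z))"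
  proof (rule lborel_pair.Fubini_integrable)
    show "integrable lborel (\<lambda>x. LINT y|lborel. norm (f (fst (x, y)) * g (snd (x, y))))"
      using f by (simp add: abs_mult)
    show "AE x in lborel. integrable lborel (\<lambda>y. f (fst (x, y)) * g (snd (x, y)))"
      using g by simp
  qed measurable
  then show ?thesis by (simp add: lborel_prod)
qed

lemma integrable_pair_bound:
  fixes F :: "'a::euclidean_space \<times> 'b::euclidean_space \<Rightarrow> complex"
  assumes f: "integrable lborel f" and g: "integrable lborel g" and F: "F \<in> borel_measurable borel"
    and bound: "\<And>x y. norm (F (x, y)) \<le> f x * g y"
  shows "integrable lborel F"
proof (rule Bochner_Integration.integrable_bound[OF integrable_pair_mult[OF f g]])
  show "AE z in lborel. norm (F z) \<le> norm (f (fst z) * g (snd z))"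
    using bound by (intro AE_I2) (metis abs_ge_self order_trans prod.collapse real_norm_def)
qed (use F in simp)

text \<open>By the parallelogram law the quadratic terms split into one in the midpoint z and one in
  the difference v; the phases in w add up to 2 w.z and those in xi to xi.v. This is the integrand
  of the Wigner function.\<close>

lemma gauss_midpoint:
  fixes z v w \<xi> :: "'a::euclidean_space"
  shows "gauss (1 / 2) w (z + (1 / 2) *\<^sub>R v) * gauss 0 (z + (1 / 2) *\<^sub>R v) \<xi> *
    gauss 0 (- \<xi>) (z - (1 / 2) *\<^sub>R v) * gauss (1 / 2) w (z - (1 / 2) *\<^sub>R v) =
    gauss 1 (2 *\<^sub>R w) z * gauss (1 / 4) \<xi> v"
  unfolding gauss_def exp_add[symmetric]
  by (rule arg_cong[where f = exp])
    (simp add: power2_norm_eq_inner inner_simps inner_commute algebra_simps)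

lemma gauss_Pair: "gauss k (v, v') (x, y) = gauss k v x * gauss k v' y"
  unfolding gauss_def exp_add[symmetric]
  by (rule arg_cong[where f = exp]) (simp add: norm_Pair_sq algebra_simps)

text \<open>For fixed xi the integral over x and y is taken in the midpoint z and the difference v.
  The symbol depends on z alone, so the v-integral can be evaluated, and it yields the Gaussian in
  xi that completes the Wigner function on phase space.\<close>

lemma weyl_gaussian_fibre:
  fixes b :: "'a::euclidean_space \<times> 'a \<Rightarrow> complex"
  assumes b: "b \<in> symbol_class"
  shows "(LINT x|lborel. (D + 2 * \<i> * of_real (w \<bullet> x)) * gauss (1 / 2) w x * (gauss 0 x \<xi> * weyl_inner b w 0 x \<xi>)) =
    of_real (sqrt (4 * pi) ^ DIM('a)) *
     (LINT z|lborel. b (z, \<xi>) * ((D + 2 * \<i> * of_real (w \<bullet> z) - 2 * of_real (w \<bullet> \<xi>)) * gauss 1 (2 *\<^sub>R w, 0) (z, \<xi>)))"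
proof -
  define F where "F = (\<lambda>X. (D + 2 * \<i> * of_real (w \<bullet> fst X)) * gauss (1 / 2) w (fst X) * (gauss 0 (fst X) \<xi> *
     (gauss 0 (- \<xi>) (snd X) * (b ((1 / 2) *\<^sub>R (fst X + snd X), \<xi>) * gauss (1 / 2) w (snd X)))))"
  obtain C m where C: "C \<ge> 0"
    "\<And>x y. norm (b ((1 / 2) *\<^sub>R (x + y), \<xi>)) \<le> C * ((1 + norm x) * (1 + norm \<xi>) * (1 + norm y)) ^ m"
    using symbol_class_bound[OF b] by metis
  have intF: "integrable lborel F"
  proof (rule integrable_pair_bound)
    show "integrable lborel (\<lambda>x::'a. (norm D + 2 * norm w) * ((1 + norm x) ^ (Suc m) * exp (- (1 / 2) * (norm x)\<^sup>2)))"
      by (intro integrable_mult_right impI integrable_power_gaussian) simp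
    show "integrable lborel (\<lambda>y::'a. C * (1 + norm \<xi>) ^ m * ((1 + norm y) ^ m * exp (- (1 / 2) * (norm y)\<^sup>2)))"
      by (intro integrable_mult_right impI integrable_power_gaussian) simp
    show "F \<in> borel_measurable borel"
      unfolding F_def by (intro borel_measurable_continuous_onI continuous_intros continuous_symbol_comp[OF b])
    fix x y :: 'a
    have "norm (F (x, y)) = norm (D + 2 * \<i> * of_real (w \<bullet> x)) * exp (- (1 / 2) * (norm x)\<^sup>2) *
        (norm (b ((1 / 2) *\<^sub>R (x + y), \<xi>)) * exp (- (1 / 2) * (norm y)\<^sup>2))"
      unfolding F_def by (simp add: norm_mult norm_gauss)
    also have "\<dots> \<le> ((norm D + 2 * norm w) * (1 + norm x)) * exp (- (1 / 2) * (norm x)\<^sup>2) *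
        ((C * ((1 + norm x) * (1 + norm \<xi>) * (1 + norm y)) ^ m) * exp (- (1 / 2) * (norm y)\<^sup>2))"
      by (intro mult_mono norm_affine_le C mult_nonneg_nonneg) (use C(1) in auto)
    finally show "norm (F (x, y)) \<le> ((norm D + 2 * norm w) * ((1 + norm x) ^ (Suc m) * exp (- (1 / 2) * (norm x)\<^sup>2))) *
       (C * (1 + norm \<xi>) ^ m * ((1 + norm y) ^ m * exp (- (1 / 2) * (norm y)\<^sup>2)))"
      by (simp add: power_mult_distrib mult_ac)
  qed
  \<comment> \<open>Under \<open>gauss (1 / 4) \<xi>\<close> the normalized first moment of v is 2i
    xi, so i w.v contributes -2 w.xi.\<close>
  have I: "(LINT v|lborel. (D' + \<i> * of_real (w \<bullet> v)) * gauss (1 / 4) \<xi> v) =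
      (D' - 2 * of_real (w \<bullet> \<xi>)) * of_real (sqrt (4 * pi) ^ DIM('a) * exp (- (norm \<xi>)\<^sup>2))" for D'
  proof -
    have k: "(1 / 4 :: real) > 0" by simp
    have "(LINT v|lborel. (D' + \<i> * of_real (w \<bullet> v)) * gauss (1 / 4) \<xi> v) =
        (LINT v|lborel. D' * gauss (1 / 4) \<xi> v + \<i> * (of_real (w \<bullet> v) * gauss (1 / 4) \<xi> v))"
      by (simp add: algebra_simps)
    also have "\<dots> = D' * (LINT v|lborel. gauss (1 / 4) \<xi> v) + \<i> * (LINT v|lborel. of_real (w \<bullet> v) * gauss (1 / 4) \<xi> v)"
    proof -
      have "integrable lborel (\<lambda>v. D' * gauss (1 / 4) \<xi> v)"
        by (intro integrable_mult_right impI integrable_gauss k)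
      moreover have "integrable lborel (\<lambda>v. \<i> * (of_real (w \<bullet> v) * gauss (1 / 4) \<xi> v))"
        by (intro integrable_mult_right impI integrable_inner_gauss k)
      ultimately show ?thesis by simp
    qed
    also have "\<dots> = (D' - 2 * of_real (w \<bullet> \<xi>)) * (LINT v|lborel. gauss (1 / 4) \<xi> v)"
      unfolding integral_inner_gauss[OF k] by (simp add: algebra_simps)
    finally show ?thesis unfolding integral_gauss[OF k] by (simp add: mult.commute)
  qed
  have "(LINT x|lborel. (D + 2 * \<i> * of_real (w \<bullet> x)) * gauss (1 / 2) w x * (gauss 0 x \<xi> * weyl_inner b w 0 x \<xi>))
     = (LINT x|lborel. LINT y|lborel. F (x, y))"
    unfolding weyl_inner_def F_def by simp
  also have "\<dots> = (LINT z|lborel. LINT v|lborel. F (z + (1 / 2) *\<^sub>R v, z - (1 / 2) *\<^sub>R v))"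
    by (rule integral_midpoint_difference[OF intF])
  also have "(\<lambda>z v. F (z + (1 / 2) *\<^sub>R v, z - (1 / 2) *\<^sub>R v)) =
      (\<lambda>z v. (b (z, \<xi>) * gauss 1 (2 *\<^sub>R w) z) * (((D + 2 * \<i> * of_real (w \<bullet> z)) + \<i> * of_real (w \<bullet> v)) * gauss (1 / 4) \<xi> v))"
  proof (intro ext)
    fix z v :: 'a
    have mid: "(1 / 2) *\<^sub>R ((z + (1 / 2) *\<^sub>R v) + (z - (1 / 2) *\<^sub>R v)) = z"
    proof -
      have "(z + a) + (z - a) = 2 *\<^sub>R z" for a :: 'a
        by (simp add: scaleR_2 algebra_simps)
      then show ?thesis by simp
    qed
    have "F (z + (1 / 2) *\<^sub>R v, z - (1 / 2) *\<^sub>R v) = b (z, \<xi>) * (D + 2 * \<i> * of_real (w \<bullet> (z + (1 / 2) *\<^sub>R v))) *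
      (gauss (1 / 2) w (z + (1 / 2) *\<^sub>R v) * gauss 0 (z + (1 / 2) *\<^sub>R v) \<xi> *
    gauss 0 (- \<xi>) (z - (1 / 2) *\<^sub>R v) * gauss (1 / 2) w (z - (1 / 2) *\<^sub>R v))"
      unfolding F_def fst_conv snd_conv mid by (simp only: mult_ac)
    also have "\<dots> = b (z, \<xi>) * (D + 2 * \<i> * of_real (w \<bullet> (z + (1 / 2) *\<^sub>R v))) * (gauss 1 (2 *\<^sub>R w) z * gauss (1 / 4) \<xi> v)"
      unfolding gauss_midpoint ..
    also have "D + 2 * \<i> * of_real (w \<bullet> (z + (1 / 2) *\<^sub>R v)) = (D + 2 * \<i> * of_real (w \<bullet> z)) + \<i> * of_real (w \<bullet> v)"
      by (simp add: inner_add_right algebra_simps)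
    finally show "F (z + (1 / 2) *\<^sub>R v, z - (1 / 2) *\<^sub>R v) =
       (b (z, \<xi>) * gauss 1 (2 *\<^sub>R w) z) * (((D + 2 * \<i> * of_real (w \<bullet> z)) + \<i> * of_real (w \<bullet> v)) * gauss (1 / 4) \<xi> v)"
      by (simp only: mult_ac)
  qed
  also have "(LINT z|lborel. LINT v|lborel. (b (z, \<xi>) * gauss 1 (2 *\<^sub>R w) z) * (((D + 2 * \<i> * of_real (w \<bullet> z)) + \<i> * of_real (w \<bullet> v)) * gauss (1 / 4) \<xi> v))
    = (LINT z|lborel. of_real (sqrt (4 * pi) ^ DIM('a)) *
       (b (z, \<xi>) * ((D + 2 * \<i> * of_real (w \<bullet> z) - 2 * of_real (w \<bullet> \<xi>)) * gauss 1 (2 *\<^sub>R w, 0) (z, \<xi>))))"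
  proof (rule Bochner_Integration.integral_cong[OF refl])
    fix z :: 'a
    show "(LINT v|lborel. (b (z, \<xi>) * gauss 1 (2 *\<^sub>R w) z) * (((D + 2 * \<i> * of_real (w \<bullet> z)) + \<i> * of_real (w \<bullet> v)) * gauss (1 / 4) \<xi> v))
      = of_real (sqrt (4 * pi) ^ DIM('a)) *
       (b (z, \<xi>) * ((D + 2 * \<i> * of_real (w \<bullet> z) - 2 * of_real (w \<bullet> \<xi>)) * gauss 1 (2 *\<^sub>R w, 0) (z, \<xi>)))"
      unfolding integral_mult_right_zero I by (simp add: gauss_Pair gauss_def[of 1 0] mult_ac flip: exp_of_real)
  qed
  finally show ?thesis by simp
qed

lemma integrable_symbol_moment_gauss:
  fixes b :: "'a::euclidean_space \<times> 'a \<Rightarrow> complex"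
  assumes b: "b \<in> borel_measurable borel" and bound: "\<And>X. norm (b X) \<le> C * (1 + norm X) ^ m"
  shows "integrable lborel (\<lambda>X. b X * ((D + 2 * \<i> * of_real (w \<bullet> fst X)) * gauss 1 (2 *\<^sub>R w, 0) X))"
proof -
  have C: "C \<ge> 0" using order_trans[OF norm_ge_zero bound[of 0]] by simp
  have "integrable lborel (\<lambda>X. b X * gauss 1 (2 *\<^sub>R w, 0) X)"
    by (rule integrable_poly_growth_gauss[OF _ b bound]) simp
  moreover have "integrable lborel (\<lambda>X. b X * of_real ((w, 0) \<bullet> X) * gauss 1 (2 *\<^sub>R w, 0) X)"
  proof (rule integrable_poly_growth_gauss)
    show "(\<lambda>X. b X * of_real ((w, 0) \<bullet> X)) \<in> borel_measurable borel" using b by simp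
    fix X
    have "norm (b X * of_real ((w, 0) \<bullet> X)) \<le> (C * (1 + norm X) ^ m) * (norm (w, 0 :: 'a) * (1 + norm X) ^ 1)"
      unfolding norm_mult by (intro mult_mono bound norm_inner_le_one_plus) (use C in auto)
    then show "norm (b X * of_real ((w, 0) \<bullet> X)) \<le> (C * norm (w, 0 :: 'a)) * (1 + norm X) ^ Suc m"
      by (simp add: mult_ac)
  qed simp
  moreover have "b X * ((D + 2 * \<i> * of_real (w \<bullet> fst X)) * gauss 1 (2 *\<^sub>R w, 0) X) =
      D * (b X * gauss 1 (2 *\<^sub>R w, 0) X) + 2 * \<i> * (b X * of_real ((w, 0) \<bullet> X) * gauss 1 (2 *\<^sub>R w, 0) X)" for X
    by (cases X) (simp add: algebra_simps)
  ultimately show ?thesis by simp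
qed

text \<open>Testing \<open>H u = f\<close> against \<open>f = e\<^bsup>-|x|\<^sup>2/2 + iw\<bullet>x\<^esup>\<close> itself.\<close>

lemma weyl_gaussian_identity:
  fixes b :: "'a::euclidean_space \<times> 'a \<Rightarrow> complex"
  assumes sym: "is_weyl_symbol b harmonic_oscillator_inverse"
    and even: "\<And>z \<xi>. b (z, - \<xi>) = b (z, \<xi>)"
  shows "(LINT X|lborel. b X * ((of_real (DIM('a) + (norm w)\<^sup>2) + 2 * \<i> * of_real (w \<bullet> fst X)) * gauss 1 (2 *\<^sub>R w, 0) X)) =
    of_real (pi ^ DIM('a) * exp (- (norm w)\<^sup>2))"
proof -
  let ?d = "DIM('a)"
  define D where "D = complex_of_real (DIM('a) + (norm w)\<^sup>2)"
  define f where "f = gauss (1 / 2) w"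
  have b: "b \<in> symbol_class" using sym by (simp add: is_weyl_symbol_def)
  have f: "f \<in> schwartz" unfolding f_def by (rule schwartz_gauss) simp
  with sym obtain u where "harmonic_oscillator_inverse f u" and q: "has_weyl_quantization b f u"
    unfolding is_weyl_symbol_def by blast
  \<comment> \<open>The weak form of H u = f puts the operator on the test function f, where it is
    explicit. The pairing is bilinear, so f times f doubles the phase w instead of cancelling
    it.\<close>
  then have "(LINT x|lborel. u x * oscillator_expr f x) = (LINT x|lborel. f x * f x)"
    using f by (simp add: harmonic_oscillator_inverse_def harmonic_oscillator_def)
  also have "(\<lambda>x. f x * f x) = gauss 1 (2 *\<^sub>R w)"
    unfolding f_def gauss_def exp_add[symmetric]
    by (rule ext, rule arg_cong[where f = exp]) (simp add: algebra_simps)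
  finally have 1: "(LINT x|lborel. u x * oscillator_expr f x) = of_real (sqrt pi ^ ?d * exp (- (norm w)\<^sup>2))"
    by (simp add: integral_gauss)
  define \<psi> where "\<psi> = (\<lambda>x. (D + 2 * \<i> * of_real (w \<bullet> x)) * gauss (1 / 2) w x)"
  have osc: "oscillator_expr f x = \<psi> x" for x
    unfolding f_def \<psi>_def D_def oscillator_expr_gauss by simp
  define P where "P = (\<lambda>X. \<psi> (fst X) * (gauss 0 (fst X) (snd X) * weyl_inner b w 0 (fst X) (snd X)))"
  obtain C m where C: "C \<ge> 0" "\<And>x \<xi>. norm (weyl_inner b w 0 x \<xi>)
     \<le> C * (1 + norm x) ^ m * ((1 + norm \<xi>) ^ m / (1 + (norm \<xi>)\<^sup>2) ^ (m + DIM('a)))"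
    using weyl_inner_0_decay[OF b] by blast
  have cont_psi: "continuous_on UNIV \<psi>" unfolding \<psi>_def by (intro continuous_intros)
  \<comment> \<open>Prepares the exchange of x and xi: the Gaussian in \<open>\<psi>\<close> beats
    the powers of |x|, and \<open>weyl_inner\<close> itself decays in xi.\<close>
  have intP: "integrable lborel P"
  proof (rule integrable_pair_bound)
    show "integrable lborel (\<lambda>x. norm (\<psi> x) * (C * (1 + norm x) ^ m))"
    proof -
      have "integrable lborel (\<lambda>x. (of_real (C * (1 + norm x) ^ m) * (D + 2 * \<i> * of_real (w \<bullet> x))) * gauss (1 / 2) w x)"
      proof (rule integrable_poly_growth_gauss)
        fix x :: 'a
        have "(C * (1 + norm x) ^ m) * norm (D + 2 * \<i> * of_real (w \<bullet> x)) \<le> (C * (1 + norm x) ^ m) * ((norm D + 2 * norm w) * (1 + norm x))"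
          using C(1) by (intro mult_left_mono norm_affine_le) auto
        then show "norm (of_real (C * (1 + norm x) ^ m) * (D + 2 * \<i> * of_real (w \<bullet> x))) \<le> (C * (norm D + 2 * norm w)) * (1 + norm x) ^ Suc m"
          using C(1) unfolding norm_mult norm_of_real by (simp add: abs_mult mult_ac)
      qed (simp, measurable)
      from integrable_norm[OF this] show ?thesis
        using C(1) unfolding \<psi>_def norm_mult norm_of_real by (simp add: abs_mult norm_mult mult_ac)
    qed
    show "integrable lborel (\<lambda>\<xi>::'a. (1 + norm \<xi>) ^ m / (1 + (norm \<xi>)\<^sup>2) ^ (m + DIM('a)))"
      by (rule integrable_inverse_one_plus_norm_sq) simp
    have [measurable]: "(\<lambda>X. \<psi> (fst X)) \<in> borel_measurable borel"
      by (intro borel_measurable_continuous_onI continuous_on_compose2[OF cont_psi] continuous_intros) auto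
    have [measurable]: "(\<lambda>X. gauss 0 (fst X) (snd X)) \<in> borel_measurable borel"
      by (intro borel_measurable_continuous_onI continuous_intros)
    note [measurable] = weyl_inner_borel_measurable[OF b]
    show "P \<in> borel_measurable borel" unfolding P_def by measurable
    show "norm (P (x, \<xi>)) \<le> norm (\<psi> x) * (C * (1 + norm x) ^ m) * ((1 + norm \<xi>) ^ m / (1 + (norm \<xi>)\<^sup>2) ^ (m + DIM('a)))" for x \<xi>
      using mult_left_mono[OF C(2)[of x \<xi>], of "norm (\<psi> x)"] unfolding P_def
      by (simp add: norm_mult norm_gauss mult.assoc)
  qed
  define c0 where "c0 = complex_of_real (1 / (2 * pi) ^ ?d)"
  define c1 where "c1 = complex_of_real (sqrt (4 * pi) ^ ?d)"
  have "(LINT x|lborel. u x * oscillator_expr f x) = (LINT x|lborel. c0 * (LINT \<xi>|lborel. P (x, \<xi>)))"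
    unfolding osc weyl_quantization_gauss[OF b q[unfolded f_def]] c0_def P_def by (simp add: mult_ac)
  also have "\<dots> = c0 * (LINT x|lborel. LINT \<xi>|lborel. P (x, \<xi>))" by simp
  also have "(LINT x|lborel. LINT \<xi>|lborel. P (x, \<xi>)) = (LINT \<xi>|lborel. LINT x|lborel. P (x, \<xi>))"
    using lborel_pair.Fubini_integral[of "\<lambda>x \<xi>. P (x, \<xi>)"] intP by (simp add: case_prod_eta lborel_prod)
  also have "\<dots> = (LINT \<xi>|lborel. c1 * (LINT z|lborel. b (z, \<xi>) * ((D + 2 * \<i> * of_real (w \<bullet> z) - 2 * of_real (w \<bullet> \<xi>)) * gauss 1 (2 *\<^sub>R w, 0) (z, \<xi>))))"
    unfolding P_def \<psi>_def fst_conv snd_conv weyl_gaussian_fibre[OF b] c1_def ..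
  also have "\<dots> = c1 * (LINT \<xi>|lborel. LINT z|lborel. b (z, \<xi>) * ((D + 2 * \<i> * of_real (w \<bullet> z) - 2 * of_real (w \<bullet> \<xi>)) * gauss 1 (2 *\<^sub>R w, 0) (z, \<xi>)))"
    by simp
  finally have 2: "(LINT x|lborel. u x * oscillator_expr f x) = c0 * (c1 *
     (LINT \<xi>|lborel. LINT z|lborel. b (z, \<xi>) * ((D + 2 * \<i> * of_real (w \<bullet> z) - 2 * of_real (w \<bullet> \<xi>)) * gauss 1 (2 *\<^sub>R w, 0) (z, \<xi>))))" .
  define T1 where "T1 = (\<lambda>X. b X * ((D + 2 * \<i> * of_real (w \<bullet> fst X)) * gauss 1 (2 *\<^sub>R w, 0) X))"
  define T2 where "T2 = (\<lambda>X. b X * (2 * of_real (w \<bullet> snd X) * gauss 1 (2 *\<^sub>R w, 0) X))"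
  obtain B k where B: "B \<ge> 0" "\<And>X. norm (b X) \<le> B * (1 + norm X) ^ k"
    using symbol_class_bound[OF b] by metis
  have bm: "b \<in> borel_measurable borel"
    by (rule borel_measurable_continuous_onI[OF symbol_class_continuous[OF b]])
  have int1: "integrable lborel (\<lambda>X. b X * of_real (v \<bullet> X) * gauss 1 (2 *\<^sub>R w, 0) X)" for v
  proof (rule integrable_poly_growth_gauss)
    show "(\<lambda>X. b X * of_real (v \<bullet> X)) \<in> borel_measurable borel" using bm by simp
    fix X
    have "norm (b X * of_real (v \<bullet> X)) \<le> (B * (1 + norm X) ^ k) * (norm v * (1 + norm X) ^ 1)"
      unfolding norm_mult by (intro mult_mono B norm_inner_le_one_plus) (use B(1) in auto)
    then show "norm (b X * of_real (v \<bullet> X)) \<le> (B * norm v) * (1 + norm X) ^ Suc k"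
      by (simp add: mult_ac)
  qed simp
  have T1: "integrable lborel T1"
    unfolding T1_def by (rule integrable_symbol_moment_gauss[OF bm B(2)])
  have T2: "integrable lborel T2"
  proof -
    have "T2 = (\<lambda>X. 2 * (b X * of_real ((0, w) \<bullet> X) * gauss 1 (2 *\<^sub>R w, 0) X))"
      by (auto simp: T2_def fun_eq_iff)
    then show ?thesis using int1[of "(0, w)"] by simp
  qed
  \<comment> \<open>The term 2 w.xi left by the v-integral is odd in xi, while the symbol is even in
    xi and the Gaussian has no phase there.\<close>
  have "integral\<^sup>L lborel T2 = 0"
  proof -
    define S where "S = (\<lambda>X::'a \<times> 'a. (fst X, - snd X))"
    have "linear S" unfolding S_def by (intro linearI) auto
    then have S: "orthogonal_transformation S"
      by (simp add: orthogonal_transformation S_def norm_prod_def)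
    have "T2 (S X) = - T2 X" for X
      by (cases X) (simp add: T2_def S_def even gauss_def norm_Pair)
    with integral_lborel_isometry[OF S, of T2] T2 have "- integral\<^sup>L lborel T2 = integral\<^sup>L lborel T2"
      using borel_measurable_integrable[OF T2] by simp
    then show ?thesis by simp
  qed
  moreover have "(LINT \<xi>|lborel. LINT z|lborel. b (z, \<xi>) * ((D + 2 * \<i> * of_real (w \<bullet> z) - 2 * of_real (w \<bullet> \<xi>)) * gauss 1 (2 *\<^sub>R w, 0) (z, \<xi>)))
      = (LINT X|lborel. T1 X - T2 X)"
  proof -
    define T where "T = (\<lambda>X. T1 X - T2 X)"
    have "integrable lborel T"
      unfolding T_def using T1 T2 by simp
    then have "integrable (lborel \<Otimes>\<^sub>M lborel) (\<lambda>(z, \<xi>). T (z, \<xi>))"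
      unfolding case_prod_eta lborel_prod .
    from lborel_pair.integral_snd[OF this]
    have "(LINT \<xi>|lborel. LINT z|lborel. T (z, \<xi>)) = integral\<^sup>L lborel T"
      unfolding case_prod_eta lborel_prod .
    then show ?thesis by (simp add: T_def T1_def T2_def algebra_simps)
  qed
  ultimately have 3: "(LINT \<xi>|lborel. LINT z|lborel. b (z, \<xi>) * ((D + 2 * \<i> * of_real (w \<bullet> z) - 2 * of_real (w \<bullet> \<xi>)) * gauss 1 (2 *\<^sub>R w, 0) (z, \<xi>))) = integral\<^sup>L lborel T1"
    using T1 T2 by simp
  \<comment> \<open>The normalization of the quantization and the v-integral together leave
    pi^(-d/2), since sqrt (4 pi) / (2 pi) = 1 / sqrt pi. Against the pi^(d/2) of the right side this
    gives pi^d.\<close>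
  have "c0 * c1 = of_real (1 / sqrt pi ^ ?d)"
  proof -
    have "sqrt (4 * pi) / (2 * pi) = 1 / sqrt pi"
      by (simp add: real_sqrt_mult real_div_sqrt field_simps)
    then have "(sqrt (4 * pi) / (2 * pi)) ^ ?d = (1 / sqrt pi) ^ ?d" by simp
    then have "sqrt (4 * pi) ^ ?d / (2 * pi) ^ ?d = 1 / sqrt pi ^ ?d" by (simp only: power_divide power_one)
    then show ?thesis unfolding c0_def c1_def of_real_mult[symmetric] by simp
  qed
  moreover have "c0 * c1 * integral\<^sup>L lborel T1 = of_real (sqrt pi ^ ?d * exp (- (norm w)\<^sup>2))"
    using 1 2 3 by (simp only: mult.assoc)
  ultimately have "of_real (1 / sqrt pi ^ ?d) * integral\<^sup>L lborel T1 = of_real (sqrt pi ^ ?d * exp (- (norm w)\<^sup>2))"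
    by simp
  then have "integral\<^sup>L lborel T1 = of_real (sqrt pi ^ ?d) * of_real (sqrt pi ^ ?d * exp (- (norm w)\<^sup>2))"
    by (simp add: field_simps)
  also have "\<dots> = of_real (pi ^ ?d * exp (- (norm w)\<^sup>2))"
  proof -
    have "sqrt pi ^ ?d * sqrt pi ^ ?d = pi ^ ?d" by (simp flip: power_mult_distrib)
    then show ?thesis by (simp only: of_real_mult[symmetric] mult.assoc[symmetric])
  qed
  finally show ?thesis unfolding T1_def D_def .
qed

section \<open>Uniqueness\<close>

text \<open>The Householder reflection in the hyperplane orthogonal to a - b. Being its own adjoint,
  it moves from the point to the frequency inside an inner product without introducing an
  inverse.\<close>

lemma orthogonal_reflection_exists:
  fixes a b :: "'a::euclidean_space"
  assumes "norm a = norm b"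
  obtains T where "orthogonal_transformation T" "T a = b" "\<And>x y. T x \<bullet> y = x \<bullet> T y"
proof (cases "a = b")
  case True
  then show ?thesis using that[of "\<lambda>x. x"] by (simp add: orthogonal_transformation_id)
next
  case False
  define u where "u = a - b"
  define T where "T = (\<lambda>x. x - (2 * (x \<bullet> u) / (u \<bullet> u)) *\<^sub>R u)"
  have u: "u \<bullet> u > 0" using False by (simp add: u_def)
  have ab: "a \<bullet> a = b \<bullet> b" using assms by (simp add: norm_eq_sqrt_inner)
  have "linear T"
    unfolding T_def by (intro linearI) (auto simp: algebra_simps inner_add_left add_divide_distrib)
  moreover have "T x \<bullet> T y = x \<bullet> y" for x y
  proof -
    define c p q where "c = u \<bullet> u" and "p = x \<bullet> u" and "q = y \<bullet> u"
    have "T x \<bullet> T y = x \<bullet> y - (2 * q / c) * p - (2 * p / c) * q + (2 * p / c) * ((2 * q / c) * c)"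
      unfolding T_def c_def p_def q_def
      by (simp add: inner_diff_left inner_diff_right inner_commute[of u y] algebra_simps)
    also have "\<dots> = x \<bullet> y" using u unfolding c_def[symmetric] by (simp add: field_simps)
    finally show ?thesis .
  qed
  ultimately have "orthogonal_transformation T" by (simp add: orthogonal_transformation_def)
  moreover have "T a = b"
  proof -
    have "2 * (a \<bullet> u) = u \<bullet> u"
      using ab by (simp add: u_def inner_diff_left inner_diff_right inner_commute)
    then show ?thesis using u by (simp add: T_def u_def)
  qed
  moreover have "T x \<bullet> y = x \<bullet> T y" for x y
    unfolding T_def by (simp add: inner_diff_left inner_diff_right inner_commute[of u y])
  ultimately show ?thesis using that by blast
qed

lemma gauss_0_commute: "gauss 0 v x = gauss 0 x v"
  by (simp add: gauss_def inner_commute)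

lemma gauss_split: "gauss (k + l) (v + v') x = gauss k v x * gauss l v' x"
  unfolding gauss_def exp_add[symmetric]
  by (rule arg_cong[where f = exp]) (simp add: inner_add_left algebra_simps)

text \<open>Fourier uniqueness: integrating the hypothesis against a Gaussian in \<open>P\<close> shows that the
  convolution of \<open>g\<close> with every Gaussian vanishes; then concentrate the Gaussian.\<close>

lemma fourier_transform_unique:
  fixes g :: "'a::euclidean_space \<Rightarrow> complex"
  assumes g: "integrable lborel g" and cont: "continuous_on UNIV g" and bound: "\<And>x. norm (g x) \<le> B"
    and zero: "\<And>P. (LINT x|lborel. gauss 0 P x * g x) = 0"
  shows "g y = 0"
proof -
  have gm[measurable]: "g \<in> borel_measurable borel" by (rule borel_measurable_continuous_onI[OF cont])
  have conv: "(LINT x|lborel. g (y + c *\<^sub>R x) * gauss 1 0 x) = 0" if c: "c > 0" for c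
  proof -
    \<comment> \<open>With this \<open>s\<close> the Gaussian in P has Fourier transform
      proportional to exp (-|x - y|^2 / (4 s)), which is \<open>gauss 1 0\<close> rescaled by c; the
      phase -y in \<open>F\<close> places its centre at y.\<close>
    define s where "s = c\<^sup>2 / 4"
    have s: "s > 0" using c by (simp add: s_def)
    define F where "F = (\<lambda>z. gauss s (- y) (fst z) * (gauss 0 (fst z) (snd z) * g (snd z)))"
    have intF: "integrable lborel F"
    proof (rule integrable_pair_bound)
      show "integrable lborel (\<lambda>P::'a. norm (gauss s (- y) P))" by (intro integrable_norm integrable_gauss s)
      show "integrable lborel (\<lambda>x. norm (g x))" by (rule integrable_norm[OF g])
      show "F \<in> borel_measurable borel" unfolding F_def
        by (intro borel_measurable_continuous_onI continuous_intros continuous_on_compose2[OF cont]) auto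
      show "norm (F (P, x)) \<le> norm (gauss s (- y) P) * norm (g x)" for P x
        by (simp add: F_def norm_mult norm_gauss)
    qed
    have inner: "(LINT P|lborel. F (P, x)) = of_real (sqrt (pi / s) ^ DIM('a)) * (g x * gauss 1 0 ((1 / c) *\<^sub>R (x - y)))" for x
    proof -
      have "F (P, x) = gauss s (x - y) P * g x" for P
        using gauss_split[of s 0 "- y" x P] by (simp add: F_def gauss_0_commute[of x P])
      then have "(LINT P|lborel. F (P, x)) = (LINT P|lborel. gauss s (x - y) P) * g x" by simp
      also have "(LINT P|lborel. gauss s (x - y) P) = of_real (sqrt (pi / s) ^ DIM('a)) * gauss 1 0 ((1 / c) *\<^sub>R (x - y))"
        unfolding integral_gauss[OF s]
        by (simp add: gauss_def s_def power_divide flip: exp_of_real)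
      finally show ?thesis by simp
    qed
    have "(LINT x|lborel. LINT P|lborel. F (P, x)) = (LINT P|lborel. LINT x|lborel. F (P, x))"
      using lborel_pair.Fubini_integral[of "\<lambda>P x. F (P, x)"] intF by (simp add: case_prod_eta lborel_prod)
    also have "\<dots> = 0" by (simp add: F_def zero)
    finally have "(LINT x|lborel. g x * gauss 1 0 ((1 / c) *\<^sub>R (x - y))) = 0"
      unfolding inner using s by simp
    moreover have "(\<lambda>x. g x * gauss 1 0 ((1 / c) *\<^sub>R (x - y))) \<in> borel_measurable borel"
      by (intro borel_measurable_continuous_onI continuous_intros cont)
    from integral_lborel_affine[OF this, of c y]
    have "(LINT x|lborel. g x * gauss 1 0 ((1 / c) *\<^sub>R (x - y))) =
        c ^ DIM('a) *\<^sub>R (LINT x|lborel. g (y + c *\<^sub>R x) * gauss 1 0 x)"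
      using c by simp
    ultimately show ?thesis using c by simp
  qed
  have "(\<lambda>k. LINT x|lborel. g (y + inverse (real (Suc k)) *\<^sub>R x) * gauss 1 0 x) \<longlonglongrightarrow> (LINT x::'a|lborel. g y * gauss 1 0 x)"
  proof (rule integral_dominated_convergence[where w = "\<lambda>x::'a. B * exp (- 1 * (norm x)\<^sup>2)"])
    show "integrable lborel (\<lambda>x::'a. B * exp (- 1 * (norm x)\<^sup>2))"
      by (intro integrable_mult_right impI integrable_norm_gaussian) simp
    show "AE x in lborel. (\<lambda>k. g (y + inverse (real (Suc k)) *\<^sub>R x) * gauss 1 0 x) \<longlonglongrightarrow> g y * gauss 1 0 x"
    proof (rule AE_I2)
      fix x
      have "(\<lambda>k. y + inverse (real (Suc k)) *\<^sub>R x) \<longlonglongrightarrow> y + 0 *\<^sub>R x"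
        by (intro tendsto_intros LIMSEQ_inverse_real_of_nat)
      then have "(\<lambda>k. y + inverse (real (Suc k)) *\<^sub>R x) \<longlonglongrightarrow> y" by simp
      from continuous_on_tendsto_compose[OF cont this]
      show "(\<lambda>k. g (y + inverse (real (Suc k)) *\<^sub>R x) * gauss 1 0 x) \<longlonglongrightarrow> g y * gauss 1 0 x"
        by (intro tendsto_mult tendsto_const) auto
    qed
    show "AE x in lborel. norm (g (y + inverse (real (Suc k)) *\<^sub>R x) * gauss 1 0 x) \<le> B * exp (- 1 * (norm x)\<^sup>2)" for k
      unfolding norm_mult norm_gauss by (intro AE_I2 mult_right_mono bound) auto
  qed measurable
  moreover have "(LINT x|lborel. g (y + inverse (real (Suc k)) *\<^sub>R x) * gauss 1 0 x) = 0" for k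
    by (rule conv) simp
  ultimately have "(LINT x::'a|lborel. g y * gauss 1 0 x) = 0"
    by (simp add: LIMSEQ_const_iff)
  then have "g y * (LINT x::'a|lborel. gauss 1 0 x) = 0" by simp
  moreover have "(LINT x::'a|lborel. gauss 1 0 x) \<noteq> 0" by (simp add: integral_gauss)
  ultimately show ?thesis by simp
qed

lemma radial_symbol_eq_0:
  fixes b :: "'a::euclidean_space \<times> 'a \<Rightarrow> complex"
  assumes radial: "\<And>X Y. norm X = norm Y \<Longrightarrow> b X = b Y"
    and cont: "continuous_on UNIV b" and bound: "\<And>X. norm (b X) \<le> C * (1 + norm X) ^ m"
    and zero: "\<And>w. (LINT X|lborel. b X * ((of_real (DIM('a) + (norm w)\<^sup>2) + 2 * \<i> * of_real (w \<bullet> fst X)) *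
       gauss 1 (2 *\<^sub>R w, 0) X)) = 0"
  shows "b Y = 0"
proof -
  let ?d = "DIM('a)"
  have bm[measurable]: "b \<in> borel_measurable borel" by (rule borel_measurable_continuous_onI[OF cont])
  have C: "C \<ge> 0" using order_trans[OF norm_ge_zero bound[of 0]] by simp
  have int0: "integrable lborel (\<lambda>X. b X * gauss 1 P X)" for P
    by (rule integrable_poly_growth_gauss[OF _ bm bound]) simp
  have w0: "(LINT X|lborel. b X * gauss 1 (2 *\<^sub>R w, 0) X) = 0" for w
  proof -
    define k where "k = (norm w)\<^sup>2"
    \<comment> \<open>A primitive in t of the weighted factor \<open>\<phi>\<close> from the
      identity at t w. The power t^d makes \<open>\<Phi> X 0\<close> vanish, so only the value at t
      = 1 survives.\<close>
    define \<Phi> where "\<Phi> = (\<lambda>(X::'a \<times> 'a) t. of_real (t ^ ?d * exp (t\<^sup>2 * k / 2)) * exp (2 * \<i> * of_real (t * (w \<bullet> fst X))))"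
    define \<phi> where "\<phi> = (\<lambda>(X::'a \<times> 'a) t. of_real (t ^ (?d - 1) * exp (t\<^sup>2 * k / 2)) *
      ((of_real (?d + t\<^sup>2 * k) + 2 * \<i> * of_real (t * (w \<bullet> fst X))) * exp (2 * \<i> * of_real (t * (w \<bullet> fst X)))))"
    have der: "(\<Phi> X has_vector_derivative \<phi> X t) (at t within A)" for X :: "'a \<times> 'a" and t A
    proof -
      have t: "t * t ^ (?d - 1) = t ^ ?d" by (simp flip: power_Suc)
      have "(\<Phi> X has_vector_derivative
        (of_real (t ^ ?d * exp (t\<^sup>2 * k / 2)) * (exp (2 * \<i> * of_real (t * (w \<bullet> fst X))) * (2 * \<i> * of_real (w \<bullet> fst X))) +
         of_real (real ?d * t ^ (?d - 1) * exp (t\<^sup>2 * k / 2) + t ^ ?d * (exp (t\<^sup>2 * k / 2) * (t * k))) * exp (2 * \<i> * of_real (t * (w \<bullet> fst X))))) (at t within A)"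
        unfolding \<Phi>_def
      proof (intro has_vector_derivative_mult)
        have "((\<lambda>t. t ^ ?d * exp (t\<^sup>2 * k / 2)) has_real_derivative
            real ?d * t ^ (?d - 1) * exp (t\<^sup>2 * k / 2) + t ^ ?d * (exp (t\<^sup>2 * k / 2) * (t * k))) (at t within A)"
          by (auto intro!: derivative_eq_intros)
        then show "((\<lambda>t. complex_of_real (t ^ ?d * exp (t\<^sup>2 * k / 2))) has_vector_derivative
            of_real (real ?d * t ^ (?d - 1) * exp (t\<^sup>2 * k / 2) + t ^ ?d * (exp (t\<^sup>2 * k / 2) * (t * k)))) (at t within A)"
          by (rule has_vector_derivative_of_real)
        have "((\<lambda>z. exp (2 * \<i> * (z * of_real (w \<bullet> fst X)))) has_field_derivative
            exp (2 * \<i> * (of_real t * of_real (w \<bullet> fst X))) * (2 * \<i> * of_real (w \<bullet> fst X))) (at (of_real t))"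
          by (auto intro!: derivative_eq_intros)
        from has_vector_derivative_real_field[OF this]
        show "((\<lambda>t. exp (2 * \<i> * complex_of_real (t * (w \<bullet> fst X)))) has_vector_derivative
            exp (2 * \<i> * of_real (t * (w \<bullet> fst X))) * (2 * \<i> * of_real (w \<bullet> fst X))) (at t within A)"
          by simp
      qed
      moreover have "of_real (t ^ ?d * exp (t\<^sup>2 * k / 2)) * (exp (2 * \<i> * of_real (t * (w \<bullet> fst X))) * (2 * \<i> * of_real (w \<bullet> fst X))) +
         of_real (real ?d * t ^ (?d - 1) * exp (t\<^sup>2 * k / 2) + t ^ ?d * (exp (t\<^sup>2 * k / 2) * (t * k))) * exp (2 * \<i> * of_real (t * (w \<bullet> fst X))) = \<phi> X t"
        unfolding \<phi>_def t[symmetric] by (simp add: algebra_simps power2_eq_square)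
      ultimately show ?thesis by simp
    qed
    have contphi: "continuous_on UNIV (\<lambda>z. \<phi> (snd z) (fst z))"
      unfolding \<phi>_def by (intro continuous_intros) auto
    have ftc: "(LINT t|lborel. indicator {0..1} t *\<^sub>R \<phi> X t) = exp (of_real (k / 2)) * exp (2 * \<i> * of_real (w \<bullet> fst X))" for X
    proof -
      have "continuous_on {0..1} (\<phi> X)"
        unfolding \<phi>_def by (intro continuous_intros) auto
      with integral_FTC_atLeastAtMost[of 0 1 "\<Phi> X" "\<phi> X"] der
      have "(LINT t|lborel. indicator {0..1} t *\<^sub>R \<phi> X t) = \<Phi> X 1 - \<Phi> X 0" by simp
      then show ?thesis by (simp add: \<Phi>_def power_0_left flip: exp_of_real)
    qed
    \<comment> \<open>Integrated over X first, \<open>F\<close> gives 0 by \<open>zero\<close> at t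
      w. Integrated over t first, it gives the Fourier integral at (2 w, 0) up to the nonzero factor
      exp (k / 2).\<close>
    define F where "F = (\<lambda>z. indicator {0..1} (fst z) *\<^sub>R (\<phi> (snd z) (fst z) * (b (snd z) * gauss 1 0 (snd z))))"
    have intF: "integrable lborel F"
    proof (rule integrable_pair_bound)
      show "integrable lborel (indicator {0..1::real} :: real \<Rightarrow> real)" by simp
      show "integrable lborel (\<lambda>X::'a \<times> 'a. exp (k / 2) * (?d + k + 2 * norm w) * C * ((1 + norm X) ^ Suc m * exp (- 1 * (norm X)\<^sup>2)))"
        by (intro integrable_mult_right impI integrable_power_gaussian) simp
      have "(\<lambda>z::real \<times> ('a \<times> 'a). \<phi> (snd z) (fst z) * (b (snd z) * gauss 1 0 (snd z))) \<in> borel_measurable borel"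
        by (intro borel_measurable_continuous_onI continuous_intros contphi continuous_on_compose2[OF cont]) auto
      moreover have "(fst :: real \<times> ('a \<times> 'a) \<Rightarrow> real) \<in> borel_measurable borel"
        by (intro borel_measurable_continuous_onI continuous_intros)
      from measurable_compose[OF this, of "indicator {0..1} :: real \<Rightarrow> real"]
      have "(\<lambda>z::real \<times> ('a \<times> 'a). indicator {0..1} (fst z) :: real) \<in> borel_measurable borel"
        by simp
      ultimately show "F \<in> borel_measurable borel" unfolding F_def by (rule borel_measurable_scaleR[rotated])
      fix t :: real and X :: "'a \<times> 'a"
      show "norm (F (t, X)) \<le> indicator {0..1} t * (exp (k / 2) * (?d + k + 2 * norm w) * C * ((1 + norm X) ^ Suc m * exp (- 1 * (norm X)\<^sup>2)))"
      proof (cases "t \<in> {0..1}")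
        case True
        have k0: "k \<ge> 0" by (simp add: k_def)
        have t2: "t\<^sup>2 * k \<le> k" using True k0 by (intro mult_left_le_one_le) (auto simp: power_le_one)
        have e1: "norm (exp (2 * \<i> * of_real (t * (w \<bullet> fst X)))) = 1" by simp
        have "t ^ (?d - 1) * exp (t\<^sup>2 * k / 2) \<le> 1 * exp (k / 2)"
          using True t2 by (intro mult_mono) (auto simp: power_le_one)
        then have n1: "norm (complex_of_real (t ^ (?d - 1) * exp (t\<^sup>2 * k / 2))) \<le> exp (k / 2)"
          unfolding norm_of_real using True by (simp add: abs_mult)
        have "norm (complex_of_real (?d + t\<^sup>2 * k) + 2 * \<i> * of_real (t * (w \<bullet> fst X))) \<le> (?d + t\<^sup>2 * k) + 2 * (t * \<bar>w \<bullet> fst X\<bar>)"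
          by (rule order_trans[OF norm_triangle_ineq], unfold norm_of_real) (use True k0 in \<open>simp add: norm_mult abs_mult\<close>)
        also have "\<dots> \<le> (?d + k) * (1 + norm X) + 2 * (norm w * (1 + norm X))"
        proof (intro add_mono mult_left_mono)
          show "real ?d + t\<^sup>2 * k \<le> (?d + k) * (1 + norm X)"
            using t2 mult_left_mono[of 1 "1 + norm X" "?d + k"] k0 by simp
          have "norm (fst X) \<le> norm X" using norm_fst_le[of "fst X" "snd X"] by simp
          then have "\<bar>w \<bullet> fst X\<bar> \<le> norm w * norm X"
            by (intro order_trans[OF Cauchy_Schwarz_ineq2] mult_left_mono) auto
          with True have "t * \<bar>w \<bullet> fst X\<bar> \<le> 1 * (norm w * norm X)"
            by (intro mult_mono) auto
          also have "\<dots> \<le> norm w * (1 + norm X)" by (simp add: distrib_left)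
          finally show "t * \<bar>w \<bullet> fst X\<bar> \<le> norm w * (1 + norm X)" .
        qed simp
        finally have n2: "norm (complex_of_real (?d + t\<^sup>2 * k) + 2 * \<i> * of_real (t * (w \<bullet> fst X))) \<le> (?d + k + 2 * norm w) * (1 + norm X)"
          by (simp add: algebra_simps)
        have "norm (\<phi> X t * (b X * gauss 1 0 X)) \<le> (exp (k / 2) * ((?d + k + 2 * norm w) * (1 + norm X) * 1)) * ((C * (1 + norm X) ^ m) * exp (- 1 * (norm X)\<^sup>2))"
          unfolding \<phi>_def norm_mult norm_gauss[of 1 0 X]
        proof (intro mult_mono)
          show "norm (exp (2 * \<i> * of_real (t * (w \<bullet> fst X)))) \<le> 1" unfolding e1 by simp
        qed (use n1 n2[unfolded norm_mult] bound C k0 in \<open>auto simp: norm_mult\<close>)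
        then show ?thesis using True by (simp add: F_def mult_ac)
      qed (simp add: F_def)
    qed
    have "(LINT X|lborel. LINT t|lborel. F (t, X)) = (LINT t|lborel. LINT X|lborel. F (t, X))"
      using lborel_pair.Fubini_integral[of "\<lambda>t X. F (t, X)"] intF by (simp add: case_prod_eta lborel_prod)
    moreover have "(LINT X|lborel. F (t, X)) = 0" for t
    proof -
      have eq: "F (t, X) = (indicator {0..1} t *\<^sub>R of_real (t ^ (?d - 1) * exp (t\<^sup>2 * k / 2))) *
         (b X * ((of_real (?d + (norm (t *\<^sub>R w))\<^sup>2) + 2 * \<i> * of_real ((t *\<^sub>R w) \<bullet> fst X)) * gauss 1 (2 *\<^sub>R (t *\<^sub>R w), 0) X))" for X
      proof -
        have "gauss 1 (2 *\<^sub>R (t *\<^sub>R w), 0) X = exp (2 * \<i> * of_real (t * (w \<bullet> fst X))) * gauss 1 0 X"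
          unfolding gauss_def exp_add[symmetric]
          by (rule arg_cong[where f = exp]) (cases X, simp)
        moreover have "(norm (t *\<^sub>R w))\<^sup>2 = t\<^sup>2 * k" by (simp add: k_def power_mult_distrib)
        ultimately show ?thesis by (simp add: F_def \<phi>_def mult_ac)
      qed
      show ?thesis unfolding eq integral_mult_right_zero zero by simp
    qed
    ultimately have 0: "(LINT X|lborel. LINT t|lborel. F (t, X)) = 0" by simp
    have "(LINT t|lborel. F (t, X)) = exp (of_real (k / 2)) * (b X * gauss 1 (2 *\<^sub>R w, 0) X)" for X
    proof -
      have e: "gauss 1 (2 *\<^sub>R w, 0) X = exp (2 * \<i> * of_real (w \<bullet> fst X)) * gauss 1 0 X"
        unfolding gauss_def exp_add[symmetric]
        by (rule arg_cong[where f = exp]) (cases X, simp)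
      have "(LINT t|lborel. F (t, X)) = (LINT t|lborel. (indicator {0..1} t *\<^sub>R \<phi> X t) * (b X * gauss 1 0 X))"
        by (simp add: F_def)
      also have "\<dots> = (exp (of_real (k / 2)) * exp (2 * \<i> * of_real (w \<bullet> fst X))) * (b X * gauss 1 0 X)"
        unfolding integral_mult_left_zero ftc ..
      finally show ?thesis unfolding e by (simp only: mult_ac)
    qed
    with 0 show ?thesis by simp
  qed
  have P0: "(LINT X|lborel. b X * gauss 1 P X) = 0" for P
  proof -
    obtain i :: 'a where i: "i \<in> Basis" using nonempty_Basis by blast
    \<comment> \<open>Any direction serves; only the norm of (2 w, 0) has to match that of
      P.\<close>
    define w where "w = (norm P / 2) *\<^sub>R i"
    have "norm P = norm (2 *\<^sub>R w, 0 :: 'a)" using i by (simp add: w_def norm_Pair)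
    then obtain T where T: "orthogonal_transformation T" and TP: "T P = (2 *\<^sub>R w, 0)" and sa: "\<And>x y. T x \<bullet> y = x \<bullet> T y"
      using orthogonal_reflection_exists by metis
    have nT: "norm (T X) = norm X" for X using T unfolding orthogonal_transformation by blast
    have "(LINT X|lborel. b X * gauss 1 P X) = (LINT X|lborel. b (T X) * gauss 1 P (T X))"
      by (rule integral_lborel_isometry[OF T, symmetric]) measurable
    also have "(\<lambda>X. b (T X) * gauss 1 P (T X)) = (\<lambda>X. b X * gauss 1 (T P) X)"
      using radial[OF nT] by (simp add: gauss_def nT sa)
    finally show ?thesis unfolding TP w0 .
  qed
  have "b Y * gauss 1 0 Y = 0"
  proof (rule fourier_transform_unique[where g = "\<lambda>X. b X * gauss 1 0 X"])
    show "integrable lborel (\<lambda>X. b X * gauss 1 0 X)" by (rule int0)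
    show "continuous_on UNIV (\<lambda>X. b X * gauss 1 0 X)" by (intro continuous_intros cont)
    show "norm (b X * gauss 1 0 X) \<le> C * exp (real m ^ 2 / (4 * 1))" for X
    proof -
      have "norm (b X * gauss 1 0 X) \<le> (C * (exp (real m ^ 2 / (4 * 1)) * exp (1 * (norm X)\<^sup>2))) * exp (- 1 * (norm X)\<^sup>2)"
        unfolding norm_mult norm_gauss
        by (intro mult_right_mono order_trans[OF bound] mult_left_mono power_le_gaussian C) auto
      then show ?thesis by (simp add: mult.assoc flip: exp_add)
    qed
    show "(LINT X|lborel. gauss 0 P X * (b X * gauss 1 0 X)) = 0" for P
      using P0[of P] gauss_split[of 0 1 P 0] by (simp add: mult_ac)
  qed
  then show ?thesis by (simp add: gauss_def)
qed

section \<open>The explicit symbol\<close>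

lemma integrable_indicator_scaleR:
  fixes f :: "real \<Rightarrow> 'b::{banach, second_countable_topology}"
  assumes "continuous_on {a..b} f"
  shows "integrable lborel (\<lambda>x. indicator {a..b} x *\<^sub>R f x)"
  by (rule borel_integrable_compact[OF compact_Icc assms])

text \<open>With \<open>s = sin \<theta> = tanh t\<close> this is \<open>\<integral> (cosh t)\<^bsup>-d\<^esup> e\<^bsup>-r tanh t\<^esup> dt\<close> over \<open>t \<ge> 0\<close>,
  the superposition of the Weyl symbols of the operators \<open>e\<^bsup>-tH\<^esup>\<close>.\<close>

definition inverse_oscillator_profile :: "nat \<Rightarrow> complex \<Rightarrow> complex" where
  "inverse_oscillator_profile d z =
     (LINT \<theta>|lborel. indicator {0..pi / 2} \<theta> *\<^sub>R (of_real (cos \<theta> ^ (d - 1)) * exp (- (z * of_real (sin \<theta>)))))"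

lemma sin_cos_quadrant:
  assumes "\<theta> \<in> {0..pi / 2}"
  shows "0 \<le> sin \<theta>" "sin \<theta> \<le> 1" "0 \<le> cos \<theta>" "cos \<theta> \<le> 1"
  using assms by (auto intro!: sin_ge_zero cos_ge_zero)

lemma profile_integrand_bound:
  assumes "Re z \<ge> 0"
  shows "norm (indicator {0..pi / 2} \<theta> *\<^sub>R (of_real (cos \<theta> ^ (d - 1)) * exp (- (z * of_real (sin \<theta>))))) \<le> indicator {0..pi / 2} \<theta>"
proof (cases "\<theta> \<in> {0..pi / 2}")
  case True
  note sc = sin_cos_quadrant[OF True]
  have "norm (complex_of_real (cos \<theta> ^ (d - 1))) \<le> 1"
    unfolding norm_of_real using sc by (simp add: power_le_one)
  moreover have "norm (exp (- (z * of_real (sin \<theta>)))) \<le> 1"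
    using sc assms by simp
  ultimately have "norm (complex_of_real (cos \<theta> ^ (d - 1))) * norm (exp (- (z * of_real (sin \<theta>)))) \<le> 1 * 1"
    by (intro mult_mono) auto
  then show ?thesis using True by (simp add: norm_mult)
qed simp

lemma norm_inverse_oscillator_profile_le:
  assumes "Re z \<ge> 0"
  shows "norm (inverse_oscillator_profile d z) \<le> pi / 2"
proof -
  have "norm (inverse_oscillator_profile d z) \<le> (LINT \<theta>|lborel. indicator {0..pi / 2} \<theta>)"
    unfolding inverse_oscillator_profile_def
  proof (rule Bochner_Integration.integral_norm_bound_integral)
    show "integrable lborel (\<lambda>\<theta>. indicator {0..pi / 2} \<theta> *\<^sub>R (complex_of_real (cos \<theta> ^ (d - 1)) * exp (- (z * of_real (sin \<theta>)))))"
      by (intro integrable_indicator_scaleR continuous_intros)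
  qed (use profile_integrand_bound[OF assms] in auto)
  then show ?thesis by simp
qed

lemma gaussian_moment_pair:
  fixes w :: "'a::euclidean_space"
  assumes k: "k > 0"
  shows "(LINT X|lborel. (D + 2 * \<i> * of_real (w \<bullet> fst X)) * gauss k (2 *\<^sub>R w, 0 :: 'a) X) =
    (D - 2 * of_real ((norm w)\<^sup>2 / k)) * of_real ((pi / k) ^ DIM('a) * exp (- (norm w)\<^sup>2 / k))"
proof -
  let ?v = "(2 *\<^sub>R w, 0 :: 'a)"
  have eq: "(D + 2 * \<i> * of_real (w \<bullet> fst X)) * gauss k ?v X = D * gauss k ?v X + 2 * \<i> * (of_real ((w, 0) \<bullet> X) * gauss k ?v X)" for X
    by (cases X) (simp add: algebra_simps)
  have "integrable lborel (\<lambda>X. D * gauss k ?v X)"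
    by (intro integrable_mult_right impI integrable_gauss k)
  moreover have "integrable lborel (\<lambda>X. 2 * \<i> * (of_real ((w, 0) \<bullet> X) * gauss k ?v X))"
    by (intro integrable_mult_right impI integrable_inner_gauss k)
  ultimately have "(LINT X|lborel. (D + 2 * \<i> * of_real (w \<bullet> fst X)) * gauss k ?v X) =
      D * (LINT X|lborel. gauss k ?v X) + 2 * \<i> * (LINT X|lborel. of_real ((w, 0) \<bullet> X) * gauss k ?v X)"
    unfolding eq by simp
  also have "\<dots> = (D - 2 * of_real ((norm w)\<^sup>2 / k)) * (LINT X|lborel. gauss k ?v X)"
    unfolding integral_inner_gauss[OF k] by (simp add: power2_norm_eq_inner algebra_simps)
  also have "(LINT X|lborel. gauss k ?v X) = of_real ((pi / k) ^ DIM('a) * exp (- (norm w)\<^sup>2 / k))"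
  proof -
    have "sqrt (pi / k) ^ DIM('a \<times> 'a) = (pi / k) ^ DIM('a)"
      using k by (simp add: mult_2[symmetric] power_mult)
    moreover have "(norm ?v)\<^sup>2 / (4 * k) = (norm w)\<^sup>2 / k"
      by (simp add: norm_Pair power_mult_distrib)
    ultimately show ?thesis unfolding integral_gauss[OF k] by simp
  qed
  finally show ?thesis .
qed

text \<open>After the Gaussian integration in \<open>X\<close> the integrand is an exact derivative in \<open>\<theta>\<close>.\<close>

lemma profile_theta_integral:
  fixes k :: real
  assumes d: "d > 0"
  shows "(LINT \<theta>|lborel. indicator {0..pi / 2} \<theta> *\<^sub>R (cos \<theta> ^ (d - 1) * ((real d + k - 2 * (k / (1 + sin \<theta>))) *
      ((1 / (1 + sin \<theta>)) ^ d * exp (- (k / (1 + sin \<theta>))))))) = exp (- k)"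
proof -
  \<comment> \<open>With sin theta = tanh t the base cos theta / (1 + sin theta) is e^(-t). For k =
    |w|^2, -pi^d \<open>F\<close> is the integral of Mehler's symbol at time t against e^(-|X|^2 +
    2i w.x), that is, e^(-tH) f_w paired with f_w up to normalization; its t-derivative brings in H.
    The values of -\<open>F\<close> run from exp (-k) at theta = 0 to 0 at theta = pi / 2.\<close>
  define F where "F = (\<lambda>\<theta>. - ((cos \<theta> / (1 + sin \<theta>)) ^ d * exp (- (k / (1 + sin \<theta>)))))"
  define f where "f = (\<lambda>\<theta>. cos \<theta> ^ (d - 1) * ((real d + k - 2 * (k / (1 + sin \<theta>))) *
      ((1 / (1 + sin \<theta>)) ^ d * exp (- (k / (1 + sin \<theta>))))))"
  have pos: "1 + sin \<theta> > 0" if "\<theta> \<in> {0..pi / 2}" for \<theta>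
    using sin_cos_quadrant(1)[OF that] by simp
  have der: "(F has_vector_derivative f \<theta>) (at \<theta> within {0..pi / 2})" if "\<theta> \<in> {0..pi / 2}" for \<theta>
  proof -
    define s where "s = 1 + sin \<theta>"
    define q where "q = cos \<theta> / s"
    have s: "s > 0" using pos[OF that] by (simp add: s_def)
    have cs: "(cos \<theta>)\<^sup>2 = s * (2 - s)"
      using sin_cos_squared_add[of \<theta>] by (simp add: s_def power2_eq_square algebra_simps)
    have q: "((\<lambda>\<theta>. cos \<theta> / (1 + sin \<theta>)) has_real_derivative - (1 / s)) (at \<theta> within {0..pi / 2})"
    proof -
      have "((\<lambda>\<theta>. cos \<theta> / (1 + sin \<theta>)) has_real_derivative
          (- sin \<theta> * (1 + sin \<theta>) - cos \<theta> * cos \<theta>) / ((1 + sin \<theta>) * (1 + sin \<theta>))) (at \<theta> within {0..pi / 2})"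
        using s unfolding s_def by (auto intro!: derivative_eq_intros)
      moreover have "- sin \<theta> * (1 + sin \<theta>) - cos \<theta> * cos \<theta> = - s"
        using cs by (simp add: s_def power2_eq_square algebra_simps)
      ultimately show ?thesis using s by (simp add: s_def[symmetric])
    qed
    have E: "((\<lambda>\<theta>. exp (- (k / (1 + sin \<theta>)))) has_real_derivative exp (- (k / s)) * (k * cos \<theta> / s\<^sup>2)) (at \<theta> within {0..pi / 2})"
      using s unfolding s_def by (auto intro!: derivative_eq_intros simp: power2_eq_square)
    have "(F has_real_derivative - (real d * q ^ (d - 1) * (- (1 / s)) * exp (- (k / s)) + exp (- (k / s)) * (k * cos \<theta> / s\<^sup>2) * q ^ d)) (at \<theta> within {0..pi / 2})"
      unfolding F_def
      by (rule DERIV_minus[OF DERIV_mult[OF DERIV_power[OF q, of d] E], THEN DERIV_cong])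
        (simp add: q_def s_def algebra_simps)
    moreover have "- (real d * q ^ (d - 1) * (- (1 / s)) * exp (- (k / s)) + exp (- (k / s)) * (k * cos \<theta> / s\<^sup>2) * q ^ d) = f \<theta>"
    proof -
      obtain n where n: "d = Suc n" using d gr0_implies_Suc by blast
      have "- (real d * q ^ (d - 1) * (- (1 / s)) * exp (- (k / s)) + exp (- (k / s)) * (k * cos \<theta> / s\<^sup>2) * q ^ d)
        = q ^ n * exp (- (k / s)) * (real d / s - k * (cos \<theta>)\<^sup>2 / s ^ 3)"
        using s unfolding n q_def by (simp add: power2_eq_square power3_eq_cube field_simps)
      also have "real d / s - k * (cos \<theta>)\<^sup>2 / s ^ 3 = (real d + k - 2 * (k / s)) / s"
        unfolding cs using s by (simp add: power3_eq_cube field_simps)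
      also have "q ^ n * exp (- (k / s)) * ((real d + k - 2 * (k / s)) / s) = f \<theta>"
        using s unfolding f_def q_def s_def[symmetric] n by (simp add: power_divide mult_ac)
      finally show ?thesis .
    qed
    ultimately show ?thesis by (simp add: has_real_derivative_iff_has_vector_derivative)
  qed
  have cont: "continuous_on {0..pi / 2} f"
    unfolding f_def using pos by (intro continuous_intros) force+
  have "(LINT \<theta>|lborel. indicator {0..pi / 2} \<theta> *\<^sub>R f \<theta>) = F (pi / 2) - F 0"
    by (rule integral_FTC_atLeastAtMost[OF _ der cont]) auto
  also have "\<dots> = exp (- k)" using d by (simp add: F_def power_0_left)
  finally show ?thesis unfolding f_def .
qed

text \<open>For fixed theta the factor exp (-|X|^2 sin theta) only raises the damping of the
  Gaussian from 1 to 1 + sin theta. After Fubini the X-integral is therefore an explicit moment, and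
  \<open>profile_theta_integral\<close> applies to what remains.\<close>

lemma profile_gaussian_identity:
  fixes w :: "'a::euclidean_space"
  shows "(LINT X|lborel. inverse_oscillator_profile DIM('a) (of_real ((norm (X :: 'a \<times> 'a))\<^sup>2)) *
      ((of_real (DIM('a) + (norm w)\<^sup>2) + 2 * \<i> * of_real (w \<bullet> fst X)) * gauss 1 (2 *\<^sub>R w, 0) X)) =
    of_real (pi ^ DIM('a) * exp (- (norm w)\<^sup>2))"
proof -
  let ?d = "DIM('a)"
  define k where "k = (norm w)\<^sup>2"
  define h where "h = (\<lambda>X :: 'a \<times> 'a. (complex_of_real (?d + k) + 2 * \<i> * of_real (w \<bullet> fst X)) * gauss 1 (2 *\<^sub>R w, 0) X)"
  define G where "G = (\<lambda>(\<theta>::real) (X :: 'a \<times> 'a). complex_of_real (cos \<theta> ^ (?d - 1)) * exp (- (of_real ((norm X)\<^sup>2) * of_real (sin \<theta>))))"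
  define F where "F = (\<lambda>z :: real \<times> ('a \<times> 'a). (indicator {0..pi / 2} (fst z) *\<^sub>R G (fst z) (snd z)) * h (snd z))"
  have inth: "integrable lborel h"
  proof -
    have "h = (\<lambda>X. of_real (?d + k) * gauss 1 (2 *\<^sub>R w, 0) X + 2 * \<i> * (of_real ((w, 0) \<bullet> X) * gauss 1 (2 *\<^sub>R w, 0) X))"
      by (auto simp: h_def fun_eq_iff algebra_simps)
    moreover have "integrable lborel (\<lambda>X::'a \<times> 'a. complex_of_real (?d + k) * gauss 1 (2 *\<^sub>R w, 0) X)"
      by (intro integrable_mult_right impI integrable_gauss) simp
    moreover have "integrable lborel (\<lambda>X::'a \<times> 'a. 2 * \<i> * (of_real ((w, 0) \<bullet> X) * gauss 1 (2 *\<^sub>R w, 0) X))"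
      by (intro integrable_mult_right impI integrable_inner_gauss) simp
    ultimately show ?thesis by simp
  qed
  have intF: "integrable lborel F"
  proof (rule integrable_pair_bound)
    show "integrable lborel (indicator {0..pi / 2} :: real \<Rightarrow> real)" by simp
    show "integrable lborel (\<lambda>X. norm (h X))" by (rule integrable_norm[OF inth])
    have "(fst :: real \<times> ('a \<times> 'a) \<Rightarrow> real) \<in> borel_measurable borel"
      by (intro borel_measurable_continuous_onI continuous_intros)
    from measurable_compose[OF this, of "indicator {0..pi / 2} :: real \<Rightarrow> real"]
    have "(\<lambda>z::real \<times> ('a \<times> 'a). indicator {0..pi / 2} (fst z) :: real) \<in> borel_measurable borel"
      by simp
    moreover have "(\<lambda>z::real \<times> ('a \<times> 'a). G (fst z) (snd z)) \<in> borel_measurable borel"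
      unfolding G_def by (intro borel_measurable_continuous_onI continuous_intros)
    moreover have "(\<lambda>z::real \<times> ('a \<times> 'a). h (snd z)) \<in> borel_measurable borel"
      unfolding h_def by (intro borel_measurable_continuous_onI continuous_intros)
    ultimately show "F \<in> borel_measurable borel" unfolding F_def
      by (intro borel_measurable_times borel_measurable_scaleR)
    show "norm (F (\<theta>, X)) \<le> indicator {0..pi / 2} \<theta> * norm (h X)" for \<theta> X
      unfolding F_def G_def fst_conv snd_conv norm_mult[of _ "h X"]
      by (intro mult_right_mono profile_integrand_bound) auto
  qed
  have "(LINT X|lborel. inverse_oscillator_profile ?d (of_real ((norm X)\<^sup>2)) * h X) = (LINT X|lborel. LINT \<theta>|lborel. F (\<theta>, X))"
    unfolding inverse_oscillator_profile_def F_def G_def fst_conv snd_conv integral_mult_left_zero ..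
  also have "\<dots> = (LINT \<theta>|lborel. LINT X|lborel. F (\<theta>, X))"
    using lborel_pair.Fubini_integral[of "\<lambda>\<theta> X. F (\<theta>, X)"] intF by (simp add: case_prod_eta lborel_prod)
  also have "\<dots> = (LINT \<theta>|lborel. complex_of_real (pi ^ ?d * (indicator {0..pi / 2} \<theta> *\<^sub>R (cos \<theta> ^ (?d - 1) * ((real ?d + k - 2 * (k / (1 + sin \<theta>))) *
      ((1 / (1 + sin \<theta>)) ^ ?d * exp (- (k / (1 + sin \<theta>)))))))))"
  proof (rule Bochner_Integration.integral_cong[OF refl])
    fix \<theta> :: real
    show "(LINT X|lborel. F (\<theta>, X)) = complex_of_real (pi ^ ?d * (indicator {0..pi / 2} \<theta> *\<^sub>R (cos \<theta> ^ (?d - 1) * ((real ?d + k - 2 * (k / (1 + sin \<theta>))) *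
      ((1 / (1 + sin \<theta>)) ^ ?d * exp (- (k / (1 + sin \<theta>))))))))"
    proof (cases "\<theta> \<in> {0..pi / 2}")
      case True
      have pos: "1 + sin \<theta> > 0" using sin_cos_quadrant(1)[OF True] by simp
      have eqF: "F (\<theta>, X) = of_real (cos \<theta> ^ (?d - 1)) * ((complex_of_real (?d + k) + 2 * \<i> * of_real (w \<bullet> fst X)) * gauss (1 + sin \<theta>) (2 *\<^sub>R w, 0) X)" for X
      proof -
        have "exp (- (of_real ((norm X)\<^sup>2) * of_real (sin \<theta>))) * gauss 1 (2 *\<^sub>R w, 0) X = gauss (1 + sin \<theta>) (2 *\<^sub>R w, 0) X"
          unfolding gauss_def exp_add[symmetric] by (rule arg_cong[where f = exp]) (simp add: algebra_simps)
        then show ?thesis using True by (simp add: F_def G_def h_def mult_ac)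
      qed
      have "(LINT X|lborel. F (\<theta>, X)) = of_real (cos \<theta> ^ (?d - 1)) *
         ((complex_of_real (?d + k) - 2 * of_real (k / (1 + sin \<theta>))) * of_real ((pi / (1 + sin \<theta>)) ^ ?d * exp (- k / (1 + sin \<theta>))))"
        unfolding eqF integral_mult_right_zero k_def gaussian_moment_pair[OF pos] ..
      also have "\<dots> = complex_of_real (cos \<theta> ^ (?d - 1) * ((?d + k - 2 * (k / (1 + sin \<theta>))) * ((pi / (1 + sin \<theta>)) ^ ?d * exp (- k / (1 + sin \<theta>)))))"
        by simp
      also have "(pi / (1 + sin \<theta>)) ^ ?d = pi ^ ?d * (1 / (1 + sin \<theta>)) ^ ?d"
        by (simp add: power_divide)
      finally show ?thesis using True by (simp add: mult_ac)
    qed (simp add: F_def)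
  qed
  also have "\<dots> = of_real (pi ^ ?d * exp (- k))"
    unfolding integral_complex_of_real integral_mult_right_zero profile_theta_integral[OF DIM_positive] ..
  finally show ?thesis unfolding h_def k_def .
qed

section \<open>Power series\<close>

text \<open>Half the Beta value B((k+1)/2, (m+1)/2). For m = d - 1 these are the Taylor coefficients
  of the profile up to sign and factorial.\<close>

definition sin_cos_moment :: "nat \<Rightarrow> nat \<Rightarrow> real" where
  "sin_cos_moment k m = (LINT \<theta>|lborel. indicator {0..pi / 2} \<theta> *\<^sub>R (sin \<theta> ^ k * cos \<theta> ^ m))"

lemma integrable_sin_cos: "integrable lborel (\<lambda>\<theta>::real. indicator {0..pi / 2} \<theta> *\<^sub>R (sin \<theta> ^ k * cos \<theta> ^ m :: real))"
  by (intro integrable_indicator_scaleR continuous_intros)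

lemma sin_cos_moment_pythagoras:
  "sin_cos_moment k (m + 2) = sin_cos_moment k m - sin_cos_moment (k + 2) m"
proof -
  have "indicator {0..pi / 2} \<theta> *\<^sub>R (sin \<theta> ^ k * cos \<theta> ^ (m + 2)) =
     indicator {0..pi / 2} \<theta> *\<^sub>R (sin \<theta> ^ k * cos \<theta> ^ m) - indicator {0..pi / 2} \<theta> *\<^sub>R (sin \<theta> ^ (k + 2) * cos \<theta> ^ m)" for \<theta> :: real
    unfolding power_add cos_squared_eq by (simp add: algebra_simps)
  then show ?thesis
    unfolding sin_cos_moment_def
    using Bochner_Integration.integral_diff[OF integrable_sin_cos[of k m] integrable_sin_cos[of "k + 2" m]] by simp
qed

text \<open>sin^(k+1) cos^(m+1) vanishes at both ends of the interval, so its derivative integrates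
  to 0; \<open>sin_cos_moment_pythagoras\<close> then removes the exponent m + 2.\<close>

lemma sin_cos_moment_rec:
  "real (k + m + 2) * sin_cos_moment (k + 2) m = real (k + 1) * sin_cos_moment k m"
proof -
  define f where "f = (\<lambda>\<theta>. real (k + 1) * (sin \<theta> ^ k * cos \<theta> ^ (m + 2)) - real (m + 1) * (sin \<theta> ^ (k + 2) * cos \<theta> ^ m))"
  have der: "((\<lambda>\<theta>. sin \<theta> ^ (k + 1) * cos \<theta> ^ (m + 1)) has_vector_derivative f \<theta>) (at \<theta> within {0..pi / 2})" for \<theta>
  proof -
    have "((\<lambda>\<theta>. sin \<theta> ^ Suc k * cos \<theta> ^ Suc m) has_real_derivative
       ((1 + real k) * (cos \<theta> * sin \<theta> ^ k)) * cos \<theta> ^ Suc m + ((1 + real m) * (- sin \<theta> * cos \<theta> ^ m)) * sin \<theta> ^ Suc k) (at \<theta> within {0..pi / 2})"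
      by (intro DERIV_mult DERIV_power_Suc has_field_derivative_at_within[OF DERIV_sin] has_field_derivative_at_within[OF DERIV_cos])
    moreover have "((1 + real k) * (cos \<theta> * sin \<theta> ^ k)) * cos \<theta> ^ Suc m + ((1 + real m) * (- sin \<theta> * cos \<theta> ^ m)) * sin \<theta> ^ Suc k = f \<theta>"
      by (simp add: f_def power2_eq_square power_add mult_ac)
    ultimately show ?thesis by (simp add: has_real_derivative_iff_has_vector_derivative)
  qed
  have "(LINT \<theta>|lborel. indicator {0..pi / 2} \<theta> *\<^sub>R f \<theta>) = 0"
    using integral_FTC_atLeastAtMost[of 0 "pi / 2", OF _ der] unfolding f_def by (simp add: continuous_intros)
  moreover have "indicator {0..pi / 2} \<theta> *\<^sub>R f \<theta> = real (k + 1) * (indicator {0..pi / 2} \<theta> *\<^sub>R (sin \<theta> ^ k * cos \<theta> ^ (m + 2)))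
     - real (m + 1) * (indicator {0..pi / 2} \<theta> *\<^sub>R (sin \<theta> ^ (k + 2) * cos \<theta> ^ m))" for \<theta>
    by (simp add: f_def algebra_simps)
  moreover have "integrable lborel (\<lambda>\<theta>::real. real (k + 1) * (indicator {0..pi / 2} \<theta> *\<^sub>R (sin \<theta> ^ k * cos \<theta> ^ (m + 2))))"
    "integrable lborel (\<lambda>\<theta>::real. real (m + 1) * (indicator {0..pi / 2} \<theta> *\<^sub>R (sin \<theta> ^ (k + 2) * cos \<theta> ^ m)))"
    by (rule integrable_mult_right, rule integrable_sin_cos)+
  ultimately have "real (k + 1) * sin_cos_moment k (m + 2) - real (m + 1) * sin_cos_moment (k + 2) m = 0"
    unfolding sin_cos_moment_def by (simp only: Bochner_Integration.integral_diff integral_mult_right_zero)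
  then show ?thesis unfolding sin_cos_moment_pythagoras by (simp add: algebra_simps)
qed

lemma sin_cos_moment_0_rec: "real (m + 2) * sin_cos_moment 0 (m + 2) = real (m + 1) * sin_cos_moment 0 m"
  unfolding sin_cos_moment_pythagoras using sin_cos_moment_rec[of 0 m] by (simp add: algebra_simps)

lemma sin_cos_moment_1: "sin_cos_moment 1 m = 1 / (real m + 1)"
proof -
  have der: "((\<lambda>\<theta>. - (cos \<theta> ^ Suc m / (1 + real m))) has_vector_derivative sin \<theta> ^ 1 * cos \<theta> ^ m) (at \<theta> within {0..pi / 2})" for \<theta>
  proof -
    have "((\<lambda>\<theta>. - (cos \<theta> ^ Suc m / (1 + real m))) has_real_derivative - (((1 + real m) * (- sin \<theta> * cos \<theta> ^ m)) / (1 + real m))) (at \<theta> within {0..pi / 2})"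
      by (intro DERIV_minus DERIV_cdivide DERIV_power_Suc has_field_derivative_at_within[OF DERIV_cos])
    moreover have "- (((1 + real m) * (- sin \<theta> * cos \<theta> ^ m)) / (1 + real m)) = sin \<theta> ^ 1 * cos \<theta> ^ m"
      using of_nat_0_le_iff[of m, where 'a = real] by (simp add: field_simps)
    ultimately show ?thesis by (simp only: has_real_derivative_iff_has_vector_derivative)
  qed
  have "continuous_on {0..pi / 2} (\<lambda>\<theta>. sin \<theta> ^ 1 * cos \<theta> ^ m :: real)" by (intro continuous_intros)
  from integral_FTC_atLeastAtMost[OF _ der this] show ?thesis
    unfolding sin_cos_moment_def by (simp add: add.commute)
qed

lemma sin_cos_moment_0_0: "sin_cos_moment 0 0 = pi / 2"
  by (simp add: sin_cos_moment_def)

lemma sin_cos_moment_0_1: "sin_cos_moment 0 1 = 1"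
proof -
  have "continuous_on {0..pi / 2} (\<lambda>\<theta>. sin \<theta> ^ 0 * cos \<theta> ^ 1 :: real)" by (intro continuous_intros)
  from integral_FTC_atLeastAtMost[OF _ _ this, of sin] show ?thesis
    unfolding sin_cos_moment_def
    by (simp add: DERIV_sin has_field_derivative_at_within flip: has_real_derivative_iff_has_vector_derivative)
qed

section \<open>Closed forms of the moments\<close>

lemma semifactorial_pos: "semifactorial k > 0"
  by (induction k rule: semifactorial.induct) auto

lemma semifactorial_add_2: "semifactorial (k + 2) = (k + 2) * semifactorial k"
  by (simp add: numeral_2_eq_2)

text \<open>Wallis' formula. The recursion has step 2 and keeps the parity of m, so the starting
  values pi/2 and 1 survive as the constant; with m = d - 1 they become the two cases of alpha. The
  quotient (m+1)!! / (m+1) stands for (m-1)!! and also makes sense at m = 0; it is the source of d!!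
  / d.\<close>

lemma sin_cos_moment_0_closed:
  "sin_cos_moment 0 m = (if even m then pi / 2 else 1) * real (semifactorial (m + 1)) / (real (m + 1) * real (semifactorial m))"
proof (induction m rule: semifactorial.induct)
  case (3 m)
  have 1: "sin_cos_moment 0 (m + 2) = real (m + 1) * sin_cos_moment 0 m / real (m + 2)"
    using sin_cos_moment_0_rec[of m] by (simp add: field_simps)
  have 2: "semifactorial (m + 2) = (m + 2) * semifactorial m"
    "semifactorial (m + 2 + 1) = (m + 3) * semifactorial (m + 1)"
    using semifactorial_add_2[of m] semifactorial_add_2[of "m + 1"] by (simp_all add: numeral_3_eq_3 numeral_2_eq_2)
  have "sin_cos_moment 0 (m + 2) = (if even (m + 2) then pi / 2 else 1) * real (semifactorial (m + 2 + 1)) / (real (m + 2 + 1) * real (semifactorial (m + 2)))"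
  proof -
    have aux: "x * (a * u / (x * v)) / y = a * (z * u) / (z * (y * v))" if "x \<noteq> 0" "z \<noteq> 0" for a u v x y z :: real
      using that by simp
    have "even (m + 2) = even m" "m + 2 + 1 = m + 3" by simp_all
    then show ?thesis
      unfolding 1 2 3 of_nat_mult by (simp only: of_nat_mult) (rule aux, simp_all)
  qed
  then show ?case by (simp add: numeral_2_eq_2)
qed (simp_all add: sin_cos_moment_0_0 sin_cos_moment_0_1[unfolded One_nat_def])

text \<open>The shape of one induction step below: \<open>a\<close> occurs both in the recursion of
  the moments and in the factorial, and cancels.\<close>

lemma mult_divide_cancel_common:
  fixes a b c f j :: real
  assumes "a \<noteq> 0"
  shows "(a * j / b) / (c * (a * f)) = (j / f) / (c * b)"
  using assms by simp

text \<open>Passing from p to p + 1, the factorial gains (2p+2)(2p+1) and the moment gains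
  (2p+1)/(2p+d+1). After the factor 2p+1 cancels, the other two extend the two semifactorials by one
  step each.\<close>

lemma even_moment_closed:
  assumes d: "d > 0"
  shows "sin_cos_moment (2 * p) (d - 1) / fact (2 * p) = real (semifactorial d) / real d *
    ((if even d then 1 else pi / 2) / real (semifactorial (2 * p) * semifactorial (2 * p + d - 1)))"
proof (induction p)
  case 0
  obtain m where m: "d = Suc m" using d gr0_implies_Suc by blast
  show ?case using sin_cos_moment_0_closed[of m] by (simp add: m)
next
  case (Suc p)
  obtain m where m: "d = Suc m" using d gr0_implies_Suc by blast
  have 1: "sin_cos_moment (2 * p + 2) m = real (2 * p + 1) * sin_cos_moment (2 * p) m / real (2 * p + m + 2)"
    using sin_cos_moment_rec[of "2 * p" m] by (simp add: field_simps)
  have "fact (2 * p + 2) = real (2 * p + 2) * (real (2 * p + 1) * fact (2 * p))"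
    by (simp add: algebra_simps)
  then have "sin_cos_moment (2 * p + 2) m / fact (2 * p + 2) = (sin_cos_moment (2 * p) m / fact (2 * p)) / (real (2 * p + 2) * real (2 * p + m + 2))"
    unfolding 1 by (simp only:) (rule mult_divide_cancel_common, simp)
  also have "sin_cos_moment (2 * p) m / fact (2 * p) = real (semifactorial d) / real d *
    ((if even d then 1 else pi / 2) / real (semifactorial (2 * p) * semifactorial (2 * p + m)))"
    using Suc by (simp add: m)
  also have "real (semifactorial d) / real d *
    ((if even d then 1 else pi / 2) / real (semifactorial (2 * p) * semifactorial (2 * p + m))) / (real (2 * p + 2) * real (2 * p + m + 2)) =
    real (semifactorial d) / real d *
    ((if even d then 1 else pi / 2) / real (semifactorial (2 * p + 2) * semifactorial (2 * p + m + 2)))"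
    unfolding semifactorial_add_2 of_nat_mult by (simp only: divide_divide_eq_left times_divide_eq_right mult_ac)
  finally show ?case by (simp add: m)
qed

text \<open>The recursion starts from the elementary moment 1/d for every d, so both parities of d
  share the constant 1 here. The d!! in front cancels the second semifactorial at p = 0.\<close>

lemma odd_moment_closed:
  assumes d: "d > 0"
  shows "sin_cos_moment (2 * p + 1) (d - 1) / fact (2 * p + 1) = real (semifactorial d) / real d *
    (1 / real (semifactorial (2 * p + 1) * semifactorial (2 * p + d)))"
proof (induction p)
  case 0
  show ?case using sin_cos_moment_1[of "d - 1"] semifactorial_pos[of d] d by (simp add: of_nat_diff)
next
  case (Suc p)
  obtain m where m: "d = Suc m" using d gr0_implies_Suc by blast
  have 1: "sin_cos_moment (2 * p + 1 + 2) m = real (2 * p + 2) * sin_cos_moment (2 * p + 1) m / real (2 * p + m + 3)"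
    using sin_cos_moment_rec[of "2 * p + 1" m] by (simp add: field_simps)
  have "fact (2 * p + 1 + 2) = real (2 * p + 3) * (real (2 * p + 2) * fact (2 * p + 1))"
    by (simp add: algebra_simps numeral_3_eq_3)
  then have "sin_cos_moment (2 * p + 1 + 2) m / fact (2 * p + 1 + 2) = (sin_cos_moment (2 * p + 1) m / fact (2 * p + 1)) / (real (2 * p + 3) * real (2 * p + m + 3))"
    unfolding 1 by (simp only:) (rule mult_divide_cancel_common, simp)
  also have "sin_cos_moment (2 * p + 1) m / fact (2 * p + 1) = real (semifactorial d) / real d *
    (1 / real (semifactorial (2 * p + 1) * semifactorial (2 * p + d)))"
    using Suc by (simp add: m)
  also have "real (semifactorial d) / real d * (1 / real (semifactorial (2 * p + 1) * semifactorial (2 * p + d))) / (real (2 * p + 3) * real (2 * p + m + 3)) =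
    real (semifactorial d) / real d * (1 / real (semifactorial (2 * p + 1 + 2) * semifactorial (2 * p + d + 2)))"
  proof -
    have "2 * p + 3 = 2 * p + 1 + 2" "2 * p + m + 3 = 2 * p + d + 2" by (simp_all add: m)
    then show ?thesis
      unfolding semifactorial_add_2 of_nat_mult by (simp only: divide_divide_eq_left times_divide_eq_right mult_ac)
  qed
  finally show ?case by (simp add: m)
qed

text \<open>The exponential is expanded under the integral. Sine and cosine lie between 0 and 1 on
  the interval, so the terms are dominated by |z|^n / n!, which justifies termwise integration for
  every z. The absolute version serves to separate even from odd powers.\<close>

lemma inverse_oscillator_profile_sums:
  "(\<lambda>n. (- z) ^ n * of_real (sin_cos_moment n (d - 1) / fact n)) sums inverse_oscillator_profile d z"
  and summable_norm_inverse_oscillator_profile: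
  "summable (\<lambda>n. norm ((- z) ^ n * of_real (sin_cos_moment n (d - 1) / fact n)))"
proof -
  define f where "f = (\<lambda>n \<theta>. indicator {0..pi / 2} \<theta> *\<^sub>R (of_real (cos \<theta> ^ (d - 1)) * ((- (z * of_real (sin \<theta>))) ^ n /\<^sub>R fact n)))"
  have f_eq: "f n \<theta> = (- z) ^ n * of_real ((indicator {0..pi / 2} \<theta> *\<^sub>R (sin \<theta> ^ n * cos \<theta> ^ (d - 1))) / fact n)" for n \<theta>
  proof -
    have "(- (z * of_real (sin \<theta>))) ^ n = (- z) ^ n * of_real (sin \<theta> ^ n)"
    proof -
      have "- (z * of_real (sin \<theta>)) = (- z) * of_real (sin \<theta>)" by simp
      then show ?thesis by (simp only: power_mult_distrib of_real_power)
    qed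
    moreover have "i *\<^sub>R (of_real c * ((Z * of_real s) /\<^sub>R g)) = Z * of_real ((i *\<^sub>R (s * c)) / g)"
      for i c s g :: real and Z :: complex
      by (simp add: scaleR_conv_of_real divide_inverse mult_ac)
    ultimately show ?thesis by (simp only: f_def)
  qed
  have int_f: "integrable lborel (f n)" for n
    unfolding f_def by (intro integrable_indicator_scaleR continuous_intros)
  have I: "(LINT \<theta>|lborel. f n \<theta>) = (- z) ^ n * of_real (sin_cos_moment n (d - 1) / fact n)" for n
    unfolding f_eq integral_mult_right_zero integral_complex_of_real integral_divide_zero sin_cos_moment_def ..
  have bound: "norm (f n \<theta>) \<le> (norm z ^ n / fact n) * indicator {0..pi / 2} \<theta>" for n \<theta>
  proof (cases "\<theta> \<in> {0..pi / 2}")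
    case True
    note sc = sin_cos_quadrant[OF True]
    have "sin \<theta> ^ n * cos \<theta> ^ (d - 1) \<le> 1 * 1"
      using sc by (intro mult_mono) (auto simp: power_le_one)
    moreover have "0 \<le> sin \<theta> ^ n * cos \<theta> ^ (d - 1)" using sc by simp
    ultimately have "\<bar>sin \<theta> ^ n * cos \<theta> ^ (d - 1) / fact n\<bar> \<le> 1 / fact n"
      by (simp add: abs_mult divide_right_mono)
    then have "norm z ^ n * \<bar>sin \<theta> ^ n * cos \<theta> ^ (d - 1) / fact n\<bar> \<le> norm z ^ n * (1 / fact n)"
      by (rule mult_left_mono) simp
    then show ?thesis
      using True unfolding f_eq norm_mult norm_of_real norm_power by simp
  qed (simp add: f_eq)
  have sb: "summable (\<lambda>n. (norm z ^ n / fact n) * (pi / 2))"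
    using summable_exp[of "norm z"] by (intro summable_mult2) (simp add: divide_inverse mult.commute)
  have nI: "(LINT \<theta>|lborel. norm (f n \<theta>)) \<le> (norm z ^ n / fact n) * (pi / 2)" for n
  proof -
    have "(LINT \<theta>|lborel. norm (f n \<theta>)) \<le> (LINT \<theta>|lborel. (norm z ^ n / fact n) * indicator {0..pi / 2} \<theta>)"
      by (rule integral_mono) (use int_f bound in auto)
    then show ?thesis by simp
  qed
  have s1: "summable (\<lambda>n. LINT \<theta>|lborel. norm (f n \<theta>))"
    by (rule summable_comparison_test'[OF sb, of 0]) (use nI in \<open>simp add: Bochner_Integration.integral_nonneg\<close>)
  have "(\<lambda>n. integral\<^sup>L lborel (f n)) sums (LINT \<theta>|lborel. (\<Sum>n. f n \<theta>))"
  proof (rule sums_integral)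
    show "AE \<theta> in lborel. summable (\<lambda>n. norm (f n \<theta>))"
    proof (rule AE_I2)
      fix \<theta>
      have "summable (\<lambda>n. (norm z ^ n / fact n) * indicator {0..pi / 2} \<theta>)"
        using summable_exp[of "norm z"] by (intro summable_mult2) (simp add: divide_inverse mult.commute)
      then show "summable (\<lambda>n. norm (f n \<theta>))"
        by (rule summable_comparison_test'[of _ 0]) (use bound[of _ \<theta>] in simp)
    qed
  qed (use int_f s1 in auto)
  moreover have "(\<Sum>n. f n \<theta>) = indicator {0..pi / 2} \<theta> *\<^sub>R (of_real (cos \<theta> ^ (d - 1)) * exp (- (z * of_real (sin \<theta>))))" for \<theta>
  proof -
    have "(\<lambda>n. (- (z * of_real (sin \<theta>))) ^ n /\<^sub>R fact n) sums exp (- (z * of_real (sin \<theta>)))"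
      by (rule exp_converges)
    then have "(\<lambda>n. f n \<theta>) sums (indicator {0..pi / 2} \<theta> *\<^sub>R (of_real (cos \<theta> ^ (d - 1)) * exp (- (z * of_real (sin \<theta>)))))"
      unfolding f_def by (intro sums_scaleR_right sums_mult)
    then show ?thesis by (rule sums_unique[symmetric])
  qed
  ultimately show "(\<lambda>n. (- z) ^ n * of_real (sin_cos_moment n (d - 1) / fact n)) sums inverse_oscillator_profile d z"
    unfolding I inverse_oscillator_profile_def by simp
  show "summable (\<lambda>n. norm ((- z) ^ n * of_real (sin_cos_moment n (d - 1) / fact n)))"
    unfolding I[symmetric]
    by (rule summable_comparison_test'[OF sb, of 0]) (simp only: real_norm_def abs_norm_cancel, rule order_trans[OF integral_norm_bound nI])
qed

lemma inverse_oscillator_profile_holomorphic: "inverse_oscillator_profile d holomorphic_on A"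
proof -
  have "inverse_oscillator_profile d field_differentiable (at z)" for z
  proof (rule holomorphic_on_imp_differentiable_at)
    \<comment> \<open>Any open ball about 0 that contains z would do, as the series converges
      everywhere.\<close>
    show "inverse_oscillator_profile d holomorphic_on ball 0 (norm z + 1)"
    proof (rule power_series_holomorphic)
      fix u
      show "(\<lambda>n. ((- 1) ^ n * of_real (sin_cos_moment n (d - 1) / fact n)) * (u - 0) ^ n) sums inverse_oscillator_profile d u"
        using inverse_oscillator_profile_sums[of u d] unfolding power_minus[of u] by (simp add: mult_ac)
    qed
  qed auto
  then show ?thesis by (simp add: holomorphic_on_def field_differentiable_at_within)
qed

lemma inverse_oscillator_profile_series:
  fixes t :: complex
  assumes d: "d > 0" and \<alpha>: "\<alpha> = (if even d then 1 else pi / 2)"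
  shows "inverse_oscillator_profile d t = of_real (real (semifactorial d) / real d) *
      (of_real \<alpha> *
         (\<Sum>p. t ^ (2 * p) / of_nat (semifactorial (2 * p) * semifactorial (2 * p + d - 1)))
       - (\<Sum>p. t ^ (2 * p + 1) / of_nat (semifactorial (2 * p + 1) * semifactorial (2 * p + d))))"
proof -
  define a where "a = (\<lambda>n. (- t) ^ n * complex_of_real (sin_cos_moment n (d - 1) / fact n))"
  define K where "K = complex_of_real (real (semifactorial d) / real d)"
  define E where "E = (\<lambda>p. t ^ (2 * p) / of_nat (semifactorial (2 * p) * semifactorial (2 * p + d - 1)))"
  define O' where "O' = (\<lambda>p. t ^ (2 * p + 1) / of_nat (semifactorial (2 * p + 1) * semifactorial (2 * p + d)))"
  \<comment> \<open>Pulling constants out of the two series presupposes that these converge; their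
    summability is recovered from that of the even and odd terms by dividing by \<open>K\<close> and
    \<open>\<alpha>\<close>.\<close>
  have K: "K \<noteq> 0" using d semifactorial_pos[of d] by (simp add: K_def)
  have \<alpha>0: "\<alpha> \<noteq> 0" by (simp add: \<alpha>)
  have ev: "a (2 * p) = K * of_real \<alpha> * E p" for p
    unfolding a_def even_moment_closed[OF d] K_def E_def \<alpha> by (simp add: divide_inverse mult_ac)
  have od: "a (2 * p + 1) = - K * O' p" for p
    unfolding a_def odd_moment_closed[OF d] K_def O'_def by (simp add: divide_inverse mult_ac)
  have sa: "summable (\<lambda>n. norm (a n))" unfolding a_def by (rule summable_norm_inverse_oscillator_profile)
  have "summable (\<lambda>p. norm (a (2 * p)))"
    using summable_reindex[OF sa, of "\<lambda>p. 2 * p"] by (auto simp: inj_on_def o_def)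
  then have "summable (\<lambda>p. K * of_real \<alpha> * E p)" unfolding ev[symmetric] by (rule summable_norm_cancel)
  then have sE: "summable E" using K \<alpha>0 by (simp add: summable_cmult_iff)
  have "summable (\<lambda>p. norm (a (2 * p + 1)))"
    using summable_reindex[OF sa, of "\<lambda>p. 2 * p + 1"] by (auto simp: inj_on_def o_def)
  then have "summable (\<lambda>p. - K * O' p)" unfolding od[symmetric] by (rule summable_norm_cancel)
  then have sO: "summable O'" using K by (simp add: summable_minus_iff summable_cmult_iff)
  have "(\<lambda>p. a (2 * p)) sums (K * of_real \<alpha> * suminf E)"
    unfolding ev by (intro sums_mult summable_sums sE)
  moreover have "(\<lambda>p. a (2 * p + 1)) sums (- K * suminf O')"
    unfolding od by (intro sums_mult summable_sums sO)
  ultimately have "(\<lambda>p. a (2 * p) + a (2 * p + 1)) sums (K * of_real \<alpha> * suminf E + - K * suminf O')"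
    by (rule sums_add)
  moreover have "(\<lambda>p. a (2 * p) + a (2 * p + 1)) sums inverse_oscillator_profile d t"
  proof -
    have "a sums inverse_oscillator_profile d t" unfolding a_def by (rule inverse_oscillator_profile_sums)
    \<comment> \<open>Blocks of length 2 pair the terms of index 2 p and 2 p + 1.\<close>
    from sums_group[OF this, of 2] show ?thesis
      by (simp add: mult.commute numeral_2_eq_2 sum.atLeastLessThan_Suc)
  qed
  ultimately have "inverse_oscillator_profile d t = K * of_real \<alpha> * suminf E + - K * suminf O'"
    by (rule sums_unique2[symmetric])
  then show ?thesis unfolding K_def E_def O'_def by (simp only:) (simp add: algebra_simps)
qed

section \<open>Identification of the symbol\<close>

lemma weyl_symbol_inverse_oscillator:
  fixes c :: "complex \<Rightarrow> complex"
  assumes entire: "c holomorphic_on UNIV"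
    and symbol: "is_weyl_symbol
      (\<lambda>X :: 'a::euclidean_space \<times> 'a. c (of_real ((norm X)\<^sup>2))) harmonic_oscillator_inverse"
  shows "c t = inverse_oscillator_profile DIM('a) t"
proof -
  let ?d = "DIM('a)"
  define b where "b = (\<lambda>X :: 'a \<times> 'a. c (of_real ((norm X)\<^sup>2)))"
  define b0 where "b0 = (\<lambda>X :: 'a \<times> 'a. inverse_oscillator_profile ?d (of_real ((norm X)\<^sup>2)))"
  have sb: "b \<in> symbol_class" using symbol by (simp add: is_weyl_symbol_def b_def)
  have cont: "continuous_on UNIV b" by (rule symbol_class_continuous[OF sb])
  have cont0: "continuous_on UNIV b0"
    unfolding b0_def
    by (rule continuous_on_compose2[OF holomorphic_on_imp_continuous_on[OF inverse_oscillator_profile_holomorphic[of ?d UNIV]]])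
      (auto intro!: continuous_intros)
  obtain B m where B: "B \<ge> 0" "\<And>X. norm (b X) \<le> B * (1 + norm X) ^ m"
    using symbol_class_bound[OF sb] by metis
  \<comment> \<open>The profile is bounded on the half line; the constant bound is relaxed to the
    power m so that the difference of the symbols has a single growth bound.\<close>
  have B0: "norm (b0 X) \<le> (pi / 2) * (1 + norm X) ^ m" for X
  proof -
    have "norm (b0 X) \<le> (pi / 2) * 1" unfolding b0_def using norm_inverse_oscillator_profile_le by simp
    also have "\<dots> \<le> (pi / 2) * (1 + norm X) ^ m" by (intro mult_left_mono one_le_power) auto
    finally show ?thesis .
  qed
  have "b Y - b0 Y = 0" for Y
  proof (rule radial_symbol_eq_0)
    show "b X - b0 X = b Y - b0 Y" if "norm X = norm Y" for X Y
      using that by (simp add: b_def b0_def)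
    show "continuous_on UNIV (\<lambda>X. b X - b0 X)" by (intro continuous_intros cont cont0)
    show "norm (b X - b0 X) \<le> (B + pi / 2) * (1 + norm X) ^ m" for X
      using norm_triangle_ineq4[of "b X" "b0 X"] B(2)[of X] B0[of X] unfolding distrib_right by linarith
    fix w :: 'a
    let ?h = "\<lambda>X. (of_real (?d + (norm w)\<^sup>2) + 2 * \<i> * of_real (w \<bullet> fst X)) * gauss 1 (2 *\<^sub>R w, 0) X"
    have "integrable lborel (\<lambda>X. b X * ?h X)"
      by (rule integrable_symbol_moment_gauss[OF borel_measurable_continuous_onI[OF cont] B(2)])
    moreover have "integrable lborel (\<lambda>X. b0 X * ?h X)"
      by (rule integrable_symbol_moment_gauss[OF borel_measurable_continuous_onI[OF cont0] B0])
    ultimately have "(LINT X|lborel. b X * ?h X - b0 X * ?h X) = (LINT X|lborel. b X * ?h X) - (LINT X|lborel. b0 X * ?h X)"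
      by (rule Bochner_Integration.integral_diff)
    also have "(LINT X|lborel. b X * ?h X) = of_real (pi ^ ?d * exp (- (norm w)\<^sup>2))"
      using symbol unfolding b_def by (rule weyl_gaussian_identity) (simp add: norm_Pair)
    also have "(LINT X|lborel. b0 X * ?h X) = of_real (pi ^ ?d * exp (- (norm w)\<^sup>2))"
      unfolding b0_def by (rule profile_gaussian_identity)
    finally show "(LINT X|lborel. (b X - b0 X) * ?h X) = 0" by (simp only: left_diff_distrib) simp
  qed
  then have eq: "c (of_real r) - inverse_oscillator_profile ?d (of_real r) = 0" if "r \<ge> 0" for r
  proof -
    obtain i :: 'a where i: "i \<in> Basis" using nonempty_Basis by blast
    \<comment> \<open>Every r >= 0 is a squared norm in phase space, so the vanishing of the radial
      difference reaches the whole half line.\<close>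
    have "(norm (sqrt r *\<^sub>R i, 0 :: 'a))\<^sup>2 = r" using i that by (simp add: norm_Pair)
    with \<open>\<And>Y. b Y - b0 Y = 0\<close>[of "(sqrt r *\<^sub>R i, 0)"] show ?thesis by (simp only: b_def b0_def)
  qed
  have "c t - inverse_oscillator_profile ?d t = 0"
  proof (rule analytic_continuation[where f = "\<lambda>z. c z - inverse_oscillator_profile ?d z" and S = UNIV and U = "of_real ` {0..}" and \<xi> = 0])
    show "(\<lambda>z. c z - inverse_oscillator_profile ?d z) holomorphic_on UNIV"
      by (intro holomorphic_on_diff entire inverse_oscillator_profile_holomorphic)
    \<comment> \<open>The identity theorem asks for an accumulation point of the zeros; the points e
      / 2 of the half line provide 0.\<close>
    show "(0::complex) islimpt of_real ` {0..}"
      unfolding islimpt_approachable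
    proof (intro allI impI)
      fix e :: real assume "e > 0"
      then show "\<exists>x'\<in>complex_of_real ` {0..}. x' \<noteq> 0 \<and> dist x' 0 < e"
        by (intro bexI[of _ "of_real (e / 2)"] conjI imageI) auto
    qed
  qed (use eq in auto)
  then show ?thesis by simp
qed

theorem proposition4p1:
  fixes c :: "complex \<Rightarrow> complex" and d :: nat and \<alpha> :: real
  assumes d: "d = CARD('n::finite)"
    and entire: "c holomorphic_on UNIV"
    and symbol: "is_weyl_symbol
      (\<lambda>X :: (real ^ 'n) \<times> (real ^ 'n). c (of_real ((norm X)\<^sup>2))) harmonic_oscillator_inverse"
    and \<alpha>: "\<alpha> = (if even d then 1 else pi / 2)"
  shows "\<forall>t :: complex.
    c t = of_real (real (semifactorial d) / real d) *
      (of_real \<alpha> *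
         (\<Sum>p. t ^ (2 * p) / of_nat (semifactorial (2 * p) * semifactorial (2 * p + d - 1)))
       - (\<Sum>p. t ^ (2 * p + 1) / of_nat (semifactorial (2 * p + 1) * semifactorial (2 * p + d))))"
proof
  fix t :: complex
  have "d > 0" using d by simp
  have "c t = inverse_oscillator_profile DIM(real ^ 'n) t"
    by (rule weyl_symbol_inverse_oscillator[OF entire symbol])
  also have "DIM(real ^ 'n) = d" using d by simp
  finally show "c t = of_real (real (semifactorial d) / real d) *
      (of_real \<alpha> *
         (\<Sum>p. t ^ (2 * p) / of_nat (semifactorial (2 * p) * semifactorial (2 * p + d - 1)))
       - (\<Sum>p. t ^ (2 * p + 1) / of_nat (semifactorial (2 * p + 1) * semifactorial (2 * p + d))))"
    by (simp only: inverse_oscillator_profile_series[OF \<open>d > 0\<close> \<alpha>])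
qed

end
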